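(* Let $X$ be an infinite-dimensional quasi-reflexive (in particular, possibly reflexive) Banach space. Then: (i) $S_X$ contains a symmetrically $(1+)$-separated subset with cardinality $\mathrm{dens}\, X$; (ii) for every cardinal number $\kappa\leq\mathrm{dens}\, X$ with uncountable cofinality there exist $\varepsilon>0$ and a symmetrically $(1+\varepsilon)$-separated subset of $S_X$ of cardinality $\kappa$; (iii) if $X$ is super-reflexive, there exist $\varepsilon>0$ and a symmetrically $(1+\varepsilon)$-separated subset of $S_X$ of cardinality $\mathrm{dens}\, X$.
   Context: Banach spaces are over the real or the complex field. A Banach space $X$ is quasi-reflexive if the canonical image of $X$ in its bidual $X^{**}$ has finite codimension (so reflexive spaces are quasi-reflexive). $\mathrm{dens}\,X$ is the density character of $X$ and $S_X$ its unit sphere. For $\delta>0$, a subset $A$ of a normed space is symmetrically $(\delta+)$-separated if $\|x-y\|>\delta$ and $\|x+y\|>\delta$ for all distinct $x,y\in A$, and symmetrically $\delta$-separated if $\|x-y\|\geq\delta$ and $\|x+y\|\geq\delta$ for all distinct $x,y\in A$. *)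

theory Defs
  imports "HOL-Analysis.Analysis"
begin

unbundle cardinal_syntax

section \<open>Scalar fields\<close>

class real_or_complex = real_normed_field +
  assumes real_or_complex:
    "(\<forall>z. \<exists>a. z = a *\<^sub>R 1) \<or>
     (\<exists>i. i * i = - 1 \<and> (\<forall>z. \<exists>a b. z = a *\<^sub>R 1 + b *\<^sub>R i))"

instance real :: real_or_complex
  by standard simp

instance complex :: real_or_complex
proof
  have "\<i> * \<i> = - 1 \<and> (\<forall>z. \<exists>a b. z = a *\<^sub>R 1 + b *\<^sub>R \<i>)"
    by (auto simp: complex_eq_iff)
  then show "(\<forall>z::complex. \<exists>a. z = a *\<^sub>R 1) \<or>
     (\<exists>i::complex. i * i = - 1 \<and> (\<forall>z. \<exists>a b. z = a *\<^sub>R 1 + b *\<^sub>R i))"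
    by blast
qed


section \<open>Normed spaces with an explicit carrier\<close>

text \<open>
  Explicit carriers are needed because duals must be formed over either scalar field, and because
  super-reflexivity quantifies over Banach spaces inside a formula.
\<close>

record ('k, 'v) nspace =
  vcarrier :: "'v set"
  vzero :: 'v
  vadd :: "'v \<Rightarrow> 'v \<Rightarrow> 'v"
  vsmul :: "'k \<Rightarrow> 'v \<Rightarrow> 'v"
  vnorm :: "'v \<Rightarrow> real"

definition vdiff :: "('k::ring_1, 'v) nspace \<Rightarrow> 'v \<Rightarrow> 'v \<Rightarrow> 'v" where
  "vdiff V x y = vadd V x (vsmul V (- 1) y)"

locale normed_space =
  fixes V :: "('k::real_or_complex, 'v) nspace"
  assumes zero_closed: "vzero V \<in> vcarrier V"
    and add_closed: "\<lbrakk>x \<in> vcarrier V; y \<in> vcarrier V\<rbrakk> \<Longrightarrow> vadd V x y \<in> vcarrier V"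
    and smul_closed: "x \<in> vcarrier V \<Longrightarrow> vsmul V c x \<in> vcarrier V"
    and add_assoc: "\<lbrakk>x \<in> vcarrier V; y \<in> vcarrier V; z \<in> vcarrier V\<rbrakk>
      \<Longrightarrow> vadd V (vadd V x y) z = vadd V x (vadd V y z)"
    and add_commute: "\<lbrakk>x \<in> vcarrier V; y \<in> vcarrier V\<rbrakk> \<Longrightarrow> vadd V x y = vadd V y x"
    and add_zero: "x \<in> vcarrier V \<Longrightarrow> vadd V x (vzero V) = x"
    and diff_self: "x \<in> vcarrier V \<Longrightarrow> vdiff V x x = vzero V"
    and smul_add_right: "\<lbrakk>x \<in> vcarrier V; y \<in> vcarrier V\<rbrakk>
      \<Longrightarrow> vsmul V c (vadd V x y) = vadd V (vsmul V c x) (vsmul V c y)"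
    and smul_add_left: "x \<in> vcarrier V
      \<Longrightarrow> vsmul V (c + d) x = vadd V (vsmul V c x) (vsmul V d x)"
    and smul_smul: "x \<in> vcarrier V \<Longrightarrow> vsmul V c (vsmul V d x) = vsmul V (c * d) x"
    and smul_one: "x \<in> vcarrier V \<Longrightarrow> vsmul V 1 x = x"
    and norm_eq_zero: "x \<in> vcarrier V \<Longrightarrow> vnorm V x = 0 \<longleftrightarrow> x = vzero V"
    and norm_triangle: "\<lbrakk>x \<in> vcarrier V; y \<in> vcarrier V\<rbrakk>
      \<Longrightarrow> vnorm V (vadd V x y) \<le> vnorm V x + vnorm V y"
    and norm_smul: "x \<in> vcarrier V \<Longrightarrow> vnorm V (vsmul V c x) = norm c * vnorm V x"

locale banach_space = normed_space +
  assumes complete: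
    "\<lbrakk>\<And>n. s n \<in> vcarrier V;
      \<And>e. e > 0 \<Longrightarrow> \<exists>N. \<forall>m\<ge>N. \<forall>n\<ge>N. vnorm V (vdiff V (s m) (s n)) < e\<rbrakk>
     \<Longrightarrow> \<exists>l\<in>vcarrier V. (\<lambda>n. vnorm V (vdiff V (s n) l)) \<longlonglongrightarrow> 0"

text \<open>
  A Banach space over \<open>'k\<close> whose carrier is a type: the norm and the addition are those of the type
  class, the scalar multiplication is a parameter. If the result is a normed space, the multiplication
  necessarily extends \<open>scaleR\<close>, since \<open>r \<mapsto> sc (of_real r) x\<close> is additive and continuous.
\<close>

definition type_space :: "('k \<Rightarrow> 'a \<Rightarrow> 'a) \<Rightarrow> ('k, 'a::real_normed_vector) nspace" where
  "type_space sc =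
     \<lparr>vcarrier = UNIV, vzero = 0, vadd = (+), vsmul = sc, vnorm = norm\<rparr>"

lemma banach_space_type_space:
  fixes sc :: "'k::real_or_complex \<Rightarrow> 'a::banach \<Rightarrow> 'a"
  assumes "vector_space sc" and nrm: "\<And>c x. norm (sc c x) = norm c * norm x"
  shows "banach_space (type_space sc)"
proof -
  interpret vector_space sc by fact
  have diff: "vdiff (type_space sc) x y = x - y" for x y
    by (simp add: vdiff_def type_space_def)
  show ?thesis
  proof (unfold_locales, goal_cases)
    case (15 s)
    then have "Cauchy s"
      unfolding diff by (simp add: Cauchy_iff type_space_def)
    then obtain l where "s \<longlonglongrightarrow> l"
      using Cauchy_convergent convergent_def by blast
    then have "(\<lambda>n. norm (s n - l)) \<longlonglongrightarrow> 0"
      using LIM_zero tendsto_norm_zero by blast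
    then show ?case
      unfolding diff by (auto simp: type_space_def)
  next
    case (7 x)
    then show ?case
      unfolding diff by (simp add: type_space_def)
  qed (simp_all add: type_space_def nrm norm_triangle_ineq scale_right_distrib
      scale_left_distrib add_ac)
qed

lemma banach_space_scaleR: "banach_space (type_space ((*\<^sub>R) :: real \<Rightarrow> 'a::banach \<Rightarrow> 'a))"
  by (rule banach_space_type_space) (auto intro: real_vector.vector_space_axioms)

lemma banach_space_complex_times: "banach_space (type_space ((*) :: complex \<Rightarrow> _))"
  by (rule banach_space_type_space)
    (auto simp: norm_mult vector_space_def algebra_simps)


section \<open>Subspaces\<close>

definition vsubspace :: "('k, 'v) nspace \<Rightarrow> 'v set \<Rightarrow> bool" where
  "vsubspace V E \<longleftrightarrow> E \<subseteq> vcarrier V \<and> vzero V \<in> E \<and>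
     (\<forall>x\<in>E. \<forall>y\<in>E. vadd V x y \<in> E) \<and> (\<forall>c. \<forall>x\<in>E. vsmul V c x \<in> E)"

definition vspan :: "('k, 'v) nspace \<Rightarrow> 'v set \<Rightarrow> 'v set" where
  "vspan V B = vsubspace V hull B"

definition fin_dim_subspace :: "('k, 'v) nspace \<Rightarrow> 'v set \<Rightarrow> bool" where
  "fin_dim_subspace V E \<longleftrightarrow> (\<exists>B. finite B \<and> B \<subseteq> vcarrier V \<and> E = vspan V B)"

definition infinite_dimensional :: "('k, 'v) nspace \<Rightarrow> bool" where
  "infinite_dimensional V \<longleftrightarrow> \<not> fin_dim_subspace V (vcarrier V)"

definition finite_codimension :: "('k, 'v) nspace \<Rightarrow> 'v set \<Rightarrow> bool" where
  "finite_codimension V E \<longleftrightarrow>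
     (\<exists>B. finite B \<and> B \<subseteq> vcarrier V \<and> vspan V (E \<union> B) = vcarrier V)"

definition vlinear_on :: "('k, 'v) nspace \<Rightarrow> ('k, 'w) nspace \<Rightarrow> 'v set \<Rightarrow> ('v \<Rightarrow> 'w) \<Rightarrow> bool" where
  "vlinear_on V W E T \<longleftrightarrow> (\<forall>x\<in>E. T x \<in> vcarrier W) \<and>
     (\<forall>x\<in>E. \<forall>y\<in>E. T (vadd V x y) = vadd W (T x) (T y)) \<and>
     (\<forall>c. \<forall>x\<in>E. T (vsmul V c x) = vsmul W c (T x))"


section \<open>Duality\<close>

definition scalar_space :: "('k::real_normed_field, 'k) nspace" where
  "scalar_space = type_space (*)"

text \<open>
  Functionals are set to 0 outside the carrier, so that distinct elements of the dual are distinct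
  as functionals on the space.
\<close>

definition dual :: "('k::real_normed_field, 'v) nspace \<Rightarrow> ('k, 'v \<Rightarrow> 'k) nspace" where
  "dual V =
     \<lparr>vcarrier = {f. vlinear_on V scalar_space (vcarrier V) f \<and>
                    (\<exists>C. \<forall>x\<in>vcarrier V. norm (f x) \<le> C * vnorm V x) \<and>
                    (\<forall>x. x \<notin> vcarrier V \<longrightarrow> f x = 0)},
      vzero = (\<lambda>x. 0),
      vadd = (\<lambda>f g x. f x + g x),
      vsmul = (\<lambda>c f x. c * f x),
      vnorm = (\<lambda>f. SUP x\<in>{x \<in> vcarrier V. vnorm V x \<le> 1}. norm (f x))\<rparr>"

lemma (in normed_space) normed_space_dual: "normed_space (dual V)"
proof -
  let ?B = "{x \<in> vcarrier V. vnorm V x \<le> 1}"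
  note defs = dual_def vlinear_on_def scalar_space_def type_space_def
  have norm_zero: "vnorm V (vzero V) = 0"
    using norm_eq_zero zero_closed by blast
  have ne: "vzero V \<in> ?B"
    using zero_closed norm_zero by simp
  have norm_nonneg: "0 \<le> vnorm V x" if x: "x \<in> vcarrier V" for x
  proof -
    have "vnorm V (vdiff V x x) \<le> vnorm V x + vnorm V x"
      using norm_triangle[OF x smul_closed[OF x, of "- 1"]] norm_smul[OF x, of "- 1"]
      by (simp add: vdiff_def)
    then show ?thesis
      using diff_self[OF x] norm_zero by simp
  qed
  have bdd: "bdd_above ((\<lambda>x. norm (f x)) ` ?B)" if f: "f \<in> vcarrier (dual V)" for f
  proof -
    obtain C where C: "\<And>x. x \<in> vcarrier V \<Longrightarrow> norm (f x) \<le> C * vnorm V x"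
      using f by (force simp: defs)
    have "norm (f x) \<le> \<bar>C\<bar>" if x: "x \<in> ?B" for x
    proof -
      have "C * vnorm V x \<le> \<bar>C\<bar> * vnorm V x"
        using norm_nonneg x by (simp add: mult_right_mono)
      also have "\<dots> \<le> \<bar>C\<bar> * 1"
        using x by (intro mult_left_mono) auto
      finally show ?thesis using C[of x] x by simp
    qed
    then show ?thesis by (auto intro!: bdd_aboveI2)
  qed
  have le: "norm (f x) \<le> vnorm (dual V) f" if "f \<in> vcarrier (dual V)" "x \<in> ?B" for f x
    using cSUP_upper[OF that(2) bdd[OF that(1)]] by (simp add: dual_def)
  have least: "vnorm (dual V) f \<le> c" if "\<And>x. x \<in> ?B \<Longrightarrow> norm (f x) \<le> c" for f c
    using that ne by (auto simp: dual_def intro!: cSUP_least)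
  have add: "vadd (dual V) f g \<in> vcarrier (dual V)"
    if f: "f \<in> vcarrier (dual V)" and g: "g \<in> vcarrier (dual V)" for f g
  proof -
    obtain C D where "\<And>x. x \<in> vcarrier V \<Longrightarrow> norm (f x) \<le> C * vnorm V x"
      "\<And>x. x \<in> vcarrier V \<Longrightarrow> norm (g x) \<le> D * vnorm V x"
      using f g by (force simp: defs)
    then have "\<exists>C. \<forall>x\<in>vcarrier V. norm (f x + g x) \<le> C * vnorm V x"
      by (intro exI[of _ "C + D"]) (smt (verit) norm_triangle_ineq distrib_right)
    then show ?thesis
      using f g by (auto simp: defs algebra_simps)
  qed
  have smul: "vsmul (dual V) c f \<in> vcarrier (dual V)" if f: "f \<in> vcarrier (dual V)" for c f
  proof -
    obtain C where "\<And>x. x \<in> vcarrier V \<Longrightarrow> norm (f x) \<le> C * vnorm V x"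
      using f by (force simp: defs)
    then have "\<exists>C. \<forall>x\<in>vcarrier V. norm (c * f x) \<le> C * vnorm V x"
      by (intro exI[of _ "norm c * C"]) (simp add: norm_mult mult.assoc mult_left_mono)
    then show ?thesis
      using f by (auto simp: defs algebra_simps)
  qed
  have smul_le: "vnorm (dual V) (vsmul (dual V) c f) \<le> norm c * vnorm (dual V) f"
    if f: "f \<in> vcarrier (dual V)" for c f
  proof (rule least)
    fix x assume x: "x \<in> ?B"
    show "norm (vsmul (dual V) c f x) \<le> norm c * vnorm (dual V) f"
      using le[OF f x] by (simp add: dual_def norm_mult mult_left_mono)
  qed
  have zero: "vzero (dual V) \<in> vcarrier (dual V)"
    by (auto simp: defs intro!: exI[of _ 0])
  have dual_zero: "vnorm (dual V) (vzero (dual V)) = 0"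
    using least[of "vzero (dual V)" 0] le[OF zero ne] by (simp add: dual_def)
  show ?thesis
  proof (unfold_locales, goal_cases)
    case 1 show ?case by (rule zero)
  next
    case 2 then show ?case by (rule add)
  next
    case 3 then show ?case by (rule smul)
  next
    case (12 f)
    have "f x = 0" if *: "vnorm (dual V) f = 0" and x: "x \<in> vcarrier V" for x
    proof (cases "vnorm V x = 0")
      case True
      then show ?thesis using 12 x by (auto simp: defs)
    next
      case False
      let ?c = "of_real (inverse (vnorm V x)) :: 'k"
      have "norm ?c = inverse (vnorm V x)"
        using norm_nonneg[OF x] by (simp add: norm_inverse)
      then have "vsmul V ?c x \<in> ?B"
        using x False by (simp add: smul_closed norm_smul)
      from le[OF 12 this] have "f (vsmul V ?c x) = 0" using * by simp
      moreover have "f (vsmul V ?c x) = ?c * f x"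
        using 12 x by (simp add: defs)
      ultimately show ?thesis using False by simp
    qed
    moreover have "f x = 0" if "x \<notin> vcarrier V" for x
      using 12 that by (simp add: defs)
    ultimately have "f = vzero (dual V)" if "vnorm (dual V) f = 0"
      using that by (fastforce simp: dual_def)
    then show ?case using dual_zero by blast
  next
    case (13 f g)
    show ?case
    proof (rule least)
      fix x assume x: "x \<in> ?B"
      have "norm (f x + g x) \<le> norm (f x) + norm (g x)" by (rule norm_triangle_ineq)
      then show "norm (vadd (dual V) f g x) \<le> vnorm (dual V) f + vnorm (dual V) g"
        using le[OF 13(1) x] le[OF 13(2) x] by (simp add: dual_def)
    qed
  next
    case (14 f c)
    show ?case
    proof (cases "c = 0")
      case True
      then have "vsmul (dual V) c f = vzero (dual V)" by (simp add: dual_def)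
      then show ?thesis using dual_zero True by simp
    next
      case False
      have "vsmul (dual V) (inverse c) (vsmul (dual V) c f) = f"
        using False by (simp add: dual_def flip: mult.assoc)
      then have "vnorm (dual V) f \<le> inverse (norm c) * vnorm (dual V) (vsmul (dual V) c f)"
        using smul_le[OF smul[OF 14], of "inverse c" c] by (simp add: norm_inverse)
      then have "norm c * vnorm (dual V) f \<le> vnorm (dual V) (vsmul (dual V) c f)"
        using False by (simp add: field_simps)
      then show ?thesis using smul_le[OF 14, of c] by linarith
    qed
  qed (auto simp: dual_def vdiff_def algebra_simps)
qed

abbreviation bidual :: "('k::real_normed_field, 'v) nspace \<Rightarrow> ('k, ('v \<Rightarrow> 'k) \<Rightarrow> 'k) nspace" where
  "bidual V \<equiv> dual (dual V)"

definition canonical :: "('k::real_normed_field, 'v) nspace \<Rightarrow> 'v \<Rightarrow> ('v \<Rightarrow> 'k) \<Rightarrow> 'k" where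
  "canonical V x = (\<lambda>f. if f \<in> vcarrier (dual V) then f x else 0)"

definition reflexive :: "('k::real_normed_field, 'v) nspace \<Rightarrow> bool" where
  "reflexive V \<longleftrightarrow> canonical V ` vcarrier V = vcarrier (bidual V)"

definition quasi_reflexive :: "('k::real_normed_field, 'v) nspace \<Rightarrow> bool" where
  "quasi_reflexive V \<longleftrightarrow> finite_codimension (bidual V) (canonical V ` vcarrier V)"


section \<open>Super-reflexivity\<close>

text \<open>
  The two bounds on \<open>T\<close> say, up to rescaling \<open>T\<close>, that \<open>T\<close> is an isomorphism of \<open>E\<close> onto its image
  with \<open>\<parallel>T\<parallel> \<parallel>T\<inverse>\<parallel> \<le> 1 + \<epsilon>\<close>.
\<close>

definition finitely_representable ::
    "('k, 'w) nspace \<Rightarrow> ('k, 'v) nspace \<Rightarrow> bool" where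
  "finitely_representable Y X \<longleftrightarrow>
     (\<forall>E. \<forall>\<epsilon>>0. fin_dim_subspace Y E \<longrightarrow>
        (\<exists>T. vlinear_on Y X E T \<and>
             (\<forall>y\<in>E. vnorm Y y \<le> vnorm X (T y) \<and> vnorm X (T y) \<le> (1 + \<epsilon>) * vnorm Y y)))"

text \<open>
  James' definition: every Banach space finitely representable in \<open>X\<close> is reflexive. HOL cannot
  quantify over types inside a formula, so the spaces \<open>Y\<close> have their carriers in one fixed type.
  Its size makes this no restriction. A non-reflexive Banach space has a separable closed
  non-reflexive subspace (by Eberlein--Smulian), which is finitely representable in whatever the
  whole space is, and which has at most continuum many points. The type \<open>(nat \<Rightarrow> 'a) set\<close> has at
  least that many points unless \<open>'a\<close> is a singleton, in which case \<open>X = {0}\<close>. It also contains the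
  ultrapowers of \<open>X\<close> over \<open>nat\<close> literally, as sets of equivalence classes of sequences.
\<close>

definition super_reflexive :: "('k::real_or_complex, 'a) nspace \<Rightarrow> bool" where
  "super_reflexive X \<longleftrightarrow>
     (\<forall>Y :: ('k, (nat \<Rightarrow> 'a) set) nspace.
        banach_space Y \<and> finitely_representable Y X \<longrightarrow> reflexive Y)"


section \<open>Cardinals\<close>

definition least_card :: "('a set \<Rightarrow> bool) \<Rightarrow> 'a rel" where
  "least_card P = |SOME A. P A \<and> (\<forall>B. P B \<longrightarrow> |A| \<le>o |B| )|"

lemma least_card:
  assumes "P B"
  shows "\<exists>A. P A \<and> least_card P = |A|" and "least_card P \<le>o |B|"
proof -
  have "\<exists>r \<in> card_of ` Collect P. \<forall>r' \<in> card_of ` Collect P. r \<le>o r'"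
    using assms by (intro exists_minim_Card_order) (auto simp: card_of_Card_order)
  then have "\<exists>A. P A \<and> (\<forall>B. P B \<longrightarrow> |A| \<le>o |B| )"
    by auto
  from someI_ex[OF this]
  show "\<exists>A. P A \<and> least_card P = |A|" and "least_card P \<le>o |B|"
    using assms unfolding least_card_def by blast+
qed

definition dens :: "'a::topological_space set \<Rightarrow> 'a rel" where
  "dens S = least_card (\<lambda>D. D \<subseteq> S \<and> S \<subseteq> closure D)"

text \<open>
  With the non-strict order a finite cardinal has cofinality at most 1. Under the library's strict
  \<open>cofinal\<close> a nonzero finite cardinal has no cofinal subset at all.
\<close>

definition cofinality :: "'a rel \<Rightarrow> 'a rel" where
  "cofinality r = least_card (\<lambda>A. A \<subseteq> Field r \<and> (\<forall>a\<in>Field r. \<exists>b\<in>A. (a, b) \<in> r))"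


section \<open>Separation\<close>

definition symmetrically_separated :: "real \<Rightarrow> 'a::real_normed_vector set \<Rightarrow> bool" where
  "symmetrically_separated \<delta> A \<longleftrightarrow>
     (\<forall>x\<in>A. \<forall>y\<in>A. x \<noteq> y \<longrightarrow> norm (x - y) \<ge> \<delta> \<and> norm (x + y) \<ge> \<delta>)"

definition symmetrically_plus_separated :: "real \<Rightarrow> 'a::real_normed_vector set \<Rightarrow> bool" where
  "symmetrically_plus_separated \<delta> A \<longleftrightarrow>
     (\<forall>x\<in>A. \<forall>y\<in>A. x \<noteq> y \<longrightarrow> norm (x - y) > \<delta> \<and> norm (x + y) > \<delta>)"

end

theory Submission
  imports Defs
begin

text \<open>
  All three parts come from one transfinite construction, carried out over the real scalars. Unit
  vectors \<open>x\<^sub>\<alpha>\<close> and finite sets \<open>F\<^sub>\<alpha>\<close> of functionals are chosen so that each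
  new vector lies in the common kernel \<open>Y\<close> of all functionals chosen before, and so that
  \<open>\<parallel>x\<^sub>\<alpha> + z\<parallel> \<ge> 1 + \<epsilon>\<^sub>\<alpha>\<close> for every unit vector \<open>z\<close> of \<open>Y\<close> that is killed by \<open>F\<^sub>\<alpha>\<close>. Every later vector
  is such a \<open>z\<close>, and so is its negative; hence \<open>\<parallel>x\<^sub>\<alpha> \<plusminus> x\<^sub>\<beta>\<parallel> \<ge> 1 + \<epsilon>\<^sub>\<alpha>\<close> for \<open>\<beta> > \<alpha>\<close>
  (\<open>transfinite_separated_set\<close>). Two things are needed for a length of \<open>dens X\<close>.

  First, fewer than \<open>dens X\<close> functionals must have a common nonzero zero
  (\<open>common_kernel_nontrivial\<close>): otherwise the annihilator of their span in the bidual meets \<open>X\<close>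
  trivially, so it is finite-dimensional, finitely many further functionals make the span dense in the
  dual, and then \<open>X\<close> has too small a dense subset.

  Secondly, a nonzero subspace \<open>Y\<close> must contain a suitable \<open>x\<close> for some \<open>\<epsilon> > 0\<close>. A subspace without
  one is called \<open>flat\<close> with constant \<open>\<epsilon>\<close>: each of its unit vectors \<open>x\<close> has, inside the kernel of any
  given finite set of functionals, a unit vector \<open>z\<close> of \<open>Y\<close> with \<open>\<parallel>x + z\<parallel> < 1 + \<epsilon>\<close>. In a flat subspace unit
  vectors can be added up again and again with little growth of the norm, so \<open>flat_sequence\<close> produces unit
  vectors \<open>x\<^sub>0, x\<^sub>1, \<dots>\<close> with biorthogonal functionals \<open>h\<^sub>k\<close> of norm at most 3 whose partial sums along
  each residue class modulo \<open>d\<close> stay bounded when \<open>Y\<close> is flat for all constants. Limits of these sums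
  along an ultrafilter are \<open>d\<close> elements of the bidual. If \<open>d\<close> is large compared with the codimension of
  \<open>X\<close>, a nontrivial combination of them, with coefficients \<open>c\<close>, is evaluation at a point \<open>s\<close> of \<open>X\<close>.
  This \<open>s\<close> lies in the closed span of the \<open>x\<^sub>i\<close>, so that \<open>h\<^sub>k s\<close> tends to 0, whereas \<open>h\<^sub>k s\<close> is the
  coefficient of the class of \<open>k\<close>: a contradiction (\<open>finite_deficiency_not_flat\<close>).

  The first part is then immediate. In the second part the numbers \<open>\<epsilon>\<^sub>\<alpha>\<close> are sorted into countably
  many classes \<open>\<epsilon>\<^sub>\<alpha> \<ge> 1/n\<close>, one of which has full cardinality when the cofinality is uncountable
  (\<open>uncountable_cofinality_pigeonhole\<close>). In the third part one \<open>\<epsilon>\<close> serves all subspaces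
  (\<open>super_reflexive_not_flat\<close>). Otherwise there are subspaces that are flat with arbitrarily small
  constants, hence arbitrarily long finite sequences as above with a common bound on all partial sums.
  In an ultrapower of \<open>X\<close> they become one infinite sequence of this kind. The closed span of its
  partial sums is a Banach space that is finitely representable in \<open>X\<close>
  (\<open>finitely_representable_Y\<close>) and not reflexive (\<open>not_reflexive_Y\<close>).
\<close>

section \<open>Sublinear functionals and Hahn--Banach theorems\<close>

definition sublinear :: "('a::real_vector \<Rightarrow> real) \<Rightarrow> bool" where
  "sublinear p \<longleftrightarrow> (\<forall>x y. p (x + y) \<le> p x + p y) \<and> (\<forall>t>0. \<forall>x. p (t *\<^sub>R x) \<le> t * p x)"

lemma sublinearD:
  assumes "sublinear p"
  shows "p (x + y) \<le> p x + p y" and "0 \<le> t \<Longrightarrow> p (t *\<^sub>R x) = t * p x"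
    and "p 0 = 0" and "- p (- x) \<le> p x"
proof -
  have add: "p (x + y) \<le> p x + p y" and hom: "t > 0 \<Longrightarrow> p (t *\<^sub>R x) \<le> t * p x" for x y t
    using assms by (auto simp: sublinear_def)
  show "p (x + y) \<le> p x + p y" by (rule add)
  have "p 0 \<le> (1/2) * p 0" using hom[of "1/2" 0] by simp
  moreover have "p 0 \<le> p 0 + p 0" using add[of 0 0] by simp
  ultimately show z: "p 0 = 0" by simp
  show "- p (- x) \<le> p x" using add[of x "- x"] z by simp
  show "p (t *\<^sub>R x) = t * p x" if "0 \<le> t"
  proof (cases "t = 0")
    case False
    with that have t: "t > 0" by simp
    have "p x \<le> inverse t * p (t *\<^sub>R x)"
      using hom[of "inverse t" "t *\<^sub>R x"] t by simp
    then have "t * p x \<le> p (t *\<^sub>R x)" using t by (simp add: field_simps)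
    then show ?thesis using hom[OF t, of x] by simp
  qed (simp add: z)
qed

text \<open>
  The directional modification of \<open>p\<close>: among the sublinear functionals below \<open>p\<close> it is one that is as
  small as possible at \<open>- u\<close>, namely at most \<open>- p u\<close>. A minimal sublinear functional equals its own
  modification in every direction, which makes it additive; and a linear functional below the
  modification in direction \<open>u\<close> touches \<open>p\<close> at \<open>u\<close>.
\<close>

lemma sublinear_directional:
  fixes u :: "'a::real_vector"
  assumes p: "sublinear p"
  defines "q \<equiv> \<lambda>x. INF t\<in>{0..}. p (x + t *\<^sub>R u) - t * p u"
  shows "sublinear q" and "q x \<le> p x" and "t \<ge> 0 \<Longrightarrow> q x \<le> p (x + t *\<^sub>R u) - t * p u"
proof -
  note P = sublinearD[OF p]
  have bdd: "bdd_below ((\<lambda>t. p (x + t *\<^sub>R u) - t * p u) ` {0..})" for x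
  proof (rule bdd_belowI2)
    fix t :: real assume "t \<in> {0..}"
    then have "t * p u = p ((x + t *\<^sub>R u) + (- x))" using P(2)[of t u] by simp
    also have "\<dots> \<le> p (x + t *\<^sub>R u) + p (- x)" by (rule P(1))
    finally show "- p (- x) \<le> p (x + t *\<^sub>R u) - t * p u" by simp
  qed
  show le: "q x \<le> p (x + t *\<^sub>R u) - t * p u" if "t \<ge> 0" for x t
    unfolding q_def by (rule cINF_lower[OF bdd]) (use that in simp)
  show "q x \<le> p x" using le[of 0 x] by simp
  have ge: "c \<le> q x" if "\<And>t. t \<ge> 0 \<Longrightarrow> c \<le> p (x + t *\<^sub>R u) - t * p u" for c x
    unfolding q_def by (rule cINF_greatest) (use that in auto)
  show "sublinear q"
    unfolding sublinear_def
  proof (intro conjI allI impI)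
    fix x y
    have "q (x + y) - (p (y + s *\<^sub>R u) - s * p u) \<le> q x" if s: "s \<ge> 0" for s
    proof (rule ge)
      fix t :: real assume t: "t \<ge> 0"
      have "q (x + y) \<le> p ((x + y) + (t + s) *\<^sub>R u) - (t + s) * p u"
        using s t by (intro le) simp
      also have "(x + y) + (t + s) *\<^sub>R u = (x + t *\<^sub>R u) + (y + s *\<^sub>R u)"
        by (simp add: algebra_simps)
      finally show "q (x + y) - (p (y + s *\<^sub>R u) - s * p u) \<le> p (x + t *\<^sub>R u) - t * p u"
        using P(1)[of "x + t *\<^sub>R u" "y + s *\<^sub>R u"] by (simp add: algebra_simps)
    qed
    then have "q (x + y) - q x \<le> q y" by (intro ge) (simp add: algebra_simps)
    then show "q (x + y) \<le> q x + q y" by simp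
  next
    fix r :: real and x assume r: "r > 0"
    have "inverse r * q (r *\<^sub>R x) \<le> q x"
    proof (rule ge)
      fix t :: real assume t: "t \<ge> 0"
      have "q (r *\<^sub>R x) \<le> p (r *\<^sub>R x + (r * t) *\<^sub>R u) - (r * t) * p u"
        using r t by (intro le) simp
      also have "r *\<^sub>R x + (r * t) *\<^sub>R u = r *\<^sub>R (x + t *\<^sub>R u)"
        by (simp add: scaleR_right_distrib)
      finally have "q (r *\<^sub>R x) \<le> r * (p (x + t *\<^sub>R u) - t * p u)"
        using P(2)[of r "x + t *\<^sub>R u"] r by (simp add: algebra_simps)
      then show "inverse r * q (r *\<^sub>R x) \<le> p (x + t *\<^sub>R u) - t * p u"
        using r by (simp add: field_simps)
    qed
    then show "q (r *\<^sub>R x) \<le> r * q x" using r by (simp add: field_simps)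
  qed
qed

lemma exists_minimal_sublinear:
  assumes p: "sublinear p"
  obtains q where "sublinear q" "q \<le> p" "\<And>q'. sublinear q' \<Longrightarrow> q' \<le> q \<Longrightarrow> q' = q"
proof -
  let ?A = "{q. sublinear q \<and> q \<le> p}"
  have "\<exists>m\<in>?A. \<forall>q\<in>?A. (\<lambda>a b. b \<le> a) m q \<longrightarrow> q = m"
  proof (rule predicate_Zorn)
    show "partial_order_on ?A (relation_of (\<lambda>a b. b \<le> a) ?A)"
      by (rule partial_order_on_relation_ofI) auto
  next
    fix C assume C: "C \<in> Chains (relation_of (\<lambda>a b. b \<le> a) ?A)"
    have CA: "C \<subseteq> ?A" and tot: "\<And>a b. a \<in> C \<Longrightarrow> b \<in> C \<Longrightarrow> a \<le> b \<or> b \<le> a"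
      using C by (auto simp: Chains_def relation_of_def)
    show "\<exists>u\<in>?A. \<forall>a\<in>C. u \<le> a"
    proof (cases "C = {}")
      case True then show ?thesis using p by auto
    next
      case ne: False
      define u where "u x = (INF q\<in>C. q x)" for x
      have bdd: "bdd_below ((\<lambda>q. q x) ` C)" for x
      proof (rule bdd_belowI2)
        fix q assume "q \<in> C"
        then have "sublinear q" "q (- x) \<le> p (- x)" using CA by (auto simp: le_fun_def)
        then show "- p (- x) \<le> q x" using sublinearD(4)[of q x] by simp
      qed
      have le: "u x \<le> q x" if "q \<in> C" for q x
        unfolding u_def using bdd that by (rule cINF_lower)
      have ge: "c \<le> u x" if "\<And>q. q \<in> C \<Longrightarrow> c \<le> q x" for c x
        unfolding u_def using ne that by (rule cINF_greatest)
      have "sublinear u"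
        unfolding sublinear_def
      proof (intro conjI allI impI)
        fix x y
        have "u (x + y) - q' y \<le> u x" if q': "q' \<in> C" for q'
        proof (rule ge)
          fix q assume q: "q \<in> C"
          from tot[OF q q'] obtain r where r: "r \<in> C" "r \<le> q" "r \<le> q'"
            using q q' by auto
          have "u (x + y) \<le> r x + r y"
            using le[OF r(1), of "x + y"] sublinearD(1)[of r x y] CA r by fastforce
          also have "\<dots> \<le> q x + q' y" using r by (intro add_mono) (auto simp: le_fun_def)
          finally show "u (x + y) - q' y \<le> q x" by simp
        qed
        then have "u (x + y) - u x \<le> u y" by (intro ge) (simp add: algebra_simps)
        then show "u (x + y) \<le> u x + u y" by simp
      next
        fix t :: real and x assume t: "t > 0"
        have "inverse t * u (t *\<^sub>R x) \<le> u x"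
        proof (rule ge)
          fix q assume q: "q \<in> C"
          then have "u (t *\<^sub>R x) \<le> t * q x"
            using le[OF q, of "t *\<^sub>R x"] sublinearD(2)[of q t x] CA t by auto
          then show "inverse t * u (t *\<^sub>R x) \<le> q x" using t by (simp add: field_simps)
        qed
        then show "u (t *\<^sub>R x) \<le> t * u x" using t by (simp add: field_simps)
      qed
      moreover obtain q where "q \<in> C" using ne by auto
      then have "u \<le> p" using le CA by (force simp: le_fun_def intro: order_trans)
      ultimately show ?thesis using le by (auto simp: le_fun_def)
    qed
  qed
  then show ?thesis using that by (auto intro: order_trans)
qed

text \<open>
  The Hahn--Banach theorem in the form of a supporting functional at a point. The Hahn--Banach facts
  below are the cases where \<open>p\<close> is the norm and where \<open>p\<close> is the distance to a subspace.
\<close>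

theorem sublinear_support:
  assumes p: "sublinear p"
  obtains f where "linear f" "\<And>x. f x \<le> p x" "f u = p u"
proof -
  define p' where "p' x = (INF t\<in>{0..}. p (x + t *\<^sub>R u) - t * p u)" for x
  note p' = sublinear_directional[OF p, where u = u, folded p'_def]
  obtain f where f: "sublinear f" "f \<le> p'" "\<And>q'. sublinear q' \<Longrightarrow> q' \<le> f \<Longrightarrow> q' = f"
    using exists_minimal_sublinear[OF p'(1)] by blast
  have "f x + f v \<le> f (x + v)" for x v
  proof -
    have "(\<lambda>x. INF t\<in>{0..}. f (x + t *\<^sub>R v) - t * f v) = f"
      by (rule f(3)) (auto simp: le_fun_def sublinear_directional[OF f(1)])
    from fun_cong[OF this, of x] show ?thesis
      using sublinear_directional(3)[OF f(1), where t = 1 and x = x and u = v] by simp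
  qed
  then have add: "f (x + v) = f x + f v" for x v
    using sublinearD(1)[OF f(1)] by (meson antisym)
  have neg: "f (- x) = - f x" for x using add[of x "- x"] sublinearD(3)[OF f(1)] by simp
  have "f (r *\<^sub>R x) = r *\<^sub>R f x" for r x
  proof (cases "r \<ge> 0")
    case True then show ?thesis using sublinearD(2)[OF f(1)] by simp
  next
    case False then show ?thesis
      using sublinearD(2)[OF f(1), of "- r" x] neg[of "r *\<^sub>R x"] by simp
  qed
  with add have lin: "linear f" by (intro linearI)
  have le: "f x \<le> p x" for x using f(2) p'(2)[where x = x] by (auto simp: le_fun_def intro: order_trans)
  have "f (- u) \<le> - p u"
    using f(2) p'(3)[where t = 1 and x = "- u"] sublinearD(3)[OF p] by (auto simp: le_fun_def intro: order_trans)
  then have "f u = p u" using neg[of u] le[of u] by simp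
  with lin le show ?thesis by (rule that)
qed

lemma norming_functional:
  fixes x :: "'a::real_normed_vector"
  obtains f :: "'a \<Rightarrow>\<^sub>L real" where "norm f \<le> 1" "blinfun_apply f x = norm x"
proof -
  have "sublinear (norm :: 'a \<Rightarrow> real)"
    by (simp add: sublinear_def norm_triangle_ineq)
  then obtain g where g: "linear g" "\<And>y. g y \<le> norm y" "g x = norm x"
    using sublinear_support by blast
  have abs: "norm (g y) \<le> norm y * 1" for y
    using g(2)[of y] g(2)[of "- y"] linear_neg[OF g(1), of y] by simp
  have bl: "bounded_linear g"
    by (rule bounded_linear_intro[OF linear_add[OF g(1)] linear_scale[OF g(1)] abs])
  show ?thesis
  proof
    show "norm (Blinfun g) \<le> 1"
      using abs by (intro norm_blinfun_bound) (auto simp: bounded_linear_Blinfun_apply[OF bl])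
    show "blinfun_apply (Blinfun g) x = norm x"
      using g(3) by (simp add: bounded_linear_Blinfun_apply[OF bl])
  qed
qed

lemma functional_vanishing_on_subspace:
  fixes x :: "'a::real_normed_vector"
  assumes E: "subspace E" and d: "d > 0" "\<And>v. v \<in> E \<Longrightarrow> d \<le> norm (x - v)"
  obtains f :: "'a \<Rightarrow>\<^sub>L real" where "norm f \<le> 1 / d" "blinfun_apply f x = 1"
    "\<And>v. v \<in> E \<Longrightarrow> blinfun_apply f v = 0"
proof -
  have ne: "E \<noteq> {}" using subspace_0[OF E] by auto
  define p where "p y = infdist y E" for y
  have ple: "p y \<le> norm (y - v)" if "v \<in> E" for v y
    unfolding p_def using infdist_le[OF that, of y] by (simp add: dist_norm)
  have pge: "c \<le> p y" if "\<And>v. v \<in> E \<Longrightarrow> c \<le> norm (y - v)" for c y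
    unfolding p_def using ne that by (auto simp: infdist_notempty dist_norm intro!: cINF_greatest)
  have "sublinear p"
    unfolding sublinear_def
  proof (intro conjI allI impI)
    fix y z
    have "p (y + z) - norm (z - w) \<le> p y" if w: "w \<in> E" for w
    proof (rule pge)
      fix v assume v: "v \<in> E"
      have "p (y + z) \<le> norm ((y + z) - (v + w))"
        by (rule ple) (rule subspace_add[OF E v w])
      also have "\<dots> = norm ((y - v) + (z - w))" by (simp add: algebra_simps)
      also have "\<dots> \<le> norm (y - v) + norm (z - w)" by (rule norm_triangle_ineq)
      finally show "p (y + z) - norm (z - w) \<le> norm (y - v)" by simp
    qed
    then have "p (y + z) - p y \<le> p z" by (intro pge) (simp add: algebra_simps)
    then show "p (y + z) \<le> p y + p z" by simp
  next
    fix t :: real and y assume t: "t > 0"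
    have "inverse t * p (t *\<^sub>R y) \<le> p y"
    proof (rule pge)
      fix v assume v: "v \<in> E"
      have "p (t *\<^sub>R y) \<le> norm (t *\<^sub>R y - t *\<^sub>R v)"
        by (rule ple) (rule subspace_scale[OF E v])
      also have "\<dots> = t * norm (y - v)" using t by (simp flip: scaleR_diff_right)
      finally show "inverse t * p (t *\<^sub>R y) \<le> norm (y - v)" using t by (simp add: field_simps)
    qed
    then show "p (t *\<^sub>R y) \<le> t * p y" using t by (simp add: field_simps)
  qed
  then obtain g where g: "linear g" "\<And>y. g y \<le> p y" "g x = p x"
    using sublinear_support by blast
  have px: "p x \<ge> d" using d by (intro pge)
  have abs: "norm (g y) \<le> norm y" for y
    using order_trans[OF g(2)[of y] ple[OF subspace_0[OF E]]]
      order_trans[OF g(2)[of "- y"] ple[OF subspace_0[OF E]]] linear_neg[OF g(1), of y] by simp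
  \<comment> \<open>Both \<open>g v\<close> and \<open>g (- v)\<close> are bounded by the distance 0.\<close>
  have zero: "g v = 0" if "v \<in> E" for v
    using order_trans[OF g(2)[of v] ple[OF that]]
      order_trans[OF g(2)[of "- v"] ple[OF subspace_neg[OF E that]]] linear_neg[OF g(1), of v] by simp
  define h where "h y = g y / p x" for y
  have lin: "linear h" unfolding h_def by (intro linearI) (simp_all add: linear_add[OF g(1)]
    linear_scale[OF g(1)] add_divide_distrib)
  have habs: "norm (h y) \<le> norm y * (1 / d)" for y
  proof -
    have "\<bar>g y\<bar> / p x \<le> norm y / d" using abs[of y] px d by (intro frac_le) auto
    then show ?thesis using px d by (simp add: h_def)
  qed
  have bl: "bounded_linear h"
    by (rule bounded_linear_intro[OF linear_add[OF lin] linear_scale[OF lin] habs])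
  show ?thesis
  proof
    show "norm (Blinfun h) \<le> 1 / d"
      using habs d by (intro norm_blinfun_bound) (auto simp: bounded_linear_Blinfun_apply[OF bl] mult.commute)
    show "blinfun_apply (Blinfun h) x = 1"
      using g(3) px d by (simp add: bounded_linear_Blinfun_apply[OF bl] h_def)
    show "blinfun_apply (Blinfun h) v = 0" if "v \<in> E" for v
      using zero[OF that] by (simp add: bounded_linear_Blinfun_apply[OF bl] h_def)
  qed
qed

section \<open>A free ultrafilter on the natural numbers\<close>

text \<open>
  Minimal proper filters are ultrafilters, and Zorn's lemma yields a minimal one.
\<close>

lemma exists_ultrafilter:
  "\<exists>U::nat filter. U \<le> sequentially \<and> U \<noteq> bot \<and>
     (\<forall>P. eventually P U \<or> eventually (\<lambda>n. \<not> P n) U)"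
proof -
  let ?A = "{F::nat filter. F \<noteq> bot \<and> F \<le> sequentially}"
  have "\<exists>m\<in>?A. \<forall>q\<in>?A. (\<lambda>a b. b \<le> a) m q \<longrightarrow> q = m"
  proof (rule predicate_Zorn)
    show "partial_order_on ?A (relation_of (\<lambda>a b. b \<le> a) ?A)"
      by (rule partial_order_on_relation_ofI) auto
  next
    fix C assume C: "C \<in> Chains (relation_of (\<lambda>a b. b \<le> a) ?A)"
    have CA: "C \<subseteq> ?A" and tot: "\<And>a b. a \<in> C \<Longrightarrow> b \<in> C \<Longrightarrow> a \<le> b \<or> b \<le> a"
      using C by (auto simp: Chains_def relation_of_def)
    show "\<exists>u\<in>?A. \<forall>a\<in>C. u \<le> a"
    proof (cases "C = {}")
      case True then show ?thesis by (auto intro!: exI[of _ sequentially])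
    next
      case ne: False
      have "\<exists>m\<in>X. \<forall>a\<in>X. m \<le> a" if "finite X" "X \<noteq> {}" "X \<subseteq> C" for X
        using that
      proof (induction X rule: finite_ne_induct)
        case (insert a X)
        then obtain m where m: "m \<in> X" "\<forall>a\<in>X. m \<le> a" by auto
        have "a \<le> m \<or> m \<le> a"
          using insert.prems m by (intro tot) auto
        then show ?case
        proof
          assume "a \<le> m" then show ?thesis using m by (intro bexI[of _ a]) (auto intro: order_trans)
        next
          assume "m \<le> a" then show ?thesis using m by (intro bexI[of _ m]) auto
        qed
      qed auto
      then have "Inf X \<noteq> bot" if X: "X \<subseteq> C" "finite X" for X
      proof (cases "X = {}")
        case False
        then obtain m where m: "m \<in> X" "\<forall>a\<in>X. m \<le> a"
          using \<open>\<And>X. finite X \<Longrightarrow> X \<noteq> {} \<Longrightarrow> X \<subseteq> C \<Longrightarrow> \<exists>m\<in>X. \<forall>a\<in>X. m \<le> a\<close> X by blast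
        then have "m \<le> Inf X" by (intro Inf_greatest) auto
        moreover have "m \<noteq> bot" using m X CA by auto
        ultimately show ?thesis using bot.extremum_uniqueI[of m] by auto
      next
        case True
        have "(top :: nat filter) \<noteq> bot" unfolding trivial_limit_def by simp
        with True show ?thesis by simp
      qed
      then have "Inf C \<noteq> bot" by (rule Inf_filter_not_bot)
      moreover have "Inf C \<le> sequentially"
      proof -
        obtain F where "F \<in> C" using ne by auto
        then show ?thesis using CA by (intro Inf_lower2[of F]) auto
      qed
      ultimately show ?thesis by (auto intro: Inf_lower)
    qed
  qed
  then obtain U where U: "U \<noteq> bot" "U \<le> sequentially"
    and min: "\<And>F. F \<noteq> bot \<Longrightarrow> F \<le> U \<Longrightarrow> F = U" by (auto intro: order_trans)
  have "eventually P U \<or> eventually (\<lambda>n. \<not> P n) U" for P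
  proof (rule ccontr)
    assume *: "\<not> ?thesis"
    let ?F = "inf U (principal {n. P n})"
    have "?F \<noteq> bot"
      using * by (simp add: trivial_limit_def eventually_inf_principal)
    then have "?F = U" by (rule min) simp
    moreover have "eventually P ?F" by (simp add: eventually_inf_principal)
    ultimately have "eventually P U" by simp
    then show False using * by simp
  qed
  then show ?thesis using U by blast
qed

definition ultra :: "nat filter" where
  "ultra = (SOME U. U \<le> sequentially \<and> U \<noteq> bot \<and>
     (\<forall>P. eventually P U \<or> eventually (\<lambda>n. \<not> P n) U))"

lemma ultra: "ultra \<le> sequentially" "ultra \<noteq> bot"
  "eventually P ultra \<or> eventually (\<lambda>n. \<not> P n) ultra"
  using someI_ex[OF exists_ultrafilter] unfolding ultra_def by blast+

lemma ultra_tendsto: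
  fixes f :: "nat \<Rightarrow> 'b::heine_borel"
  assumes "eventually (\<lambda>n. f n \<in> K) ultra" "bounded K"
  obtains l where "(f \<longlongrightarrow> l) ultra"
proof -
  let ?F = "filtermap f ultra"
  have cpt: "compact (closure K)" using assms(2) by (simp add: compact_closure)
  have "?F \<noteq> bot" "eventually (\<lambda>x. x \<in> closure K) ?F"
    using ultra(2) assms(1) closure_subset[of K]
    by (auto simp: filtermap_bot_iff eventually_filtermap elim!: eventually_mono)
  with cpt obtain l where l: "inf (nhds l) ?F \<noteq> bot"
    unfolding compact_filter le_principal by blast
  have "(f \<longlongrightarrow> l) ultra"
    unfolding tendsto_def
  proof (intro allI impI)
    fix S assume S: "open S" "l \<in> S"
    show "eventually (\<lambda>n. f n \<in> S) ultra"
    proof (rule ccontr)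
      assume "\<not> ?thesis"
      then have "eventually (\<lambda>y. y \<notin> S) ?F" using ultra(3) by (auto simp: eventually_filtermap)
      moreover have "eventually (\<lambda>y. y \<in> S) (nhds l)" using S by (rule eventually_nhds_in_open)
      ultimately have "eventually (\<lambda>_. False) (inf (nhds l) ?F)"
        unfolding eventually_inf by (rule_tac exI, rule_tac exI) auto
      then show False using l by (simp add: trivial_limit_def)
    qed
  qed
  then show ?thesis by (rule that)
qed

lemma tendsto_ultra: "f \<longlonglongrightarrow> l \<Longrightarrow> (f \<longlongrightarrow> l) ultra"
  using ultra(1) by (rule tendsto_mono)

section \<open>Functionals adapted to a finite-dimensional subspace\<close>

text \<open>
  By induction on \<open>B\<close>. For \<open>x\<close> outside \<open>span B\<close> the distance from \<open>x\<close> to \<open>span B\<close> is attained, hence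
  positive; a functional that separates \<open>x\<close> from \<open>span B\<close> bounds both parts of a decomposition
  \<open>u = v + t *\<^sub>R x\<close> of a vector of the new unit ball.
\<close>

lemma compact_span_unit_ball:
  fixes B :: "'a::real_normed_vector set"
  assumes "finite B"
  shows "compact (span B \<inter> cball 0 1)"
  using assms
proof (induction B rule: finite_induct)
  case (insert x B)
  let ?E = "span B" and ?E' = "span (insert x B)"
  show ?case
  proof (cases "x \<in> ?E")
    case True
    then show ?thesis using insert.IH by (simp add: span_redundant)
  next
    case False
    have ball: "compact (?E \<inter> cball 0 R)" if R: "R > 0" for R
    proof -
      have "?E \<inter> cball 0 R = (*\<^sub>R) R ` (?E \<inter> cball 0 1)"
      proof (intro equalityI subsetI)
        fix v assume v: "v \<in> ?E \<inter> cball 0 R"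
        then have "inverse R *\<^sub>R v \<in> ?E \<inter> cball 0 1"
          using R by (auto simp: span_scale field_simps)
        then show "v \<in> (*\<^sub>R) R ` (?E \<inter> cball 0 1)"
          using R by (intro image_eqI[of _ _ "inverse R *\<^sub>R v"]) auto
      next
        fix v assume "v \<in> (*\<^sub>R) R ` (?E \<inter> cball 0 1)"
        then show "v \<in> ?E \<inter> cball 0 R" using R by (auto simp: span_scale)
      qed
      then show ?thesis using compact_scaling[OF insert.IH, of R] by simp
    qed
    \<comment> \<open>Vectors of norm above \<open>R\<close> are farther from \<open>x\<close> than 0 is.\<close>
    define R where "R = 2 * norm x + 1"
    have "R > 0" by (simp add: R_def add_nonneg_pos)
    then have "0 \<in> ?E \<inter> cball 0 R" by (simp add: span_zero)
    then have "?E \<inter> cball 0 R \<noteq> {}" by blast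
    moreover have "continuous_on (?E \<inter> cball 0 R) (\<lambda>v. norm (x - v))"
      by (intro continuous_intros)
    ultimately obtain v0 where v0: "v0 \<in> ?E \<inter> cball 0 R"
      "\<And>v. v \<in> ?E \<inter> cball 0 R \<Longrightarrow> norm (x - v0) \<le> norm (x - v)"
      using continuous_attains_inf[OF ball[OF \<open>R > 0\<close>]] by blast
    define d where "d = norm (x - v0)"
    have d: "d > 0" using v0 False by (auto simp: d_def)
    have "d \<le> norm (x - v)" if v: "v \<in> ?E" for v
    proof (cases "norm v \<le> R")
      case True
      then show ?thesis using v0(2)[of v] v by (simp add: d_def)
    next
      case False
      have "d \<le> norm x" using v0(2)[of 0] \<open>R > 0\<close> by (simp add: d_def span_zero)
      also have "\<dots> \<le> norm v - norm x" using False by (simp add: R_def)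
      also have "\<dots> \<le> norm (x - v)"
        using norm_triangle_ineq2[of v x] by (simp add: norm_minus_commute)
      finally show ?thesis .
    qed
    from functional_vanishing_on_subspace[OF subspace_span d this]
    obtain h :: "'a \<Rightarrow>\<^sub>L real" where h: "norm h \<le> 1 / d" "blinfun_apply h x = 1"
      "\<And>v. v \<in> ?E \<Longrightarrow> blinfun_apply h v = 0" by blast
    define M where "M = 1 + norm x / d"
    have M: "M > 0" using d by (simp add: M_def add_pos_nonneg)
    define K where "K = {v + w | v w. v \<in> ?E \<inter> cball 0 M \<and> w \<in> (\<lambda>t. t *\<^sub>R x) ` {- (1/d)..1/d}}"
    have "compact ((\<lambda>t. t *\<^sub>R x) ` {- (1/d)..1/d})"
      by (intro compact_continuous_image continuous_intros compact_Icc)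
    then have "compact K"
      unfolding K_def using compact_sums[OF ball[OF M]] by simp
    moreover have "?E' \<inter> cball 0 1 = K \<inter> cball 0 1"
    proof (intro equalityI subsetI)
      fix u assume u: "u \<in> ?E' \<inter> cball 0 1"
      then obtain t where t: "u - t *\<^sub>R x \<in> ?E" by (auto simp: span_breakdown_eq)
      have "blinfun_apply h u = t"
        using h(3)[OF t] h(2) by (simp add: blinfun.diff_right blinfun.scaleR_right)
      moreover have "norm h * norm u \<le> (1/d) * 1"
        using u h(1) d by (intro mult_mono) auto
      then have "\<bar>blinfun_apply h u\<bar> \<le> (1/d) * 1"
        using norm_blinfun[of h u] by simp
      ultimately have abs: "\<bar>t\<bar> \<le> 1/d" by simp
      have "norm (u - t *\<^sub>R x) \<le> norm u + \<bar>t\<bar> * norm x"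
        using norm_triangle_ineq4[of u "t *\<^sub>R x"] by simp
      also have "\<dots> \<le> 1 + (1/d) * norm x"
        using u abs by (intro add_mono mult_right_mono) auto
      finally have "norm (u - t *\<^sub>R x) \<le> M" by (simp add: M_def)
      then have "u - t *\<^sub>R x \<in> ?E \<inter> cball 0 M" using t by simp
      moreover have "t *\<^sub>R x \<in> (\<lambda>t. t *\<^sub>R x) ` {- (1/d)..1/d}"
        using abs by (intro imageI) auto
      moreover have "u = (u - t *\<^sub>R x) + t *\<^sub>R x" by simp
      ultimately have "u \<in> K" unfolding K_def by blast
      then show "u \<in> K \<inter> cball 0 1" using u by simp
    next
      fix u assume u: "u \<in> K \<inter> cball 0 1"
      then obtain v t where "v \<in> ?E" "u = v + t *\<^sub>R x" by (auto simp: K_def)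
      then have "u - t *\<^sub>R x \<in> ?E" by simp
      then show "u \<in> ?E' \<inter> cball 0 1" using u by (auto simp: span_breakdown_eq)
    qed
    ultimately show ?thesis by (simp add: compact_Int_closed)
  qed
qed (simp)

lemma finite_norming_set:
  fixes B :: "'a::real_normed_vector set"
  assumes "finite B"
  obtains G :: "('a \<Rightarrow>\<^sub>L real) set" where "finite G" "\<And>g. g \<in> G \<Longrightarrow> norm g \<le> 1"
    "\<And>v. v \<in> span B \<Longrightarrow> \<exists>g\<in>G. norm v \<le> 2 * blinfun_apply g v"
proof -
  have "\<exists>g :: 'a \<Rightarrow>\<^sub>L real. norm g \<le> 1 \<and> blinfun_apply g v = norm v" for v
    using norming_functional[of v] by blast
  then obtain g :: "'a \<Rightarrow> 'a \<Rightarrow>\<^sub>L real"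
    where g: "\<And>v. norm (g v) \<le> 1" "\<And>v. blinfun_apply (g v) v = norm v" by metis
  let ?K = "span B \<inter> sphere 0 1"
  have "closed {v :: 'a. norm v = 1}" by (intro closed_Collect_eq continuous_intros)
  moreover have "?K = (span B \<inter> cball 0 1) \<inter> {v. norm v = 1}" by auto
  ultimately have "compact ?K"
    using compact_Int_closed[OF compact_span_unit_ball[OF assms]] by simp
  moreover have "open {u. 1 < 2 * blinfun_apply (g v) u}" for v
    by (intro open_Collect_less continuous_intros)
  moreover have "?K \<subseteq> (\<Union>v\<in>?K. {u. 1 < 2 * blinfun_apply (g v) u})"
    using g(2) by auto
  ultimately obtain C where C: "C \<subseteq> ?K" "finite C" "?K \<subseteq> (\<Union>v\<in>C. {u. 1 < 2 * blinfun_apply (g v) u})"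
    by (rule compactE_image) auto
  show ?thesis
  proof
    show "finite (insert 0 (g ` C))" using C by simp
    show "norm f \<le> 1" if "f \<in> insert 0 (g ` C)" for f using that g by auto
    fix w assume w: "w \<in> span B"
    show "\<exists>f\<in>insert 0 (g ` C). norm w \<le> 2 * blinfun_apply f w"
    proof (cases "w = 0")
      case False
      then have "inverse (norm w) *\<^sub>R w \<in> ?K" using w by (auto simp: span_scale)
      then obtain v where "v \<in> C" "1 < 2 * blinfun_apply (g v) (inverse (norm w) *\<^sub>R w)"
        using C(3) by blast
      then show ?thesis using False
        by (intro bexI[of _ "g v"]) (auto simp: blinfun.scaleR_right field_simps)
    qed auto
  qed
qed

text \<open>
  A vector that is killed by a finite \<open>1/2\<close>-norming set of \<open>span B\<close> stays at distance \<open>1/3\<close> from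
  \<open>span B\<close>: the norming functionals see \<open>z - v\<close> as they see \<open>- v\<close>. The point is that the bound 3 on the
  coordinate functional does not depend on \<open>B\<close>.
\<close>

lemma coordinate_functional_off_span:
  fixes B :: "'a::real_normed_vector set"
  assumes "finite B"
  obtains G :: "('a \<Rightarrow>\<^sub>L real) set" where "finite G"
    "\<And>z. norm z = 1 \<Longrightarrow> (\<And>g. g \<in> G \<Longrightarrow> blinfun_apply g z = 0) \<Longrightarrow>
       \<exists>h :: 'a \<Rightarrow>\<^sub>L real. norm h \<le> 3 \<and> blinfun_apply h z = 1 \<and> (\<forall>v\<in>span B. blinfun_apply h v = 0)"
proof -
  obtain G :: "('a \<Rightarrow>\<^sub>L real) set" where G: "finite G" "\<And>g. g \<in> G \<Longrightarrow> norm g \<le> 1"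
    "\<And>v. v \<in> span B \<Longrightarrow> \<exists>g\<in>G. norm v \<le> 2 * blinfun_apply g v"
    using finite_norming_set[OF assms] by blast
  show ?thesis
  proof
    show "finite G" by fact
    fix z :: 'a assume z: "norm z = 1" "\<And>g. g \<in> G \<Longrightarrow> blinfun_apply g z = 0"
    have "1/3 \<le> norm (z - v)" if v: "v \<in> span B" for v
    proof -
      obtain g where g: "g \<in> G" "norm v \<le> 2 * blinfun_apply g v" using G(3)[OF v] by blast
      have "blinfun_apply g v = blinfun_apply g (v - z)"
        using z(2)[OF g(1)] by (simp add: blinfun.diff_right)
      also have "\<dots> \<le> norm g * norm (v - z)" using norm_blinfun[of g "v - z"] by simp
      also have "\<dots> \<le> 1 * norm (v - z)" using G(2)[OF g(1)] by (intro mult_right_mono) auto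
      finally have "norm v \<le> 2 * norm (z - v)" using g(2) by (simp add: norm_minus_commute)
      moreover have "1 \<le> norm (z - v) + norm v"
        using norm_triangle_ineq[of "z - v" v] z(1) by simp
      ultimately show ?thesis by linarith
    qed
    from functional_vanishing_on_subspace[OF subspace_span _ this]
    obtain h :: "'a \<Rightarrow>\<^sub>L real" where "norm h \<le> 1 / (1/3)" "blinfun_apply h z = 1"
      "\<And>v. v \<in> span B \<Longrightarrow> blinfun_apply h v = 0" by auto
    then show "\<exists>h :: 'a \<Rightarrow>\<^sub>L real. norm h \<le> 3 \<and> blinfun_apply h z = 1 \<and> (\<forall>v\<in>span B. blinfun_apply h v = 0)"
      by auto
  qed
qed

section \<open>Flat subspaces\<close>

text \<open>
  The negation of the step in the transfinite construction. In \<open>c\<^sub>0\<close> the whole space is flat for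
  every \<open>\<epsilon> > 0\<close>.
\<close>

definition flat :: "'a::real_normed_vector set \<Rightarrow> real \<Rightarrow> bool" where
  "flat Y \<epsilon> \<longleftrightarrow> (\<forall>x\<in>Y. norm x = 1 \<longrightarrow> (\<forall>F :: ('a \<Rightarrow>\<^sub>L real) set. finite F \<longrightarrow>
     (\<exists>z\<in>Y. norm z = 1 \<and> (\<forall>f\<in>F. blinfun_apply f z = 0) \<and> norm (x + z) < 1 + \<epsilon>)))"

text \<open>
  Flatness speaks of unit vectors, but partial sums only satisfy \<open>1 \<le> norm s\<close>. Writing
  \<open>r = norm s\<close>, the vector \<open>s + z\<close> is \<open>(r - 1)\<close> times \<open>s / r\<close> plus \<open>s / r + z\<close>, so its norm is at most
  \<open>r + \<epsilon>\<close>. Asking \<open>z\<close> to be killed by a functional norming \<open>s\<close> keeps the norm at least 1, which is what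
  makes the step repeatable.
\<close>

lemma flat_step:
  fixes Y :: "'a::real_normed_vector set" and F :: "('a \<Rightarrow>\<^sub>L real) set"
  assumes Y: "subspace Y" "e \<in> Y" "norm e = 1" and fl: "flat Y \<epsilon>" "\<epsilon> > 0"
    and s: "s \<in> Y" "s = 0 \<or> 1 \<le> norm s" and F: "finite F"
  obtains z where "z \<in> Y" "norm z = 1" "\<And>f. f \<in> F \<Longrightarrow> blinfun_apply f z = 0"
    "1 \<le> norm (s + z)" "norm (s + z) \<le> (1 + \<epsilon>) * max 1 (norm s)"
proof (cases "s = 0")
  case True
  obtain z where "z \<in> Y" "norm z = 1" "\<forall>f\<in>F. blinfun_apply f z = 0"
    using fl(1) Y F unfolding flat_def by blast
  then show ?thesis using True fl(2) by (intro that[of z]) auto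
next
  case False
  define r where "r = norm s"
  have r: "r \<ge> 1" using s False by (simp add: r_def)
  obtain g :: "'a \<Rightarrow>\<^sub>L real" where g: "norm g \<le> 1" "blinfun_apply g s = norm s"
    by (rule norming_functional)
  let ?x = "inverse r *\<^sub>R s"
  have "?x \<in> Y" "norm ?x = 1" using s Y(1) r False by (auto simp: subspace_scale r_def)
  then obtain z where z: "z \<in> Y" "norm z = 1" "\<forall>f\<in>insert g F. blinfun_apply f z = 0"
    "norm (?x + z) < 1 + \<epsilon>"
    using fl(1) F unfolding flat_def by (meson finite_insert)
  have "1 \<le> blinfun_apply g (s + z)" using g z(3) r by (simp add: blinfun.add_right r_def)
  also have "\<dots> \<le> norm g * norm (s + z)" using norm_blinfun[of g "s + z"] by simp
  also have "\<dots> \<le> 1 * norm (s + z)" using g(1) by (intro mult_right_mono) auto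
  finally have ge: "1 \<le> norm (s + z)" by simp
  have "(r - 1) *\<^sub>R ?x + ?x = s"
    using r by (simp add: algebra_simps)
  then have "s + z = (r - 1) *\<^sub>R ?x + (?x + z)"
    by (simp add: add.assoc[symmetric])
  then have "norm (s + z) \<le> norm ((r - 1) *\<^sub>R ?x) + norm (?x + z)"
    using norm_triangle_ineq by metis
  also have "norm ((r - 1) *\<^sub>R ?x) = r - 1" using r \<open>norm ?x = 1\<close> unfolding norm_scaleR by simp
  finally have "norm (s + z) \<le> r + \<epsilon>" using z(4) by simp
  also have "\<dots> \<le> (1 + \<epsilon>) * r" using r fl(2) by (simp add: algebra_simps)
  finally show ?thesis using z ge r by (intro that[of z]) (auto simp: r_def max_def)
qed

lemma residue_class_below:
  fixes d k :: nat
  assumes d: "d > 0"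
  shows "k < d \<Longrightarrow> {i. i < k \<and> i mod d = k mod d} = {}"
    and "k \<ge> d \<Longrightarrow> {i. i < k \<and> i mod d = k mod d} = insert (k - d) {i. i < k - d \<and> i mod d = (k - d) mod d}"
proof -
  show "k < d \<Longrightarrow> {i. i < k \<and> i mod d = k mod d} = {}" by auto
  assume k: "k \<ge> d"
  have mod: "(k - d) mod d = k mod d" using k by (metis le_mod_geq)
  have "i \<le> k - d" if "i < k" "i mod d = k mod d" for i
  proof -
    have "d dvd k - i" using that by (metis less_imp_le_nat mod_eq_dvd_iff_nat)
    then have "d \<le> k - i" using that by (intro dvd_imp_le) auto
    then show ?thesis using that(1) k by linarith
  qed
  then show "{i. i < k \<and> i mod d = k mod d} = insert (k - d) {i. i < k - d \<and> i mod d = (k - d) mod d}"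
    using mod d k by (auto simp: le_eq_less_or_eq)
qed

text \<open>
  The sequence is built by recursion, where step \<open>k\<close> extends the partial sum along the residue class
  of \<open>k\<close>. Every new vector is taken in the kernel of the earlier functionals \<open>h i\<close> and \<open>h i \<circ> J\<close> and of a
  norming set for the span of the earlier \<open>x i\<close> and \<open>J (x i)\<close>; the latter provides \<open>h k\<close>. The map \<open>J\<close> is
  multiplication by the imaginary unit when complex spans have to be separated, and 0 otherwise. The
  \<open>d\<close> partial sums are interlaced in a single sequence so that they share one biorthogonal system.
\<close>

lemma flat_sequence:
  fixes Y :: "'a::real_normed_vector set" and J :: "'a \<Rightarrow> 'a" and eps :: "nat \<Rightarrow> real" and d :: nat
  assumes Y: "subspace Y" "e \<in> Y" "norm e = 1" and fl: "\<And>k. flat Y (eps k)" "\<And>k. eps k > 0"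
    and d: "d > 0" and J: "bounded_linear J"
  obtains x :: "nat \<Rightarrow> 'a" and h :: "nat \<Rightarrow> 'a \<Rightarrow>\<^sub>L real" where
    "\<And>k. x k \<in> Y" "\<And>k. norm (x k) = 1" "\<And>k. norm (h k) \<le> 3" "\<And>k. blinfun_apply (h k) (x k) = 1"
    "\<And>i k. i \<noteq> k \<Longrightarrow> blinfun_apply (h k) (x i) = 0 \<and> blinfun_apply (h k) (J (x i)) = 0"
    "\<And>n j. norm (\<Sum>i | i < n \<and> i mod d = j. x i) \<le> exp (\<Sum>i<n. eps i)"
proof -
  interpret J: bounded_linear J by fact
  \<comment> \<open>The summands of the partial sum that step \<open>k\<close> extends.\<close>
  define A where "A k = {i. i < k \<and> i mod d = k mod d}" for k
  have finA [simp]: "finite (A k)" for k by (simp add: A_def)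
  define P where "P f k r \<longleftrightarrow> fst r \<in> Y \<and> norm (fst r) = 1 \<and> norm (snd r) \<le> 3 \<and>
    blinfun_apply (snd r) (fst r) = 1 \<and>
    (\<forall>i<k. blinfun_apply (snd r) (fst (f i)) = 0 \<and> blinfun_apply (snd r) (J (fst (f i))) = 0 \<and>
       blinfun_apply (snd (f i)) (fst r) = 0 \<and> blinfun_apply (snd (f i)) (J (fst r)) = 0) \<and>
    1 \<le> norm ((\<Sum>i\<in>A k. fst (f i)) + fst r) \<and>
    norm ((\<Sum>i\<in>A k. fst (f i)) + fst r) \<le> (1 + eps k) * max 1 (norm (\<Sum>i\<in>A k. fst (f i)))"
    for f :: "nat \<Rightarrow> 'a \<times> ('a \<Rightarrow>\<^sub>L real)" and k and r :: "'a \<times> ('a \<Rightarrow>\<^sub>L real)"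
  have "\<exists>f. \<forall>k. P f k (f k)"
  proof (rule dependent_wellorder_choice)
    fix r and f g :: "nat \<Rightarrow> 'a \<times> ('a \<Rightarrow>\<^sub>L real)" and k :: nat
    assume *: "\<And>y. y < k \<Longrightarrow> f y = g y"
    then have "(\<Sum>i\<in>A k. fst (f i)) = (\<Sum>i\<in>A k. fst (g i))"
      by (intro sum.cong) (auto simp: A_def)
    with * show "P f k r = P g k r" by (simp add: P_def)
  next
    fix k and f :: "nat \<Rightarrow> 'a \<times> ('a \<Rightarrow>\<^sub>L real)" assume IH: "\<And>y. y < k \<Longrightarrow> P f y (f y)"
    define s where "s = (\<Sum>i\<in>A k. fst (f i))"
    have sY: "s \<in> Y"
      unfolding s_def using IH by (intro subspace_sum[OF Y(1)]) (auto simp: A_def P_def)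
    have s1: "s = 0 \<or> 1 \<le> norm s"
    proof (cases "k < d")
      case True
      then have "A k = {}" unfolding A_def by (rule residue_class_below(1)[OF d])
      then show ?thesis by (simp add: s_def)
    next
      case False
      then have A: "A k = insert (k - d) (A (k - d))"
        unfolding A_def by (intro residue_class_below(2)[OF d]) simp
      have "s = (\<Sum>i\<in>A (k - d). fst (f i)) + fst (f (k - d))"
        unfolding s_def A by (subst sum.insert) (auto simp: A_def)
      then show ?thesis using IH[of "k - d"] False d by (auto simp: P_def)
    qed
    let ?B = "(\<lambda>i. fst (f i)) ` {..<k} \<union> (\<lambda>i. J (fst (f i))) ` {..<k}"
    have "finite ?B" by simp
    then obtain G :: "('a \<Rightarrow>\<^sub>L real) set" where G: "finite G"
      "\<And>z. norm z = 1 \<Longrightarrow> (\<And>g. g \<in> G \<Longrightarrow> blinfun_apply g z = 0) \<Longrightarrow>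
       \<exists>h :: 'a \<Rightarrow>\<^sub>L real. norm h \<le> 3 \<and> blinfun_apply h z = 1 \<and> (\<forall>v\<in>span ?B. blinfun_apply h v = 0)"
      using coordinate_functional_off_span[of ?B] by blast
    let ?F = "G \<union> (\<lambda>i. snd (f i)) ` {..<k} \<union> (\<lambda>i. snd (f i) o\<^sub>L Blinfun J) ` {..<k}"
    have "finite ?F" using G by simp
    then obtain z where z: "z \<in> Y" "norm z = 1" "\<And>g. g \<in> ?F \<Longrightarrow> blinfun_apply g z = 0"
      "1 \<le> norm (s + z)" "norm (s + z) \<le> (1 + eps k) * max 1 (norm s)"
      by (rule flat_step[OF Y fl(1)[of k] fl(2)[of k] sY s1]) blast
    then obtain h :: "'a \<Rightarrow>\<^sub>L real" where h: "norm h \<le> 3" "blinfun_apply h z = 1"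
      "\<And>v. v \<in> span ?B \<Longrightarrow> blinfun_apply h v = 0" using G(2)[of z] by blast
    have "blinfun_apply (snd (f i)) (J z) = 0" if "i < k" for i
      using z(3)[of "snd (f i) o\<^sub>L Blinfun J"] that by (simp add: bounded_linear_Blinfun_apply[OF J])
    moreover have "blinfun_apply h (fst (f i)) = 0" "blinfun_apply h (J (fst (f i))) = 0" if "i < k" for i
      using that by (auto intro!: h(3) span_base)
    ultimately have "P f k (z, h)"
      unfolding P_def fst_conv snd_conv s_def[symmetric] using z h by auto
    then show "\<exists>r. P f k r" by blast
  qed
  then obtain f where f: "\<And>k. P f k (f k)" by blast
  define x where "x k = fst (f k)" for k
  define h where "h k = snd (f k)" for k
  show ?thesis
  proof
    show "x k \<in> Y" "norm (x k) = 1" "norm (h k) \<le> 3" "blinfun_apply (h k) (x k) = 1" for k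
      using f[of k] by (auto simp: P_def x_def h_def)
    show "blinfun_apply (h k) (x i) = 0 \<and> blinfun_apply (h k) (J (x i)) = 0" if "i \<noteq> k" for i k
      using f[of k] f[of i] that by (cases i k rule: linorder_cases) (auto simp: P_def x_def h_def)
    show "norm (\<Sum>i | i < n \<and> i mod d = j. x i) \<le> exp (\<Sum>i<n. eps i)" for n j
    proof (induction n)
      case (Suc n)
      let ?s = "\<Sum>i | i < n \<and> i mod d = j. x i" and ?S = "\<Sum>i<n. eps i"
      have S0: "0 \<le> ?S" using fl(2) by (intro sum_nonneg) (auto intro: less_imp_le)
      show ?case
      proof (cases "n mod d = j")
        case True
        then have "{i. i < Suc n \<and> i mod d = j} = insert n (A n)"
          and A: "A n = {i. i < n \<and> i mod d = j}" by (auto simp: A_def less_Suc_eq)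
        then have "(\<Sum>i | i < Suc n \<and> i mod d = j. x i) = ?s + x n"
          by simp
        also have "norm \<dots> \<le> (1 + eps n) * max 1 (norm ?s)"
          using f[of n] unfolding P_def A x_def by simp
        also have "\<dots> \<le> exp (eps n) * exp ?S"
          using Suc.IH S0 fl(2)[of n] by (intro mult_mono) (auto simp: exp_ge_add_one_self)
        finally show ?thesis by (simp add: exp_add add.commute)
      next
        case False
        then have eq: "{i. i < Suc n \<and> i mod d = j} = {i. i < n \<and> i mod d = j}"
          by (auto simp: less_Suc_eq)
        have "exp ?S \<le> exp (\<Sum>i<Suc n. eps i)" using fl(2)[of n] by simp
        with Suc.IH show ?thesis unfolding eq by (rule order_trans)
      qed
    qed (simp)
  qed
qed

section \<open>Scalars, duals and real parts\<close>

text \<open>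
  The real and the complex field are treated at once by a real part \<open>re\<close> and an element \<open>ii\<close>, which is
  an imaginary unit in the complex case and 0 in the real case. The formula for \<open>z\<close> recovers a scalar
  from the real parts of \<open>z\<close> and \<open>ii * z\<close> in both cases.
\<close>

definition scalar_parts :: "'k::real_normed_field \<Rightarrow> ('k \<Rightarrow> real) \<Rightarrow> bool" where
  "scalar_parts ii re \<longleftrightarrow> bounded_linear re \<and> re 1 = 1 \<and> re ii = 0 \<and> (ii = 0 \<or> ii * ii = - 1) \<and>
     (\<forall>z. z = of_real (re z) - ii * of_real (re (ii * z)))"

lemma exists_scalar_parts: "\<exists>(ii::'k::real_or_complex) re. scalar_parts ii re"
  using real_or_complex[where 'a = 'k]
proof
  assume "\<forall>z::'k. \<exists>a. z = a *\<^sub>R 1"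
  then obtain re where re: "\<And>z::'k. z = re z *\<^sub>R 1" by metis
  have uniq: "re z = a" if "z = a *\<^sub>R 1" for z :: 'k and a
    using that re[of z] by (metis of_real_def of_real_eq_iff)
  have "bounded_linear re"
  proof (rule bounded_linear_intro)
    show "re (x + y) = re x + re y" for x y
      using re[of x] re[of y] by (intro uniq) (metis scaleR_left_distrib)
    show "re (r *\<^sub>R x) = r *\<^sub>R re x" for r x
      using re[of x] by (intro uniq) (metis real_scaleR_def scaleR_scaleR)
    show "norm (re x) \<le> norm x * 1" for x
      using arg_cong[OF re[of x], of norm] by simp
  qed
  moreover have "re 1 = 1" "re 0 = 0" by (rule uniq, simp)+
  moreover have "z = of_real (re z) - 0 * of_real (re (0 * z))" for z
    using re[of z] by (simp add: of_real_def)
  ultimately show ?thesis unfolding scalar_parts_def by (intro exI[of _ 0] exI[of _ re]) simp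
next
  assume "\<exists>i::'k. i * i = - 1 \<and> (\<forall>z. \<exists>a b. z = a *\<^sub>R 1 + b *\<^sub>R i)"
  then obtain i :: 'k and re im where i: "i * i = - 1" and z: "\<And>z. z = re z *\<^sub>R 1 + im z *\<^sub>R i"
    by metis
  have prod: "(a *\<^sub>R 1 + b *\<^sub>R i) * (a *\<^sub>R 1 - b *\<^sub>R i) = of_real (a\<^sup>2 + b\<^sup>2)" for a b :: real
  proof -
    have "(a *\<^sub>R 1 + b *\<^sub>R i) * (a *\<^sub>R 1 - b *\<^sub>R i) = of_real (a * a) - of_real (b * b) * (i * i)"
      by (simp add: scaleR_conv_of_real algebra_simps)
    then show ?thesis using i by (simp add: power2_eq_square)
  qed
  have zero: "a = 0 \<and> b = 0" if "a *\<^sub>R 1 + b *\<^sub>R i = 0" for a b :: real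
  proof -
    have "(of_real (a\<^sup>2 + b\<^sup>2) :: 'k) = 0" using prod[of a b] that by simp
    then have "a\<^sup>2 + b\<^sup>2 = 0" unfolding of_real_eq_0_iff .
    then show ?thesis by (simp add: sum_power2_eq_zero_iff)
  qed
  have uniq: "re w = a \<and> im w = b" if "w = a *\<^sub>R 1 + b *\<^sub>R i" for w a b
  proof -
    have "(re w - a) *\<^sub>R 1 + (im w - b) *\<^sub>R i = (re w *\<^sub>R 1 + im w *\<^sub>R i) - (a *\<^sub>R 1 + b *\<^sub>R i)"
      by (simp add: algebra_simps)
    also have "\<dots> = 0" using z[of w] that by simp
    finally show ?thesis using zero by fastforce
  qed
  have "norm i * norm i = 1" using i by (metis norm_minus_cancel norm_mult norm_one)
  then have ni: "norm i = 1"
    by (metis abs_norm_cancel abs_square_eq_1 power2_eq_square)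
  have bound: "\<bar>re w\<bar> \<le> norm w * 2" for w
  proof (cases "re w = 0 \<and> im w = 0")
    case False
    define a b where "a = re w" and "b = im w"
    have s: "\<bar>a\<bar> + \<bar>b\<bar> > 0" using False by (auto simp: a_def b_def)
    have "w * (a *\<^sub>R 1 - b *\<^sub>R i) = of_real (a\<^sup>2 + b\<^sup>2)" using prod[of a b] z[of w] by (simp add: a_def b_def)
    then have "norm w * norm (a *\<^sub>R 1 - b *\<^sub>R i) = a\<^sup>2 + b\<^sup>2"
      by (metis norm_mult norm_of_real abs_of_nonneg sum_power2_ge_zero)
    moreover have "norm (a *\<^sub>R 1 - b *\<^sub>R i) \<le> \<bar>a\<bar> + \<bar>b\<bar>"
      using norm_triangle_ineq4[of "a *\<^sub>R 1" "b *\<^sub>R i"] ni by simp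
    ultimately have "a\<^sup>2 + b\<^sup>2 \<le> norm w * (\<bar>a\<bar> + \<bar>b\<bar>)"
      by (metis mult_left_mono norm_ge_zero)
    moreover have "(\<bar>a\<bar> + \<bar>b\<bar>) * (\<bar>a\<bar> + \<bar>b\<bar>) \<le> 2 * (a\<^sup>2 + b\<^sup>2)"
      using sum_squares_bound[of "\<bar>a\<bar>" "\<bar>b\<bar>"] by (simp add: algebra_simps power2_eq_square)
    ultimately have "(\<bar>a\<bar> + \<bar>b\<bar>) * (\<bar>a\<bar> + \<bar>b\<bar>) \<le> (2 * norm w) * (\<bar>a\<bar> + \<bar>b\<bar>)" by simp
    then have "\<bar>a\<bar> + \<bar>b\<bar> \<le> 2 * norm w" using s by (rule mult_right_le_imp_le)
    then show ?thesis by (simp add: a_def)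
  qed simp
  have "bounded_linear re"
  proof (rule bounded_linear_intro)
    show "re (x + y) = re x + re y" for x y
    proof -
      have "(re x + re y) *\<^sub>R 1 + (im x + im y) *\<^sub>R i =
        (re x *\<^sub>R 1 + im x *\<^sub>R i) + (re y *\<^sub>R 1 + im y *\<^sub>R i)"
        by (simp add: algebra_simps)
      then have "x + y = (re x + re y) *\<^sub>R 1 + (im x + im y) *\<^sub>R i"
        unfolding z[symmetric] by simp
      then show ?thesis using uniq by blast
    qed
    show "re (r *\<^sub>R x) = r *\<^sub>R re x" for r x
    proof -
      have "(r * re x) *\<^sub>R 1 + (r * im x) *\<^sub>R i = r *\<^sub>R (re x *\<^sub>R 1 + im x *\<^sub>R i)"
        by (simp add: scaleR_right_distrib)
      then have "r *\<^sub>R x = (r * re x) *\<^sub>R 1 + (r * im x) *\<^sub>R i"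
        unfolding z[symmetric] by simp
      then show ?thesis using uniq by auto
    qed
    show "norm (re x) \<le> norm x * 2" for x using bound[of x] by simp
  qed
  moreover have "re 1 = 1" using uniq[of 1 1 0] by simp
  moreover have "re i = 0" using uniq[of i 0 1] by simp
  moreover have "w = of_real (re w) - i * of_real (re (i * w))" for w
  proof -
    have "i * w = re w *\<^sub>R i + im w *\<^sub>R (i * i)"
      using arg_cong[OF z[of w], of "\<lambda>v. i * v"] by (simp add: algebra_simps)
    then have "i * w = (- im w) *\<^sub>R 1 + re w *\<^sub>R i" by (simp add: i)
    then have "re (i * w) = - im w" using uniq by blast
    then have "of_real (re w) - i * of_real (re (i * w)) = re w *\<^sub>R 1 + im w *\<^sub>R i"
      by (simp add: scaleR_conv_of_real mult.commute)
    then show ?thesis unfolding z[symmetric] by simp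
  qed
  ultimately show ?thesis using i unfolding scalar_parts_def by blast
qed

lemma type_space_simps [simp]:
  "vcarrier (type_space sc) = UNIV" "vzero (type_space sc) = 0" "vadd (type_space sc) = (+)"
  "vsmul (type_space sc) = sc" "vnorm (type_space sc) = norm"
  by (simp_all add: type_space_def)

lemma in_dual_iff:
  "F \<in> vcarrier (dual V) \<longleftrightarrow>
     (\<forall>x\<in>vcarrier V. \<forall>y\<in>vcarrier V. F (vadd V x y) = F x + F y) \<and>
     (\<forall>c. \<forall>x\<in>vcarrier V. F (vsmul V c x) = c * F x) \<and>
     (\<exists>C. \<forall>x\<in>vcarrier V. norm (F x) \<le> C * vnorm V x) \<and> (\<forall>x. x \<notin> vcarrier V \<longrightarrow> F x = 0)"
  by (simp add: dual_def vlinear_on_def scalar_space_def)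

lemma dual_simps [simp]:
  "vadd (dual V) = (\<lambda>f g x. f x + g x)" "vsmul (dual V) = (\<lambda>c f x. c * f x)"
  "vzero (dual V) = (\<lambda>x. 0)"
  by (simp_all add: dual_def)

context normed_space
begin

lemma norm_vzero: "vnorm V (vzero V) = 0"
  using norm_eq_zero zero_closed by blast

lemma smul_zero: "x \<in> vcarrier V \<Longrightarrow> vsmul V 0 x = vzero V"
  by (metis mult_eq_0_iff norm_eq_zero norm_smul norm_zero smul_closed)

lemma norm_nonneg: "x \<in> vcarrier V \<Longrightarrow> 0 \<le> vnorm V x"
proof -
  assume x: "x \<in> vcarrier V"
  have "vnorm V (vdiff V x x) \<le> vnorm V x + vnorm V x"
    using norm_triangle[OF x smul_closed[OF x, of "- 1"]] norm_smul[OF x, of "- 1"]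
    by (simp add: vdiff_def)
  then show ?thesis using diff_self[OF x] norm_vzero by simp
qed

lemma dual_bound:
  assumes F: "F \<in> vcarrier (dual V)" and x: "x \<in> vcarrier V"
  shows "norm (F x) \<le> vnorm (dual V) F * vnorm V x"
proof (cases "vnorm V x = 0")
  case True
  obtain C where "norm (F x) \<le> C * vnorm V x" using F x by (auto simp: in_dual_iff)
  then show ?thesis using True by simp
next
  case False
  then have pos: "vnorm V x > 0" using norm_nonneg[OF x] by simp
  obtain C where C: "\<And>x. x \<in> vcarrier V \<Longrightarrow> norm (F x) \<le> C * vnorm V x"
    using F unfolding in_dual_iff by blast
  let ?c = "of_real (inverse (vnorm V x)) :: 'k"
  let ?B = "{x \<in> vcarrier V. vnorm V x \<le> 1}"
  have "bdd_above ((\<lambda>x. norm (F x)) ` ?B)"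
  proof (rule bdd_aboveI2)
    fix y assume y: "y \<in> ?B"
    have "norm (F y) \<le> C * vnorm V y" using C y by simp
    also have "\<dots> \<le> \<bar>C\<bar> * 1" using y norm_nonneg[of y] by (intro mult_mono) auto
    finally show "norm (F y) \<le> \<bar>C\<bar>" by simp
  qed
  moreover have "vsmul V ?c x \<in> ?B"
    using x pos by (simp add: smul_closed norm_smul norm_inverse)
  ultimately have "norm (F (vsmul V ?c x)) \<le> vnorm (dual V) F"
    unfolding dual_def by (auto intro: cSUP_upper2)
  moreover have "norm (F (vsmul V ?c x)) = norm (F x) / vnorm V x"
    using F x pos by (simp add: in_dual_iff norm_mult norm_inverse divide_inverse mult.commute)
  ultimately have "norm (F x) / vnorm V x \<le> vnorm (dual V) F" by simp
  then show ?thesis using pos by (simp only: pos_divide_le_eq)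
qed

lemma canonical_in_bidual:
  assumes x: "x \<in> vcarrier V"
  shows "canonical V x \<in> vcarrier (bidual V)"
proof -
  interpret D: normed_space "dual V" by (rule normed_space_dual)
  have "norm (F x) \<le> vnorm V x * vnorm (dual V) F" if "F \<in> vcarrier (dual V)" for F
    using dual_bound[OF that x] by (simp add: mult.commute)
  then show ?thesis
    using D.add_closed D.smul_closed by (auto simp: in_dual_iff[of _ "dual V"] canonical_def)
qed

text \<open>
  Linearity over the scalar field reduces to real linearity and the multiplier \<open>ii\<close>.
\<close>

lemma additive_smulI:
  fixes ii :: 'k
  assumes parts: "scalar_parts ii re" and x: "x \<in> vcarrier V"
    and add: "\<And>x y. x \<in> vcarrier V \<Longrightarrow> y \<in> vcarrier V \<Longrightarrow> G (vadd V x y) = G x + G y"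
    and real: "\<And>r x. x \<in> vcarrier V \<Longrightarrow> G (vsmul V (of_real r) x) = of_real r * G x"
    and imag: "\<And>x. x \<in> vcarrier V \<Longrightarrow> G (vsmul V ii x) = ii * G x"
  shows "G (vsmul V c x) = c * (G x :: 'k)"
proof -
  define a b where "a = re c" and "b = - re (ii * c)"
  have c: "c = of_real a + ii * of_real b"
    using parts by (simp add: scalar_parts_def a_def b_def)
  have "G (vsmul V c x) = G (vsmul V (of_real a) x) + G (vsmul V ii (vsmul V (of_real b) x))"
    unfolding c using x by (simp add: smul_add_left smul_smul add smul_closed)
  also have "\<dots> = c * G x"
    using x by (simp add: real imag smul_closed c algebra_simps)
  finally show ?thesis .
qed

end

text \<open>
  The defect \<open>g r - r *\<^sub>R g 1\<close> is additive and vanishes on the integers, so at \<open>n * r\<close> it only depends on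
  the fractional part and is bounded independently of \<open>n\<close>; it is therefore 0.
\<close>

lemma additive_bounded_imp_scaleR:
  fixes g :: "real \<Rightarrow> 'a::real_normed_vector"
  assumes add: "\<And>r s. g (r + s) = g r + g s" and bound: "\<And>r. norm (g r) \<le> \<bar>r\<bar> * M"
  shows "g r = r *\<^sub>R g 1"
proof -
  define D where "D r = g r - r *\<^sub>R g 1" for r
  have Dadd: "D (r + s) = D r + D s" for r s by (simp add: D_def add algebra_simps)
  have D1: "D 1 = 0" by (simp add: D_def)
  have D0: "D 0 = 0" using Dadd[of 0 0] by simp
  have Dneg: "D (- r) = - D r" for r using Dadd[of r "- r"] D0 by (simp add: add_eq_0_iff)
  have Dnat: "D (real n * r) = real n *\<^sub>R D r" for n r
    by (induction n) (simp_all add: D0 Dadd distrib_right scaleR_left_distrib)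
  have Dint: "D (of_int m) = 0" for m
  proof (cases m rule: int_cases2)
    case (nonneg n) then show ?thesis using Dnat[of n 1] D1 by simp
  next
    case (nonpos n) then show ?thesis using Dnat[of n 1] D1 Dneg[of "real n"] by simp
  qed
  have Dbound: "norm (D t) \<le> 2 * \<bar>M\<bar>" if "\<bar>t\<bar> \<le> 1" for t
  proof -
    have "norm (D t) \<le> norm (g t) + \<bar>t\<bar> * norm (g 1)"
      unfolding D_def using norm_triangle_ineq4[of "g t" "t *\<^sub>R g 1"] by simp
    also have "\<dots> \<le> 1 * \<bar>M\<bar> + 1 * \<bar>M\<bar>"
    proof (intro add_mono mult_mono)
      show "norm (g t) \<le> 1 * \<bar>M\<bar>"
      proof -
        have "\<bar>t\<bar> * M \<le> \<bar>t\<bar> * \<bar>M\<bar>" by (intro mult_left_mono) auto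
        also have "\<dots> \<le> 1 * \<bar>M\<bar>" using that by (intro mult_right_mono) auto
        finally show ?thesis using bound[of t] by linarith
      qed
      show "norm (g 1) \<le> \<bar>M\<bar>" using bound[of 1] by simp
    qed (use that in auto)
    finally show ?thesis by simp
  qed
  have "real n * norm (D r) \<le> 2 * \<bar>M\<bar>" for n
  proof -
    have "real n * r = of_int \<lfloor>real n * r\<rfloor> + frac (real n * r)" by (simp add: frac_def)
    then have "real n *\<^sub>R D r = D (frac (real n * r))"
      using Dadd[of "of_int \<lfloor>real n * r\<rfloor>" "frac (real n * r)"] Dint Dnat[of n r] by simp
    moreover have "norm (D (frac (real n * r))) \<le> 2 * \<bar>M\<bar>"
      by (rule Dbound) (simp add: frac_lt_1 less_imp_le)
    ultimately have "norm (real n *\<^sub>R D r) \<le> 2 * \<bar>M\<bar>" by simp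
    then show ?thesis by simp
  qed
  moreover have "\<exists>n. 2 * \<bar>M\<bar> < real n * norm (D r)" if "norm (D r) > 0"
    using reals_Archimedean3[OF that] by (auto simp: mult.commute)
  ultimately have "\<not> norm (D r) > 0" by (meson not_le)
  then show ?thesis by (simp add: D_def)
qed

locale scalar_banach =
  fixes sc :: "'k::real_or_complex \<Rightarrow> 'a::banach \<Rightarrow> 'a" and ii :: 'k and re :: "'k \<Rightarrow> real"
  assumes bs: "banach_space (type_space sc)" and parts: "scalar_parts ii re"
begin

sublocale V: banach_space "type_space sc" by (rule bs)

lemma sc_simps:
  "sc c (x + y) = sc c x + sc c y" "sc (c + d) x = sc c x + sc d x"
  "sc c (sc d x) = sc (c * d) x" "sc 1 x = x" "norm (sc c x) = norm c * norm x"
  using V.smul_add_right[of x y c] V.smul_add_left[of x c d] V.smul_smul[of x c d]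
    V.smul_one[of x] V.norm_smul[of x c] by auto

lemma sc_of_real: "sc (of_real r) x = r *\<^sub>R x"
proof -
  have "sc (of_real r) x = r *\<^sub>R sc (of_real 1) x"
    by (rule additive_bounded_imp_scaleR[where M = "norm x" and g = "\<lambda>r. sc (of_real r) x"]) (simp_all add: sc_simps)
  then show ?thesis by (simp add: sc_simps)
qed

lemma sc_zero: "sc 0 x = 0" using sc_of_real[of 0 x] by simp

lemma sc_minus: "sc (- c) x = - sc c x"
  using sc_simps(2)[of c "- c" x] by (simp add: sc_zero add_eq_0_iff)

lemma sc_scaleR: "sc c (r *\<^sub>R x) = r *\<^sub>R sc c x"
  unfolding sc_of_real[symmetric] by (simp add: sc_simps mult.commute)

lemma bounded_linear_sc: "bounded_linear (sc c)"
  by (rule bounded_linear_intro[where K = "norm c"]) (simp_all add: sc_simps sc_scaleR mult.commute)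

lemma bl_re: "bounded_linear re" using parts by (simp add: scalar_parts_def)

lemma re_of_real_minus: "re (of_real a - ii * of_real b) = a"
proof -
  interpret bounded_linear re by (rule bl_re)
  have "re (of_real a) = a" using scaleR[of a 1] parts by (simp add: scalar_parts_def of_real_def)
  moreover have "re (ii * of_real b) = 0"
    using scaleR[of b ii] parts by (simp add: scalar_parts_def scaleR_conv_of_real mult.commute)
  ultimately show ?thesis by (simp add: diff)
qed

lemma scalar_expand: "z = of_real (re z) - ii * of_real (re (ii * z))"
  using parts unfolding scalar_parts_def by blast

lemma infinite_dimensional_real:
  assumes inf: "infinite_dimensional (type_space sc)" and B: "finite B"
  shows "span B \<noteq> (UNIV :: 'a set)"
proof
  assume *: "span B = UNIV"
  have sub: "subspace E" if E: "vsubspace (type_space sc) E" for E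
  proof (rule subspaceI)
    show "r *\<^sub>R x \<in> E" if "x \<in> E" for r x
      using E that unfolding sc_of_real[symmetric] by (simp add: vsubspace_def)
  qed (use E in \<open>auto simp: vsubspace_def\<close>)
  have "UNIV \<subseteq> vspan (type_space sc) B"
    unfolding vspan_def *[symmetric]
  proof (rule subsetI)
    fix x assume x: "x \<in> span B"
    show "x \<in> vsubspace (type_space sc) hull B"
      unfolding hull_def
    proof clarify
      fix E assume "vsubspace (type_space sc) E" "B \<subseteq> E"
      then show "x \<in> E" using x span_minimal[OF _ sub] by blast
    qed
  qed
  then show False
    using inf B unfolding infinite_dimensional_def fin_dim_subspace_def by auto
qed

text \<open>
  The inverse of taking real parts, from real-linear functionals to functionals over \<open>'k\<close>.
\<close>

definition complexify :: "('a \<Rightarrow> real) \<Rightarrow> 'a \<Rightarrow> 'k" where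
  "complexify f x = of_real (f x) - ii * of_real (f (sc ii x))"

lemma re_complexify: "re (complexify f x) = f x"
  by (simp add: complexify_def re_of_real_minus)

lemma norm_complexify_le:
  assumes "\<And>x. \<bar>f x\<bar> \<le> K * norm x"
  shows "norm (complexify f x) \<le> (K + norm ii * (K * norm ii)) * norm x"
proof -
  have "norm (complexify f x) \<le> \<bar>f x\<bar> + norm ii * \<bar>f (sc ii x)\<bar>"
    unfolding complexify_def using norm_triangle_ineq4[of "of_real (f x) :: 'k" "ii * of_real (f (sc ii x))"]
    by (simp add: norm_mult)
  also have "\<dots> \<le> K * norm x + norm ii * (K * norm (sc ii x))"
    by (intro add_mono mult_left_mono assms) auto
  finally show ?thesis by (simp add: sc_simps algebra_simps)
qed

lemma complexify_in_dual:
  assumes f: "bounded_linear f"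
  shows "complexify f \<in> vcarrier (dual (type_space sc))"
proof -
  interpret f: bounded_linear f by fact
  have add: "complexify f (x + y) = complexify f x + complexify f y" for x y
    by (simp add: complexify_def f.add sc_simps algebra_simps)
  have "complexify f (vsmul (type_space sc) c x) = c * complexify f x" for c x
  proof (rule V.additive_smulI[OF parts])
    show "complexify f (vsmul (type_space sc) (of_real r) x) = of_real r * complexify f x" for r x
      by (simp add: complexify_def sc_of_real sc_scaleR f.scaleR algebra_simps)
    show "complexify f (vsmul (type_space sc) ii x) = ii * complexify f x" for x
    proof (cases "ii = 0")
      case True
      have "complexify f 0 = 0" using V.smul_zero[of 0] add[of 0 0] by simp
      with True show ?thesis by (simp add: sc_zero)
    next
      case False
      then have i2: "ii * ii = - 1" using parts by (auto simp: scalar_parts_def)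
      then have "sc ii (sc ii x) = - x" by (simp add: sc_simps sc_minus)
      then show ?thesis using i2 by (simp add: complexify_def f.neg algebra_simps flip: mult.assoc)
    qed
  qed (simp_all add: add)
  moreover have "norm (complexify f x) \<le> (onorm f + norm ii * (onorm f * norm ii)) * norm x" for x
    using onorm[OF f] by (intro norm_complexify_le) simp
  ultimately show ?thesis using add by (auto simp: in_dual_iff)
qed

definition re_part :: "('a \<Rightarrow> 'k) \<Rightarrow> 'a \<Rightarrow>\<^sub>L real" where
  "re_part F = Blinfun (\<lambda>x. re (F x))"

lemma re_part_apply:
  assumes F: "F \<in> vcarrier (dual (type_space sc))"
  shows "blinfun_apply (re_part F) x = re (F x)"
    and "norm (re_part F) \<le> onorm re * vnorm (dual (type_space sc)) F"
proof -
  interpret re: bounded_linear re by (rule bl_re)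
  have bound: "norm (re (F x)) \<le> (onorm re * vnorm (dual (type_space sc)) F) * norm x" for x
  proof -
    have "norm (re (F x)) \<le> onorm re * norm (F x)" by (rule onorm[OF bl_re])
    also have "\<dots> \<le> onorm re * (vnorm (dual (type_space sc)) F * norm x)"
      using V.dual_bound[OF F, of x] onorm_pos_le[OF bl_re] by (intro mult_left_mono) auto
    finally show ?thesis by (simp add: mult.assoc)
  qed
  have "bounded_linear (\<lambda>x. re (F x))"
  proof (rule bounded_linear_intro)
    show "re (F (x + y)) = re (F x) + re (F y)" for x y
      using F by (simp add: in_dual_iff re.add)
    show "re (F (r *\<^sub>R x)) = r *\<^sub>R re (F x)" for r x
      using F re.scaleR[of r "F x"] unfolding in_dual_iff sc_of_real[symmetric]
      by (simp add: scaleR_conv_of_real)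
    show "norm (re (F x)) \<le> norm x * (onorm re * vnorm (dual (type_space sc)) F)" for x
      using bound[of x] by (simp add: mult.commute)
  qed
  then show ap: "blinfun_apply (re_part F) x = re (F x)" for x
    by (simp add: re_part_def bounded_linear_Blinfun_apply)
  have "0 \<le> vnorm (dual (type_space sc)) F"
    using normed_space.norm_nonneg[OF V.normed_space_dual F] .
  then show "norm (re_part F) \<le> onorm re * vnorm (dual (type_space sc)) F"
    using bound onorm_pos_le[OF bl_re] by (intro norm_blinfun_bound) (auto simp: ap)
qed

end

section \<open>Finite codimension in the bidual, over the reals\<close>

text \<open>
  Gaussian elimination: an unknown that occurs in the equation of \<open>i0\<close> is solved for and eliminated
  from the other equations.
\<close>

lemma exists_nontrivial_relation:
  fixes A :: "'i \<Rightarrow> 'j \<Rightarrow> real"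
  assumes "finite I" "finite K" "card I < card K"
  shows "\<exists>c. (\<exists>j\<in>K. c j \<noteq> 0) \<and> (\<forall>i\<in>I. (\<Sum>j\<in>K. c j * A i j) = 0)"
  using assms
proof (induction I arbitrary: K A rule: finite_induct)
  case empty
  then show ?case by (intro exI[of _ "\<lambda>_. 1"]) (auto simp: card_gt_0_iff)
next
  case (insert i0 I)
  show ?case
  proof (cases "\<forall>j\<in>K. A i0 j = 0")
    case True
    have "card I < card K" using insert by simp
    from insert.IH[OF insert.prems(1) this, of A] show ?thesis using True by auto
  next
    case False
    then obtain j0 where j0: "j0 \<in> K" "A i0 j0 \<noteq> 0" by blast
    define A' where "A' i j = A i j - A i j0 * A i0 j / A i0 j0" for i j
    have "card I < card (K - {j0})" using insert j0 by simp
    from insert.IH[OF _ this, of A'] insert.prems(1)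
    obtain c where c: "\<exists>j\<in>K - {j0}. c j \<noteq> 0" "\<And>i. i \<in> I \<Longrightarrow> (\<Sum>j\<in>K - {j0}. c j * A' i j) = 0"
      by auto
    define t where "t = - (\<Sum>j\<in>K - {j0}. c j * A i0 j) / A i0 j0"
    define c' where "c' = c(j0 := t)"
    have sum: "(\<Sum>j\<in>K. c' j * A i j) = t * A i j0 + (\<Sum>j\<in>K - {j0}. c j * A i j)" for i
      using insert.prems(1) j0(1) by (subst sum.remove[of _ j0]) (auto simp: c'_def intro!: sum.cong)
    have "(\<Sum>j\<in>K. c' j * A i j) = 0" if i: "i \<in> insert i0 I" for i
    proof (cases "i = i0")
      case True
      then show ?thesis using j0 by (simp add: sum t_def)
    next
      case False
      have "(\<Sum>j\<in>K - {j0}. c j * A' i j) =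
        (\<Sum>j\<in>K - {j0}. c j * A i j) - (\<Sum>j\<in>K - {j0}. c j * A i0 j) * (A i j0 / A i0 j0)"
        unfolding A'_def sum_distrib_right sum_subtractf[symmetric]
        by (intro sum.cong) (auto simp: algebra_simps)
      then show ?thesis using c(2)[of i] i False by (simp add: sum t_def field_simps)
    qed
    moreover have "\<exists>j\<in>K. c' j \<noteq> 0" using c(1) by (auto simp: c'_def)
    ultimately show ?thesis by blast
  qed
qed


text \<open>
  The real form of quasi-reflexivity: any \<open>d\<close> elements of the real bidual are linearly dependent modulo
  the canonical image of the space, that is, this image has codimension less than \<open>d\<close>.
\<close>

definition finite_deficiency :: "'a::real_normed_vector itself \<Rightarrow> nat \<Rightarrow> bool" where
  "finite_deficiency _ d \<longleftrightarrow> (\<forall>\<Lambda> :: nat \<Rightarrow> ('a \<Rightarrow>\<^sub>L real) \<Rightarrow>\<^sub>L real. \<exists>c x.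
     (\<exists>j<d. c j \<noteq> 0) \<and> (\<forall>f. (\<Sum>j<d. c j * blinfun_apply (\<Lambda> j) f) = blinfun_apply f x))"

context scalar_banach
begin

abbreviation "V \<equiv> type_space sc"

lemma imag_in_dual: "F \<in> vcarrier (dual V) \<Longrightarrow> (\<lambda>x. c * F x) \<in> vcarrier (dual V)"
  using normed_space.smul_closed[OF V.normed_space_dual, of F c] by simp

lemma add_in_dual:
  "F \<in> vcarrier (dual V) \<Longrightarrow> G \<in> vcarrier (dual V) \<Longrightarrow> (\<lambda>x. F x + G x) \<in> vcarrier (dual V)"
  using normed_space.add_closed[OF V.normed_space_dual, of F G] by simp

text \<open>
  An element of the real bidual, read as an element of the bidual over \<open>'k\<close>: the same passage from a
  real part to a functional over \<open>'k\<close> as in \<open>complexify\<close>, one level higher. It vanishes outside the dual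
  since elements of the bidual do.
\<close>

definition bidual_extension :: "(('a \<Rightarrow>\<^sub>L real) \<Rightarrow>\<^sub>L real) \<Rightarrow> ('a \<Rightarrow> 'k) \<Rightarrow> 'k" where
  "bidual_extension \<Lambda> F = (if F \<in> vcarrier (dual V)
     then of_real (blinfun_apply \<Lambda> (re_part F)) - ii * of_real (blinfun_apply \<Lambda> (re_part (\<lambda>x. ii * F x)))
     else 0)"

lemma re_part_add:
  assumes "F \<in> vcarrier (dual V)" "G \<in> vcarrier (dual V)"
  shows "re_part (\<lambda>x. F x + G x) = re_part F + re_part G"
proof -
  interpret re: bounded_linear re by (rule bl_re)
  show ?thesis
    using assms by (intro blinfun_eqI) (simp add: re_part_apply add_in_dual plus_blinfun.rep_eq re.add)
qed

lemma re_part_scale: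
  assumes "F \<in> vcarrier (dual V)"
  shows "re_part (\<lambda>x. of_real r * F x) = r *\<^sub>R re_part F"
proof -
  interpret re: bounded_linear re by (rule bl_re)
  show ?thesis
    using assms re.scaleR by (intro blinfun_eqI) (simp add: re_part_apply imag_in_dual scaleR_blinfun.rep_eq scaleR_conv_of_real)
qed

lemma bidual_extension_in_bidual: "bidual_extension \<Lambda> \<in> vcarrier (bidual V)"
proof -
  interpret D: normed_space "dual V" by (rule V.normed_space_dual)
  note L = blinfun.add_right blinfun.scaleR_right blinfun.minus_right
  have add: "bidual_extension \<Lambda> (\<lambda>x. F x + G x) = bidual_extension \<Lambda> F + bidual_extension \<Lambda> G"
    if F: "F \<in> vcarrier (dual V)" and G: "G \<in> vcarrier (dual V)" for F G
  proof -
    have "(\<lambda>x. ii * (F x + G x)) = (\<lambda>x. ii * F x + ii * G x)" by (simp add: distrib_left)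
    then show ?thesis
      using F G by (simp add: bidual_extension_def add_in_dual imag_in_dual re_part_add L) (simp add: algebra_simps)
  qed
  have real: "bidual_extension \<Lambda> (\<lambda>x. of_real r * F x) = of_real r * bidual_extension \<Lambda> F"
    if F: "F \<in> vcarrier (dual V)" for r F
  proof -
    have "(\<lambda>x. ii * (of_real r * F x)) = (\<lambda>x. of_real r * (ii * F x))" by (simp add: mult.left_commute)
    then show ?thesis
      using F by (simp add: bidual_extension_def imag_in_dual re_part_scale L) (simp add: algebra_simps)
  qed
  have imag: "bidual_extension \<Lambda> (\<lambda>x. ii * F x) = ii * bidual_extension \<Lambda> F"
    if F: "F \<in> vcarrier (dual V)" for F
  proof (cases "ii = 0")
    case True
    have "bidual_extension \<Lambda> (\<lambda>x. of_real 0 * F x) = 0" using real[OF F, of 0] by simp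
    with True show ?thesis by simp
  next
    case False
    then have i2: "ii * ii = - 1" using parts by (auto simp: scalar_parts_def)
    then have "(\<lambda>x. ii * (ii * F x)) = (\<lambda>x. of_real (- 1) * F x)" by (simp flip: mult.assoc)
    then have "re_part (\<lambda>x. ii * (ii * F x)) = - re_part F"
      using re_part_scale[OF F, of "- 1"] by simp
    then show ?thesis
      using F i2 by (simp add: bidual_extension_def imag_in_dual L algebra_simps flip: mult.assoc)
  qed
  have "bidual_extension \<Lambda> (vsmul (dual V) c F) = c * bidual_extension \<Lambda> F"
    if F: "F \<in> vcarrier (dual V)" for c F
    by (rule D.additive_smulI[OF parts F]) (simp_all add: add real imag)
  moreover have "norm (bidual_extension \<Lambda> F)
      \<le> (norm \<Lambda> * onorm re + norm ii * (norm \<Lambda> * (onorm re * norm ii))) * vnorm (dual V) F"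
    if F: "F \<in> vcarrier (dual V)" for F
  proof -
    have b: "\<bar>blinfun_apply \<Lambda> (re_part G)\<bar> \<le> norm \<Lambda> * (onorm re * vnorm (dual V) G)"
      if G: "G \<in> vcarrier (dual V)" for G
    proof -
      have "norm \<Lambda> * norm (re_part G) \<le> norm \<Lambda> * (onorm re * vnorm (dual V) G)"
        using re_part_apply(2)[OF G] by (intro mult_left_mono) auto
      then show ?thesis using norm_blinfun[of \<Lambda> "re_part G"] by simp
    qed
    have "norm (bidual_extension \<Lambda> F) \<le> \<bar>blinfun_apply \<Lambda> (re_part F)\<bar>
        + norm ii * \<bar>blinfun_apply \<Lambda> (re_part (\<lambda>x. ii * F x))\<bar>"
      unfolding bidual_extension_def
      using F norm_triangle_ineq4[of "of_real (blinfun_apply \<Lambda> (re_part F)) :: 'k"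
        "ii * of_real (blinfun_apply \<Lambda> (re_part (\<lambda>x. ii * F x)))"]
      by (simp add: norm_mult)
    also have "\<dots> \<le> norm \<Lambda> * (onorm re * vnorm (dual V) F)
        + norm ii * (norm \<Lambda> * (onorm re * vnorm (dual V) (\<lambda>x. ii * F x)))"
      using b[OF F] b[OF imag_in_dual[OF F]] by (intro add_mono mult_left_mono) auto
    also have "vnorm (dual V) (\<lambda>x. ii * F x) = norm ii * vnorm (dual V) F"
      using D.norm_smul[OF F, of ii] by simp
    finally show ?thesis by (simp add: algebra_simps)
  qed
  ultimately show ?thesis
    unfolding in_dual_iff[of _ "dual V"] using add by (auto simp: bidual_extension_def)
qed

lemma re_bidual_extension_complexify:
  "re (bidual_extension \<Lambda> (complexify (blinfun_apply f))) = blinfun_apply \<Lambda> f"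
proof -
  let ?F = "complexify (blinfun_apply f)"
  have F: "?F \<in> vcarrier (dual V)" by (intro complexify_in_dual blinfun.bounded_linear_right)
  have "re_part ?F = f" by (intro blinfun_eqI) (simp add: re_part_apply[OF F] re_complexify)
  then show ?thesis using F by (simp add: bidual_extension_def re_of_real_minus)
qed

text \<open>
  The elements with such an expansion form a subspace that contains all generators.
\<close>

lemma finite_codimension_expansion:
  assumes "quasi_reflexive V"
  obtains B where "finite B" "\<And>\<Theta>. \<Theta> \<in> vcarrier (bidual V) \<Longrightarrow>
    \<exists>x a. \<forall>F\<in>vcarrier (dual V). \<Theta> F = F x + (\<Sum>b\<in>B. a b * b F)"
proof -
  interpret D: normed_space "dual V" by (rule V.normed_space_dual)
  interpret DD: normed_space "bidual V" by (rule D.normed_space_dual)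
  obtain B where B: "finite B" "B \<subseteq> vcarrier (bidual V)"
    "vspan (bidual V) (canonical V ` UNIV \<union> B) = vcarrier (bidual V)"
    using assms by (auto simp: quasi_reflexive_def finite_codimension_def)
  define T where "T = {\<Theta> \<in> vcarrier (bidual V).
    \<exists>x a. \<forall>F\<in>vcarrier (dual V). \<Theta> F = F x + (\<Sum>b\<in>B. a b * b F)}"
  have TI: "\<Theta> \<in> T" if "\<Theta> \<in> vcarrier (bidual V)"
    "\<And>F. F \<in> vcarrier (dual V) \<Longrightarrow> \<Theta> F = F x + (\<Sum>b\<in>B. a b * b F)" for \<Theta> x a
    using that unfolding T_def by blast
  have dual_lin: "F (x + y) = F x + F y" "F (sc c x) = c * F x" if "F \<in> vcarrier (dual V)" for F x y c
    using that by (simp_all add: in_dual_iff)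
  have dual0: "F 0 = 0" if "F \<in> vcarrier (dual V)" for F
    using dual_lin(1)[OF that, of 0 0] by simp
  have "vsubspace (bidual V) T"
    unfolding vsubspace_def
  proof (intro conjI ballI allI)
    show "T \<subseteq> vcarrier (bidual V)" by (auto simp: T_def)
    show "vzero (bidual V) \<in> T"
      using DD.zero_closed dual0 by (intro TI[where x = 0 and a = "\<lambda>_. 0"]) auto
    fix \<Theta> assume "\<Theta> \<in> T"
    then obtain x a where t: "\<Theta> \<in> vcarrier (bidual V)"
      "\<And>F. F \<in> vcarrier (dual V) \<Longrightarrow> \<Theta> F = F x + (\<Sum>b\<in>B. a b * b F)"
      unfolding T_def by blast
    show "vsmul (bidual V) c \<Theta> \<in> T" for c
      using DD.smul_closed[OF t(1), of c] dual_lin(2)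
      by (intro TI[where x = "sc c x" and a = "\<lambda>b. c * a b"])
        (auto simp: t(2) distrib_left sum_distrib_left mult.assoc)
    fix \<Theta>' assume "\<Theta>' \<in> T"
    then obtain x' a' where t': "\<Theta>' \<in> vcarrier (bidual V)"
      "\<And>F. F \<in> vcarrier (dual V) \<Longrightarrow> \<Theta>' F = F x' + (\<Sum>b\<in>B. a' b * b F)"
      unfolding T_def by blast
    show "vadd (bidual V) \<Theta> \<Theta>' \<in> T"
      using DD.add_closed[OF t(1) t'(1)] dual_lin(1)
      by (intro TI[where x = "x + x'" and a = "\<lambda>b. a b + a' b"])
        (auto simp: t(2) t'(2) distrib_right sum.distrib)
  qed
  moreover have "canonical V x \<in> T" for x
    using V.canonical_in_bidual[of x]
    by (intro TI[where x = x and a = "\<lambda>_. 0"]) (auto simp: canonical_def)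
  moreover have "b \<in> T" if "b \<in> B" for b
    using that B dual0
    by (intro TI[where x = 0 and a = "\<lambda>b'. if b' = b then 1 else 0"]) (auto simp: if_distrib if_distribR cong: if_cong)
  ultimately have "vspan (bidual V) (canonical V ` UNIV \<union> B) \<subseteq> T"
    unfolding vspan_def by (intro hull_minimal) auto
  then show ?thesis using that[OF B(1)] B(3) unfolding T_def by blast
qed

text \<open>
  Modulo the canonical image every element of the bidual has coordinates \<open>a j b\<close> with respect to
  finitely many \<open>b\<close>. A real relation among more elements than there are real coordinates (two for each
  \<open>b\<close>) makes all of them vanish.
\<close>

theorem quasi_reflexive_imp_finite_deficiency:
  assumes "quasi_reflexive V"
  shows "\<exists>d. finite_deficiency TYPE('a) d"
proof -
  interpret re: bounded_linear re by (rule bl_re)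
  obtain B where B: "finite B" "\<And>\<Theta>. \<Theta> \<in> vcarrier (bidual V) \<Longrightarrow>
    \<exists>x a. \<forall>F\<in>vcarrier (dual V). \<Theta> F = F x + (\<Sum>b\<in>B. a b * b F)"
    using finite_codimension_expansion[OF assms] by blast
  \<comment> \<open>One more than the number of equations: \<open>Inl b\<close> stands for the real part and \<open>Inr b\<close> for the
    imaginary part of the coordinate at \<open>b\<close>.\<close>
  define d where "d = Suc (card (B <+> B))"
  have "finite_deficiency TYPE('a) d"
    unfolding finite_deficiency_def
  proof
    fix \<Lambda> :: "nat \<Rightarrow> ('a \<Rightarrow>\<^sub>L real) \<Rightarrow>\<^sub>L real"
    have "\<exists>p. \<forall>F\<in>vcarrier (dual V). bidual_extension (\<Lambda> j) F = F (fst p) + (\<Sum>b\<in>B. snd p b * b F)" for j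
      using B(2)[OF bidual_extension_in_bidual[of "\<Lambda> j"]] by simp
    then have "\<forall>j. \<exists>p. \<forall>F\<in>vcarrier (dual V). bidual_extension (\<Lambda> j) F = F (fst p) + (\<Sum>b\<in>B. snd p b * b F)"
      by (rule allI)
    from choice[OF this] obtain p where
      p: "\<forall>j. \<forall>F\<in>vcarrier (dual V). bidual_extension (\<Lambda> j) F = F (fst (p j)) + (\<Sum>b\<in>B. snd (p j) b * b F)" ..
    define x where "x j = fst (p j)" for j
    define a where "a j = snd (p j)" for j
    have xa: "bidual_extension (\<Lambda> j) F = F (x j) + (\<Sum>b\<in>B. a j b * b F)"
      if "F \<in> vcarrier (dual V)" for j F
      using p that by (simp add: x_def a_def)
    define A where "A i j = (case i of Inl b \<Rightarrow> re (a j b) | Inr b \<Rightarrow> re (ii * a j b))"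
      for i :: "(('a \<Rightarrow> 'k) \<Rightarrow> 'k) + (('a \<Rightarrow> 'k) \<Rightarrow> 'k)" and j :: nat
    obtain c where c: "\<exists>j\<in>{..<d}. c j \<noteq> 0" "\<And>i. i \<in> B <+> B \<Longrightarrow> (\<Sum>j<d. c j * A i j) = 0"
      using exists_nontrivial_relation[of "B <+> B" "{..<d}" A] B(1) by (auto simp: d_def)
    have comb: "(\<Sum>j<d. of_real (c j) * a j b) = 0" if b: "b \<in> B" for b
    proof -
      let ?z = "\<Sum>j<d. of_real (c j) * a j b"
      have "re ?z = (\<Sum>j<d. c j * re (a j b))"
        by (simp add: re.sum re.scaleR flip: scaleR_conv_of_real)
      then have 1: "re ?z = 0" using c(2)[OF InlI[OF b]] by (simp add: A_def)
      have "ii * ?z = (\<Sum>j<d. c j *\<^sub>R (ii * a j b))"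
        by (simp add: sum_distrib_left scaleR_conv_of_real mult.left_commute)
      then have "re (ii * ?z) = (\<Sum>j<d. c j * re (ii * a j b))"
        by (simp add: re.sum re.scaleR)
      then have 2: "re (ii * ?z) = 0" using c(2)[OF InrI[OF b]] by (simp add: A_def)
      show ?thesis using scalar_expand[of ?z, unfolded 1 2] by simp
    qed
    have "(\<Sum>j<d. c j * blinfun_apply (\<Lambda> j) f) = blinfun_apply f (\<Sum>j<d. c j *\<^sub>R x j)" for f
    proof -
      let ?F = "complexify (blinfun_apply f)"
      have F: "?F \<in> vcarrier (dual V)" by (intro complexify_in_dual blinfun.bounded_linear_right)
      have "(\<Sum>j<d. of_real (c j) * (\<Sum>b\<in>B. a j b * b ?F)) = (\<Sum>b\<in>B. (\<Sum>j<d. of_real (c j) * a j b) * b ?F)"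
        unfolding sum_distrib_left sum_distrib_right by (subst sum.swap) (simp add: mult.assoc)
      also have "\<dots> = 0" by (simp add: comb)
      finally have z: "(\<Sum>j<d. of_real (c j) * (\<Sum>b\<in>B. a j b * b ?F)) = 0" .
      have "(\<Sum>j<d. of_real (c j) * bidual_extension (\<Lambda> j) ?F) = (\<Sum>j<d. of_real (c j) * ?F (x j))"
        using z by (simp add: xa[OF F] distrib_left sum.distrib)
      then have "re (\<Sum>j<d. c j *\<^sub>R bidual_extension (\<Lambda> j) ?F) = re (\<Sum>j<d. c j *\<^sub>R ?F (x j))"
        by (simp add: scaleR_conv_of_real)
      then show ?thesis
        by (simp add: re.sum re.scaleR re_bidual_extension_complexify re_complexify blinfun.sum_right blinfun.scaleR_right)
    qed
    then show "\<exists>c x. (\<exists>j<d. c j \<noteq> 0) \<and> (\<forall>f. (\<Sum>j<d. c j * blinfun_apply (\<Lambda> j) f) = blinfun_apply f x)"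
      using c(1) by blast
  qed
  then show ?thesis ..
qed

end

section \<open>Finite deficiency excludes flat subspaces\<close>

lemma span_range_initial:
  fixes x :: "nat \<Rightarrow> 'a::real_vector"
  assumes "v \<in> span (range x)"
  obtains N where "v \<in> span (x ` {..<N})"
proof -
  have "\<exists>N. v \<in> span (x ` {..<N})"
    using assms
  proof (induction rule: span_induct_alt)
    case base
    show ?case using span_zero by blast
  next
    case (step c y z)
    then obtain i N where i: "y = x i" and N: "z \<in> span (x ` {..<N})" by blast
    have "z \<in> span (x ` {..<max N (Suc i)})" "y \<in> span (x ` {..<max N (Suc i)})"
      using N span_mono[of "x ` {..<N}" "x ` {..<max N (Suc i)}"] unfolding i
      by (force, intro span_base imageI) auto
    then show ?case by (meson span_add span_scale)
  qed
  then show ?thesis using that by blast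
qed

lemma blinfun_zero_on_span:
  assumes "v \<in> span B" "\<And>b. b \<in> B \<Longrightarrow> blinfun_apply f b = 0"
  shows "blinfun_apply f v = 0"
  using linear_eq_0_on_span[OF bounded_linear.linear[OF blinfun.bounded_linear_right]] assms by blast

lemma blinfun_abs_le: "\<bar>blinfun_apply f x\<bar> \<le> norm f * norm x" for f :: "'a::real_normed_vector \<Rightarrow>\<^sub>L real"
  using norm_blinfun[of f x] by simp

text \<open>
  The functional is the pointwise limit, which exists because bounded real sequences converge along an
  ultrafilter; it inherits linearity and the bound.
\<close>

lemma ultralimit_functional:
  fixes s :: "nat \<Rightarrow> 'a::real_normed_vector"
  assumes s: "\<And>n. norm (s n) \<le> M"
  shows "\<exists>\<Lambda> :: ('a \<Rightarrow>\<^sub>L real) \<Rightarrow>\<^sub>L real.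
    \<forall>f. ((\<lambda>n. blinfun_apply f (s n)) \<longlongrightarrow> blinfun_apply \<Lambda> f) ultra"
proof -
  have bound: "\<bar>blinfun_apply f (s n)\<bar> \<le> norm f * M" for f :: "'a \<Rightarrow>\<^sub>L real" and n
    using blinfun_abs_le[of f "s n"] mult_left_mono[OF s[of n], of "norm f"] by simp
  have "\<exists>l. ((\<lambda>n. blinfun_apply f (s n)) \<longlongrightarrow> l) ultra" for f :: "'a \<Rightarrow>\<^sub>L real"
  proof -
    have "eventually (\<lambda>n. blinfun_apply f (s n) \<in> cball 0 (norm f * M)) ultra"
      using bound by (intro always_eventually) (simp add: dist_norm)
    from ultra_tendsto[OF this bounded_cball] show ?thesis by blast
  qed
  then have "\<forall>f :: 'a \<Rightarrow>\<^sub>L real. \<exists>l. ((\<lambda>n. blinfun_apply f (s n)) \<longlongrightarrow> l) ultra" by blast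
  from choice[OF this] obtain L where
    L: "\<And>f :: 'a \<Rightarrow>\<^sub>L real. ((\<lambda>n. blinfun_apply f (s n)) \<longlongrightarrow> L f) ultra" by blast
  have uniq: "L f = l" if "((\<lambda>n. blinfun_apply f (s n)) \<longlongrightarrow> l) ultra" for f l
    using tendsto_unique[OF ultra(2) L that] .
  have "bounded_linear L"
  proof (rule bounded_linear_intro)
    show "L (f + g) = L f + L g" for f g
      using tendsto_add[OF L[of f] L[of g]] by (intro uniq) (simp add: plus_blinfun.rep_eq)
    show "L (r *\<^sub>R f) = r *\<^sub>R L f" for r f
      using tendsto_mult_left[OF L[of f], of r] by (intro uniq) (simp add: scaleR_blinfun.rep_eq)
    show "norm (L f) \<le> norm f * M" for f
      using tendsto_norm[OF L[of f]] bound[of f]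
      by (intro tendsto_upperbound[OF _ _ ultra(2)]) (auto intro!: always_eventually)
  qed
  then show ?thesis using L by (intro exI[of _ "Blinfun L"]) (simp add: bounded_linear_Blinfun_apply)
qed

text \<open>
  With the constants \<open>(1/2)^k\<close> all partial sums of \<open>flat_sequence\<close> are bounded by \<open>exp 2\<close>. Their \<open>d\<close>
  ultralimits in the bidual have a nontrivial combination that is evaluation at some \<open>s\<close>. The values
  \<open>h k s\<close> are the coefficients of the combination, repeated periodically; but \<open>s\<close> is a limit of vectors
  in the spans of initial segments of \<open>x\<close>, on which \<open>h k\<close> vanishes for large \<open>k\<close>.
\<close>

theorem finite_deficiency_not_flat:
  fixes Y :: "'a::real_normed_vector set"
  assumes fd: "finite_deficiency TYPE('a) d"
    and Y: "subspace Y" "e \<in> Y" "norm e = 1"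
  shows "\<exists>\<epsilon>>0. \<not> flat Y \<epsilon>"
proof (rule ccontr)
  assume "\<not> ?thesis"
  then have fl: "flat Y \<epsilon>" if "\<epsilon> > 0" for \<epsilon> using that by blast
  have "\<exists>c :: nat \<Rightarrow> real. \<exists>j<d. c j \<noteq> 0"
    using fd[unfolded finite_deficiency_def, rule_format, of "\<lambda>_. 0"] by blast
  then have d: "d > 0" by auto
  define eps where "eps k = (1/2 :: real) ^ k" for k :: nat
  have eps: "eps k > 0" "flat Y (eps k)" for k using fl by (auto simp: eps_def)
  have sum_eps: "(\<Sum>i<n. eps i) \<le> 2" for n
    unfolding eps_def by (simp add: sum_gp_strict)
  obtain x :: "nat \<Rightarrow> 'a" and h :: "nat \<Rightarrow> 'a \<Rightarrow>\<^sub>L real" where seq: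
    "\<And>k. x k \<in> Y" "\<And>k. norm (x k) = 1" "\<And>k. norm (h k) \<le> 3" "\<And>k. blinfun_apply (h k) (x k) = 1"
    "\<And>i k. i \<noteq> k \<Longrightarrow> blinfun_apply (h k) (x i) = 0 \<and> blinfun_apply (h k) 0 = 0"
    "\<And>n j. norm (\<Sum>i | i < n \<and> i mod d = j. x i) \<le> exp (\<Sum>i<n. eps i)"
    by (rule flat_sequence[OF Y eps(2) eps(1) d bounded_linear_zero]) (rule that, assumption+)
  note x = seq(3,4,5,6)
  define S where "S n j = (\<Sum>i | i < n \<and> i mod d = j. x i)" for n j
  have S: "norm (S n j) \<le> exp 2" for n j
    using order_trans[OF x(4)[of n j]] sum_eps[of n] by (simp add: S_def)
  have "\<exists>\<Lambda> :: ('a \<Rightarrow>\<^sub>L real) \<Rightarrow>\<^sub>L real.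
      \<forall>f. ((\<lambda>n. blinfun_apply f (S n j)) \<longlongrightarrow> blinfun_apply \<Lambda> f) ultra" for j
    by (rule ultralimit_functional[OF S])
  then have "\<forall>j. \<exists>\<Lambda> :: ('a \<Rightarrow>\<^sub>L real) \<Rightarrow>\<^sub>L real.
      \<forall>f. ((\<lambda>n. blinfun_apply f (S n j)) \<longlongrightarrow> blinfun_apply \<Lambda> f) ultra" by blast
  from choice[OF this] obtain \<Lambda> :: "nat \<Rightarrow> ('a \<Rightarrow>\<^sub>L real) \<Rightarrow>\<^sub>L real" where
    \<Lambda>: "\<And>j f. ((\<lambda>n. blinfun_apply f (S n j)) \<longlongrightarrow> blinfun_apply (\<Lambda> j) f) ultra" by blast
  obtain c s where c: "\<exists>j<d. c j \<noteq> 0"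
    and s: "\<And>f. (\<Sum>j<d. c j * blinfun_apply (\<Lambda> j) f) = blinfun_apply f s"
    using fd[unfolded finite_deficiency_def, rule_format, of \<Lambda>] by blast
  have lim: "((\<lambda>n. \<Sum>j<d. c j * blinfun_apply f (S n j)) \<longlongrightarrow> blinfun_apply f s) ultra" for f
    unfolding s[symmetric] by (intro tendsto_intros \<Lambda>)
  have hs: "blinfun_apply (h k) s = c (k mod d)" for k
  proof -
    have "(\<Sum>j<d. c j * blinfun_apply (h k) (S n j)) = c (k mod d)" if n: "n > k" for n
    proof -
      have hS: "blinfun_apply (h k) (S n j) = (if j = k mod d then 1 else 0)" for j
      proof -
        have "blinfun_apply (h k) (S n j) = (\<Sum>i | i < n \<and> i mod d = j. if i = k then 1 else 0)"
          unfolding S_def blinfun.sum_right using x(3)[of _ k] x(2)[of k] by (intro sum.cong) auto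
        also have "\<dots> = (if j = k mod d then 1 else 0)" using n by (simp add: eq_commute)
        finally show ?thesis .
      qed
      have "(\<Sum>j<d. c j * blinfun_apply (h k) (S n j)) = (\<Sum>j<d. if j = k mod d then c j else 0)"
        by (intro sum.cong) (auto simp: hS)
      also have "\<dots> = c (k mod d)" using d by simp
      finally show ?thesis .
    qed
    then have "eventually (\<lambda>n. (\<Sum>j<d. c j * blinfun_apply (h k) (S n j)) = c (k mod d)) sequentially"
      by (intro eventually_mono[OF eventually_gt_at_top[of k]])
    then have "((\<lambda>n. \<Sum>j<d. c j * blinfun_apply (h k) (S n j)) \<longlongrightarrow> c (k mod d)) sequentially"
      by (rule tendsto_eventually)
    from tendsto_unique[OF ultra(2) lim tendsto_ultra[OF this]] show ?thesis .
  qed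
  \<comment> \<open>A functional that vanishes at all \<open>x i\<close> vanishes at all partial sums, hence at \<open>s\<close>.\<close>
  have approx: "\<exists>v\<in>span (range x). norm (s - v) < \<delta>" if \<delta>: "\<delta> > 0" for \<delta>
  proof (rule ccontr)
    assume "\<not> ?thesis"
    then have "\<delta> \<le> norm (s - v)" if "v \<in> span (range x)" for v using that by force
    from functional_vanishing_on_subspace[OF subspace_span \<delta> this]
    obtain f :: "'a \<Rightarrow>\<^sub>L real" where f: "blinfun_apply f s = 1"
      "\<And>v. v \<in> span (range x) \<Longrightarrow> blinfun_apply f v = 0" by blast
    have "blinfun_apply f (S n j) = 0" for n j
      unfolding S_def by (intro f(2) span_sum span_base) auto
    then have "((\<lambda>n. 0) \<longlongrightarrow> blinfun_apply f s) ultra" using lim[of f] by simp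
    from tendsto_unique[OF ultra(2) this tendsto_const] show False using f(1) by simp
  qed
  obtain j where j: "j < d" "c j \<noteq> 0" using c by blast
  then obtain v where v: "v \<in> span (range x)" "norm (s - v) < \<bar>c j\<bar> / 3"
    using approx[of "\<bar>c j\<bar> / 3"] by auto
  obtain N where N: "v \<in> span (x ` {..<N})" using span_range_initial[OF v(1)] .
  \<comment> \<open>At this index \<open>h k v = 0\<close>, whereas \<open>h k s = c j\<close>.\<close>
  define k where "k = N * d + j"
  have "k \<ge> N" using d by (simp add: k_def trans_le_add1)
  then have "blinfun_apply (h k) v = 0" by (intro blinfun_zero_on_span[OF N]) (auto simp: x(3))
  moreover have "k mod d = j" using j by (simp add: k_def)
  ultimately have "\<bar>c j\<bar> = \<bar>blinfun_apply (h k) (s - v)\<bar>" using hs[of k] by (simp add: blinfun.diff_right)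
  also have "\<dots> \<le> 3 * norm (s - v)"
    using blinfun_abs_le[of "h k" "s - v"] mult_right_mono[OF x(1)[of k], of "norm (s - v)"] by simp
  finally show False using v(2) by simp
qed

section \<open>Common kernels of few functionals\<close>

text \<open>
  A functional that does not vanish on the common kernel of the others adds one vector to \<open>B\<close>.
\<close>

lemma finite_functionals_complement:
  fixes \<Phi> :: "('a::real_normed_vector \<Rightarrow>\<^sub>L real) set"
  assumes "finite \<Phi>"
  shows "\<exists>B. finite B \<and> (\<forall>v. \<exists>w\<in>span B. \<forall>f\<in>\<Phi>. blinfun_apply f (v - w) = 0)"
  using assms
proof (induction \<Phi> rule: finite_induct)
  case empty
  then show ?case using span_zero by blast
next
  case (insert f \<Phi>)
  then obtain B where B: "finite B" "\<And>v. \<exists>w\<in>span B. \<forall>f\<in>\<Phi>. blinfun_apply f (v - w) = 0" by blast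
  show ?case
  proof (cases "\<exists>u. blinfun_apply f u \<noteq> 0 \<and> (\<forall>g\<in>\<Phi>. blinfun_apply g u = 0)")
    case True
    then obtain u where u: "blinfun_apply f u \<noteq> 0" "\<And>g. g \<in> \<Phi> \<Longrightarrow> blinfun_apply g u = 0" by blast
    have "\<exists>w\<in>span (insert u B). \<forall>g\<in>insert f \<Phi>. blinfun_apply g (v - w) = 0" for v
    proof -
      obtain w where w: "w \<in> span B" "\<And>g. g \<in> \<Phi> \<Longrightarrow> blinfun_apply g (v - w) = 0" using B(2) by blast
      let ?t = "blinfun_apply f (v - w) / blinfun_apply f u"
      have "w \<in> span (insert u B)" using w(1) span_mono[OF subset_insertI[of B u]] by blast
      then have "w + ?t *\<^sub>R u \<in> span (insert u B)"
        by (rule span_add) (intro span_scale span_base insertI1)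
      moreover have "blinfun_apply g (v - (w + ?t *\<^sub>R u)) = 0" if "g \<in> insert f \<Phi>" for g
      proof -
        have "blinfun_apply g (v - (w + ?t *\<^sub>R u)) = blinfun_apply g (v - w) - ?t * blinfun_apply g u"
          by (simp add: blinfun.diff_right blinfun.add_right blinfun.scaleR_right)
        then show ?thesis using that u w(2) by auto
      qed
      ultimately show ?thesis by blast
    qed
    then show ?thesis using B(1) by (intro exI[of _ "insert u B"]) auto
  next
    case False
    have "\<exists>w\<in>span B. \<forall>g\<in>insert f \<Phi>. blinfun_apply g (v - w) = 0" for v
    proof -
      obtain w where "w \<in> span B" "\<forall>g\<in>\<Phi>. blinfun_apply g (v - w) = 0" using B(2) by blast
      moreover from this have "blinfun_apply f (v - w) = 0" using False by blast
      ultimately show ?thesis by blast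
    qed
    then show ?thesis using B(1) by blast
  qed
qed

lemma card_of_countable_ordLeq_infinite:
  assumes "infinite T"
  shows "|UNIV :: rat set| \<le>o |T|" "|UNIV :: nat set| \<le>o |T|"
proof -
  show n: "|UNIV :: nat set| \<le>o |T|" using assms infinite_iff_card_of_nat by blast
  have "|UNIV :: rat set| \<le>o |UNIV :: nat set|"
    by (rule card_of_ordLeqI[of to_nat]) auto
  then show "|UNIV :: rat set| \<le>o |T|" using n ordLeq_transitive by blast
qed

lemma card_of_Un_ordLeq:
  "infinite T \<Longrightarrow> |A| \<le>o |T| \<Longrightarrow> |B| \<le>o |T| \<Longrightarrow> |A \<union> B| \<le>o |T|"
  by (rule card_of_Un_ordLeq_infinite_Field[OF _ _ _ card_of_Card_order]) (simp_all add: Field_card_of)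

lemma card_of_Times_ordLeq:
  "infinite T \<Longrightarrow> |A| \<le>o |T| \<Longrightarrow> |B| \<le>o |T| \<Longrightarrow> |A \<times> B| \<le>o |T|"
  by (rule card_of_Times_ordLeq_infinite_Field[OF _ _ _ card_of_Card_order]) (simp_all add: Field_card_of)

text \<open>
  Rational combinations are dense in the span. They are generated in countably many rounds by the map
  \<open>(q, a, b) \<mapsto> q *\<^sub>R a + b\<close>, none of which raises an infinite cardinality.
\<close>

lemma dense_subset_of_span:
  fixes S :: "'a::real_normed_vector set"
  assumes inf: "infinite T" and S: "|S| \<le>o |T|"
  obtains D where "|D| \<le>o |T|" "span S \<subseteq> closure D"
proof -
  define g where "g = (\<lambda>(q, a, b). of_rat q *\<^sub>R a + b :: 'a)"
  define Dn where "Dn n = ((\<lambda>A. g ` (UNIV \<times> A \<times> A)) ^^ n) (insert 0 S)" for n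
  have Dn0: "Dn 0 = insert 0 S" and DnS: "Dn (Suc n) = g ` (UNIV \<times> Dn n \<times> Dn n)" for n
    by (simp_all add: Dn_def)
  have le: "|Dn n| \<le>o |T|" for n
  proof (induction n)
    case 0
    have "|{0 :: 'a}| \<le>o |T|" using inf by (intro card_of_singl_ordLeq) auto
    then show ?case unfolding Dn0 insert_is_Un[of 0 S]
      by (rule card_of_Un_ordLeq[OF inf _ S])
  next
    case (Suc n)
    have "|UNIV \<times> Dn n \<times> Dn n :: (rat \<times> 'a \<times> 'a) set| \<le>o |T|"
      by (intro card_of_Times_ordLeq[OF inf] card_of_countable_ordLeq_infinite(1)[OF inf] Suc)
    then show ?case unfolding DnS by (rule ordLeq_transitive[OF card_of_image])
  qed
  have mono: "Dn n \<subseteq> Dn (Suc n)" for n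
  proof
    fix b assume "b \<in> Dn n"
    then have "g (0, b, b) \<in> Dn (Suc n)" unfolding DnS by blast
    then show "b \<in> Dn (Suc n)" by (simp add: g_def)
  qed
  then have mono': "m \<le> n \<Longrightarrow> Dn m \<subseteq> Dn n" for m n by (rule lift_Suc_mono_le)
  define D where "D = (\<Union>n. Dn n)"
  have "|D| \<le>o |T|"
    unfolding D_def
    by (rule card_of_UNION_ordLeq_infinite[OF inf card_of_countable_ordLeq_infinite(2)[OF inf]]) (use le in blast)
  moreover have "span S \<subseteq> closure D"
  proof (rule span_minimal)
    show "S \<subseteq> closure D" using Dn0 closure_subset[of D] by (force simp: D_def)
    have gD: "r *\<^sub>R a + b \<in> D" if r: "r \<in> \<rat>" and a: "a \<in> D" and b: "b \<in> D" for r a b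
    proof -
      obtain q where q: "r = of_rat q" using r by (auto simp: Rats_def)
      obtain m n where "a \<in> Dn m" "b \<in> Dn n" using a b by (auto simp: D_def)
      then have "a \<in> Dn (max m n)" "b \<in> Dn (max m n)"
        using mono'[of m "max m n"] mono'[of n "max m n"] by auto
      then have "g (q, a, b) \<in> Dn (Suc (max m n))" unfolding DnS by blast
      then show ?thesis unfolding D_def q by (auto simp: g_def)
    qed
    let ?f = "\<lambda>(r :: real, a, b). r *\<^sub>R a + b :: 'a"
    have "?f ` closure (\<rat> \<times> D \<times> D) \<subseteq> closure D"
    proof (rule image_closure_subset)
      show "continuous_on (closure (\<rat> \<times> D \<times> D)) ?f"
        unfolding case_prod_unfold by (intro continuous_intros)
      show "?f ` (\<rat> \<times> D \<times> D) \<subseteq> closure D" using gD closure_subset[of D] by auto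
    qed simp
    then have cl: "r *\<^sub>R a + b \<in> closure D" if "a \<in> closure D" "b \<in> closure D" for r a b
      using that by (force simp: closure_Times Rats_closure_real)
    have "0 \<in> closure D" using Dn0 closure_subset[of D] by (force simp: D_def)
    then show "subspace (closure D)"
      using cl[of _ _ 1] cl[of _ 0] by (intro subspaceI) auto
  qed
  ultimately show ?thesis by (rule that)
qed

text \<open>
  Choose for each functional in \<open>D\<close> a point of the unit ball where it attains at least half its norm. A
  functional that vanishes at all these points is 0, so their span is dense.
\<close>

lemma dense_functionals_bound_density:
  fixes D :: "('a::real_normed_vector \<Rightarrow>\<^sub>L real) set"
  assumes inf: "infinite T" and D: "|D| \<le>o |T|" "closure D = UNIV"
  shows "dens (UNIV :: 'a set) \<le>o |T|"
proof -
  have "\<exists>x. norm x \<le> 1 \<and> norm g \<le> 2 * blinfun_apply g x" for g :: "'a \<Rightarrow>\<^sub>L real"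
  proof (rule ccontr)
    assume *: "\<not> ?thesis"
    have "\<not> (norm (0 :: 'a) \<le> 1 \<and> norm g \<le> 2 * blinfun_apply g 0)" using * by blast
    then have g0: "g \<noteq> 0" by auto
    have "norm (blinfun_apply g y) \<le> (norm g / 2) * norm y" for y
    proof (cases "y = 0")
      case False
      let ?u = "inverse (norm y) *\<^sub>R y"
      have "norm ?u \<le> 1" "norm (- ?u) \<le> 1" using False by auto
      then have "2 * blinfun_apply g ?u < norm g" "2 * blinfun_apply g (- ?u) < norm g"
        using * by (meson not_le)+
      then have "2 * \<bar>blinfun_apply g ?u\<bar> < norm g" by (simp add: blinfun.minus_right)
      then show ?thesis using False by (simp add: blinfun.scaleR_right abs_mult field_simps)
    qed simp
    then have "norm g \<le> norm g / 2" by (intro norm_blinfun_bound) auto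
    then show False using g0 by simp
  qed
  then have "\<forall>g :: 'a \<Rightarrow>\<^sub>L real. \<exists>x. norm x \<le> 1 \<and> norm g \<le> 2 * blinfun_apply g x" by blast
  from choice[OF this] obtain x where
    x: "\<And>g :: 'a \<Rightarrow>\<^sub>L real. norm (x g) \<le> 1" "\<And>g. norm g \<le> 2 * blinfun_apply g (x g)" by blast
  have "|x ` D| \<le>o |T|" using card_of_image D(1) ordLeq_transitive by blast
  then obtain D' where D': "|D'| \<le>o |T|" "span (x ` D) \<subseteq> closure D'"
    using dense_subset_of_span[OF inf] by blast
  have "y \<in> closure D'" for y
  proof (rule ccontr)
    assume y: "y \<notin> closure D'"
    then have "y \<notin> closure (closure D')" by simp
    then obtain e where e: "e > 0" "\<And>v. v \<in> closure D' \<Longrightarrow> e \<le> dist v y"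
      unfolding closure_approachable[of y "closure D'"] by (meson not_le)
    have "e \<le> norm (y - v)" if "v \<in> span (x ` D)" for v
      using e(2)[OF subsetD[OF D'(2) that]] unfolding dist_norm norm_minus_commute[of v y] .
    from functional_vanishing_on_subspace[OF subspace_span e(1) this]
    obtain h :: "'a \<Rightarrow>\<^sub>L real" where h: "blinfun_apply h y = 1"
      "\<And>v. v \<in> span (x ` D) \<Longrightarrow> blinfun_apply h v = 0" by blast
    have h0: "norm h > 0" using h(1) by (auto simp: zero_less_norm_iff)
    have "h \<in> closure D" using D(2) by simp
    moreover have "norm h / 4 > 0" using h0 by simp
    ultimately obtain g where g: "g \<in> D" "dist g h < norm h / 4"
      unfolding closure_approachable by blast
    have "blinfun_apply g (x g) = blinfun_apply (g - h) (x g)"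
      using h(2)[of "x g"] g(1) by (simp add: blinfun.diff_left span_base)
    also have "\<dots> \<le> norm (g - h) * 1"
      using blinfun_abs_le[of "g - h" "x g"] mult_left_mono[OF x(1)[of g], of "norm (g - h)"] by simp
    finally have "norm g \<le> 2 * norm (g - h)" using x(2)[of g] by simp
    moreover have "norm h \<le> norm g + norm (g - h)"
      using norm_triangle_ineq4[of g "g - h"] by simp
    ultimately show False using g(2) norm_ge_zero[of "g - h"] unfolding dist_norm by linarith
  qed
  then have "dens (UNIV :: 'a set) \<le>o |D'|"
    unfolding dens_def by (intro least_card(2)) auto
  then show ?thesis using D'(1) ordLeq_transitive by blast
qed

text \<open>
  For finite \<open>\<Phi>\<close> this is a matter of dimension. Let \<open>\<Phi>\<close> be infinite with trivial common kernel. If no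
  finite \<open>G\<close> made the span of \<open>\<Phi> \<union> G\<close> dense in the dual, there would be functionals \<open>g\<^sub>k\<close> and elements
  \<open>\<Lambda>\<^sub>k\<close> of the bidual with \<open>\<Lambda>\<^sub>k g\<^sub>k = 1\<close>, while \<open>\<Lambda>\<^sub>k\<close> vanishes on \<open>\<Phi>\<close> and on the \<open>g\<^sub>i\<close> with \<open>i < k\<close>. A
  combination of the \<open>\<Lambda>\<^sub>k\<close> that is evaluation at a point is evaluation at 0, as the point is a common
  zero of \<open>\<Phi>\<close>, and the triangular shape then forces its coefficients to vanish. So a suitable \<open>G\<close>
  exists, and the dual and the space have density at most the cardinality of \<open>\<Phi>\<close>.
\<close>

theorem common_kernel_nontrivial:
  fixes \<Phi> :: "('a::real_normed_vector \<Rightarrow>\<^sub>L real) set"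
  assumes fd: "finite_deficiency TYPE('a) d"
    and infdim: "\<And>B :: 'a set. finite B \<Longrightarrow> span B \<noteq> UNIV"
    and \<Phi>: "|\<Phi>| <o dens (UNIV :: 'a set)"
  obtains v where "norm v = 1" "\<And>f. f \<in> \<Phi> \<Longrightarrow> blinfun_apply f v = 0"
proof -
  have "\<exists>v. v \<noteq> 0 \<and> (\<forall>f\<in>\<Phi>. blinfun_apply f v = 0)"
  proof (rule ccontr)
    assume "\<not> ?thesis"
    then have triv: "v = 0" if "\<And>f. f \<in> \<Phi> \<Longrightarrow> blinfun_apply f v = 0" for v using that by blast
    show False
    proof (cases "finite \<Phi>")
      case True
      obtain B where B: "finite B" "\<And>v. \<exists>w\<in>span B. \<forall>f\<in>\<Phi>. blinfun_apply f (v - w) = 0"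
        using finite_functionals_complement[OF True] by blast
      have "v \<in> span B" for v
      proof -
        obtain w where w: "w \<in> span B" "\<forall>f\<in>\<Phi>. blinfun_apply f (v - w) = 0" using B(2) by blast
        then have "v - w = 0" by (intro triv) blast
        then show ?thesis using w(1) by simp
      qed
      then show False using infdim[OF B(1)] by blast
    next
      case inf: False
      have "\<exists>G. finite G \<and> closure (span (\<Phi> \<union> G)) = UNIV"
      proof (rule ccontr)
        assume no: "\<not> ?thesis"
        define P where "P f k r \<longleftrightarrow> blinfun_apply (snd r) (fst r) = 1 \<and> (\<forall>\<phi>\<in>\<Phi>. blinfun_apply (snd r) \<phi> = 0) \<and>
          (\<forall>i<k. blinfun_apply (snd r) (fst (f i)) = 0)"
          for f :: "nat \<Rightarrow> ('a \<Rightarrow>\<^sub>L real) \<times> (('a \<Rightarrow>\<^sub>L real) \<Rightarrow>\<^sub>L real)" and k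
            and r :: "('a \<Rightarrow>\<^sub>L real) \<times> (('a \<Rightarrow>\<^sub>L real) \<Rightarrow>\<^sub>L real)"
        have "\<exists>f. \<forall>k. P f k (f k)"
        proof (rule dependent_wellorder_choice)
          fix f g :: "nat \<Rightarrow> ('a \<Rightarrow>\<^sub>L real) \<times> (('a \<Rightarrow>\<^sub>L real) \<Rightarrow>\<^sub>L real)" and r and k :: nat
          assume "\<And>y. y < k \<Longrightarrow> f y = g y"
          then show "P f k r = P g k r" by (simp add: P_def)
        next
          fix k and f :: "nat \<Rightarrow> ('a \<Rightarrow>\<^sub>L real) \<times> (('a \<Rightarrow>\<^sub>L real) \<Rightarrow>\<^sub>L real)"
          let ?E = "span (\<Phi> \<union> (\<lambda>i. fst (f i)) ` {..<k})"
          have "finite ((\<lambda>i. fst (f i)) ` {..<k})" by simp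
          then have "closure ?E \<noteq> UNIV" using no by blast
          then obtain g where "g \<notin> closure ?E" by blast
          then obtain e where e: "e > 0" "\<And>v. v \<in> ?E \<Longrightarrow> e \<le> dist v g"
            unfolding closure_approachable by (meson not_le)
          have "e \<le> norm (g - v)" if "v \<in> ?E" for v
            using e(2)[OF that] unfolding dist_norm norm_minus_commute[of v g] .
          from functional_vanishing_on_subspace[OF subspace_span e(1) this]
          obtain \<Lambda> :: "('a \<Rightarrow>\<^sub>L real) \<Rightarrow>\<^sub>L real" where "blinfun_apply \<Lambda> g = 1"
            "\<And>v. v \<in> ?E \<Longrightarrow> blinfun_apply \<Lambda> v = 0" by blast
          then have "P f k (g, \<Lambda>)" by (auto simp: P_def span_base)
          then show "\<exists>r. P f k r" by blast
        qed
        then obtain f where f: "\<And>k. P f k (f k)" by blast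
        obtain c x where c: "\<exists>j<d. c j \<noteq> 0"
          and x: "\<And>\<phi>. (\<Sum>j<d. c j * blinfun_apply (snd (f j)) \<phi>) = blinfun_apply \<phi> x"
          using fd[unfolded finite_deficiency_def, rule_format, of "\<lambda>j. snd (f j)"] by blast
        have "blinfun_apply \<phi> x = 0" if "\<phi> \<in> \<Phi>" for \<phi>
          using f that unfolding x[symmetric] by (intro sum.neutral) (auto simp: P_def)
        then have x0: "x = 0" by (rule triv)
        define j0 where "j0 = (LEAST j. c j \<noteq> 0)"
        obtain j where j: "j < d" "c j \<noteq> 0" using c by blast
        have j0: "c j0 \<noteq> 0" unfolding j0_def by (rule LeastI[of _ j]) (rule j(2))
        have "j0 < d" using j Least_le[of "\<lambda>j. c j \<noteq> 0" j] by (simp add: j0_def)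
        have "c i * blinfun_apply (snd (f i)) (fst (f j0)) = (if i = j0 then c j0 else 0)" for i
        proof (cases i j0 rule: linorder_cases)
          case less
          then have "c i = 0" using not_less_Least[of i "\<lambda>j. c j \<noteq> 0"] by (auto simp: j0_def)
          then show ?thesis using less by simp
        qed (use f[of i] in \<open>auto simp: P_def\<close>)
        then have "(\<Sum>i<d. c i * blinfun_apply (snd (f i)) (fst (f j0))) = c j0"
          using \<open>j0 < d\<close> by simp
        then show False using x[of "fst (f j0)"] x0 j0 by simp
      qed
      then obtain G where G: "finite G" "closure (span (\<Phi> \<union> G)) = UNIV" by blast
      have "|G| \<le>o |\<Phi>|"
        using G(1) inf ordLeq_total[OF card_of_Well_order card_of_Well_order] card_of_ordLeq_infinite by blast
      then have "|\<Phi> \<union> G| \<le>o |\<Phi>|"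
        by (rule card_of_Un_ordLeq[OF inf ordIso_imp_ordLeq[OF card_of_refl]])
      then obtain D where D: "|D| \<le>o |\<Phi>|" "span (\<Phi> \<union> G) \<subseteq> closure D"
        using dense_subset_of_span[OF inf] by blast
      have "closure D = UNIV" using closure_mono[OF D(2)] G(2) by auto
      then have "dens (UNIV :: 'a set) \<le>o |\<Phi>|" by (rule dense_functionals_bound_density[OF inf D(1)])
      then show False using \<Phi> not_ordLess_ordLeq by blast
    qed
  qed
  then obtain v where v: "v \<noteq> 0" "\<And>f. f \<in> \<Phi> \<Longrightarrow> blinfun_apply f v = 0" by blast
  show ?thesis
    by (rule that[of "inverse (norm v) *\<^sub>R v"]) (use v in \<open>auto simp: blinfun.scaleR_right\<close>)
qed

section \<open>Transfinite construction of separated sets\<close>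

lemma Card_orderD:
  assumes "Card_order r"
  shows "wf (r - Id)" "trans r" "\<And>a b. a \<in> Field r \<Longrightarrow> b \<in> Field r \<Longrightarrow> a \<noteq> b \<Longrightarrow> (a, b) \<in> r \<or> (b, a) \<in> r"
    "\<And>a. a \<in> Field r \<Longrightarrow> (a, a) \<in> r" "antisym r"
  using assms
  by (auto simp: card_order_on_def well_order_on_def linear_order_on_def partial_order_on_def
      preorder_on_def total_on_def refl_on_def)

lemma underS_mono:
  assumes "Card_order r" "a \<in> underS r b"
  shows "underS r a \<subseteq> underS r b"
  using assms Card_orderD(2,5)[OF assms(1)] by (auto simp: underS_def dest: transD antisymD)

lemma card_of_finite_ordLess_infinite: "finite A \<Longrightarrow> infinite B \<Longrightarrow> |A| <o |B|"
  by (rule finite_ordLess_infinite[OF card_of_Well_order card_of_Well_order]) (simp_all add: Field_card_of)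

lemma finite_ordLess_Card_order:
  assumes "Card_order r" "infinite (Field r)" "finite A"
  shows "|A| <o r"
proof -
  have "|A| <o |Field r|" by (rule card_of_finite_ordLess_infinite[OF assms(3,2)])
  then show ?thesis using card_of_Field_ordIso[OF assms(1)] ordLess_ordIso_trans by blast
qed

text \<open>
  The recursion runs along the well-order \<open>r\<close>. Before stage \<open>i\<close> only \<open>underS r i\<close> many finite sets of
  functionals have been chosen, which is fewer than \<open>r\<close> many functionals. The function \<open>e\<close> attaches to
  each vector its own constant; a pair is separated by the constant of the vector that was chosen first.
\<close>

theorem transfinite_separated_set:
  fixes r :: "'i rel" and Eps :: "real set"
  assumes r: "Card_order r" "infinite (Field r)" and Eps: "Eps \<subseteq> {0<..}"
    and step: "\<And>\<Phi> :: ('a::real_normed_vector \<Rightarrow>\<^sub>L real) set. |\<Phi>| <o r \<Longrightarrow>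
      \<exists>x F \<epsilon>. norm x = 1 \<and> (\<forall>f\<in>\<Phi>. blinfun_apply f x = 0) \<and> finite F \<and> \<epsilon> \<in> Eps \<and>
        (\<forall>z. norm z = 1 \<longrightarrow> (\<forall>f\<in>\<Phi> \<union> F. blinfun_apply f z = 0) \<longrightarrow> 1 + \<epsilon> \<le> norm (x + z))"
  obtains A :: "'a::real_normed_vector set" and e where "A \<subseteq> sphere 0 1" "|A| =o r" "\<And>a. a \<in> A \<Longrightarrow> e a \<in> Eps"
    "\<And>a b. a \<in> A \<Longrightarrow> b \<in> A \<Longrightarrow> a \<noteq> b \<Longrightarrow> \<exists>k\<in>{a, b}. 1 + e k \<le> norm (a + b) \<and> 1 + e k \<le> norm (a - b)"
proof -
  define Phi where "Phi f i = (\<Union>j\<in>underS r i. fst (snd (f j)))"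
    for f :: "'i \<Rightarrow> 'a \<times> ('a \<Rightarrow>\<^sub>L real) set \<times> real" and i
  define P where "P f i p \<longleftrightarrow> norm (fst p) = 1 \<and> (\<forall>g\<in>Phi f i. blinfun_apply g (fst p) = 0) \<and>
      finite (fst (snd p)) \<and> snd (snd p) \<in> Eps \<and>
      (\<forall>z. norm z = 1 \<longrightarrow> (\<forall>g\<in>Phi f i \<union> fst (snd p). blinfun_apply g z = 0) \<longrightarrow>
        1 + snd (snd p) \<le> norm (fst p + z))"
    for f and i and p :: "'a \<times> ('a \<Rightarrow>\<^sub>L real) set \<times> real"
  have "\<exists>f. \<forall>i. P f i (f i)"
  proof (rule dependent_wf_choice)
    show "wf (r - Id)" by (rule Card_orderD(1)[OF r(1)])
  next
    fix f g :: "'i \<Rightarrow> 'a \<times> ('a \<Rightarrow>\<^sub>L real) set \<times> real" and i p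
    assume "\<And>j. (j, i) \<in> r - Id \<Longrightarrow> f j = g j"
    then have "Phi f i = Phi g i" by (auto simp: Phi_def underS_def)
    then show "P f i p = P g i p" by (simp add: P_def)
  next
    fix i and f :: "'i \<Rightarrow> 'a \<times> ('a \<Rightarrow>\<^sub>L real) set \<times> real"
    assume IH: "\<And>j. (j, i) \<in> r - Id \<Longrightarrow> P f j (f j)"
    then have fin: "finite (fst (snd (f j)))" if "j \<in> underS r i" for j
      using that by (auto simp: underS_def P_def)
    have "|Phi f i| <o r"
    proof (cases "finite (underS r i)")
      case True
      then have "finite (Phi f i)" using fin by (simp add: Phi_def)
      then show ?thesis by (rule finite_ordLess_Card_order[OF r])
    next
      case False
      then have "i \<in> Field r" by (auto simp: underS_def Field_def dest!: infinite_imp_nonempty)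
      then have "|underS r i| <o r" by (rule card_of_underS[OF r(1)])
      moreover have "|Phi f i| \<le>o |underS r i|"
        unfolding Phi_def
      proof (rule card_of_UNION_ordLeq_infinite[OF False ordIso_imp_ordLeq[OF card_of_refl]], rule ballI)
        fix j assume "j \<in> underS r i"
        then show "|fst (snd (f j))| \<le>o |underS r i|"
          using fin False by (intro ordLess_imp_ordLeq card_of_finite_ordLess_infinite)
      qed
      ultimately show ?thesis using ordLeq_ordLess_trans by blast
    qed
    from step[OF this] obtain x F \<epsilon> where "norm x = 1" "\<forall>g\<in>Phi f i. blinfun_apply g x = 0" "finite F"
      "\<epsilon> \<in> Eps" "\<forall>z. norm z = 1 \<longrightarrow> (\<forall>g\<in>Phi f i \<union> F. blinfun_apply g z = 0) \<longrightarrow> 1 + \<epsilon> \<le> norm (x + z)"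
      by blast
    then have "P f i (x, F, \<epsilon>)" by (simp add: P_def)
    then show "\<exists>p. P f i p" by blast
  qed
  then obtain f where f: "\<And>i. P f i (f i)" by blast
  define x where "x i = fst (f i)" for i
  define \<epsilon> where "\<epsilon> i = snd (snd (f i))" for i
  have unit: "norm (x i) = 1" and \<epsilon>: "\<epsilon> i \<in> Eps" for i using f[of i] by (auto simp: P_def x_def \<epsilon>_def)
  have less: "1 + \<epsilon> j \<le> norm (x j + x i) \<and> 1 + \<epsilon> j \<le> norm (x j - x i)" if j: "j \<in> underS r i" for i j
  proof -
    have "Phi f j \<union> fst (snd (f j)) \<subseteq> Phi f i" using j underS_mono[OF r(1) j] unfolding Phi_def by blast
    then have zero: "\<forall>g\<in>Phi f j \<union> fst (snd (f j)). blinfun_apply g (x i) = 0"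
      using f[of i] unfolding P_def x_def by blast
    have sep: "1 + \<epsilon> j \<le> norm (x j + z)" if "norm z = 1" "\<forall>g\<in>Phi f j \<union> fst (snd (f j)). blinfun_apply g z = 0" for z
      using f[of j] that unfolding P_def x_def \<epsilon>_def by blast
    show ?thesis
      using sep[of "x i"] sep[of "- x i"] zero unit[of i] by (simp add: blinfun.minus_right)
  qed
  have sep: "\<exists>k\<in>{i, j}. 1 + \<epsilon> k \<le> norm (x i + x j) \<and> 1 + \<epsilon> k \<le> norm (x i - x j)"
    if "i \<in> Field r" "j \<in> Field r" "i \<noteq> j" for i j
  proof -
    have "j \<in> underS r i \<or> i \<in> underS r j"
      using Card_orderD(3)[OF r(1) that] that(3) by (auto simp: underS_def)
    then show ?thesis
      using less[of j i] less[of i j] by (auto simp: add.commute norm_minus_commute)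
  qed
  have inj: "inj_on x (Field r)"
  proof (rule inj_onI, rule ccontr)
    fix i j assume ij: "i \<in> Field r" "j \<in> Field r" "x i = x j" "i \<noteq> j"
    then obtain k where "1 + \<epsilon> k \<le> norm (x i - x j)" using sep by blast
    moreover have "\<epsilon> k > 0" using \<epsilon>[of k] Eps by auto
    ultimately show False using ij(3) by simp
  qed
  let ?A = "x ` Field r" and ?e = "\<lambda>a. \<epsilon> (inv_into (Field r) x a)"
  show ?thesis
  proof
    show "?A \<subseteq> sphere 0 1" using unit by auto
    have "|Field r| =o |?A|" using inj by (intro card_of_ordIsoI[of x]) (simp add: bij_betw_def)
    then show "|?A| =o r"
      using card_of_Field_ordIso[OF r(1)] ordIso_symmetric ordIso_transitive by blast
    show "?e a \<in> Eps" for a by (rule \<epsilon>)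
    show "\<exists>k\<in>{a, b}. 1 + ?e k \<le> norm (a + b) \<and> 1 + ?e k \<le> norm (a - b)"
      if ab: "a \<in> ?A" "b \<in> ?A" "a \<noteq> b" for a b
    proof -
      obtain i j where ij: "i \<in> Field r" "j \<in> Field r" "a = x i" "b = x j" using ab by blast
      then have "i \<noteq> j" using ab(3) by blast
      then show ?thesis using sep[OF ij(1,2)] ij by (auto simp: inv_into_f_f[OF inj])
    qed
  qed
qed

section \<open>Cardinals of uncountable cofinality\<close>

lemma countable_union_ordLess:
  fixes B :: "nat \<Rightarrow> 'b set" and T :: "'t set"
  assumes "infinite T" "\<And>n. |B n| \<le>o |T|"
  shows "|\<Union>n. B n| \<le>o |T|"
  using assms card_of_countable_ordLeq_infinite(2)[OF assms(1)]
  by (intro card_of_UNION_ordLeq_infinite) auto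

text \<open>
  If each \<open>B n\<close> is smaller than \<open>\<kappa>\<close>, it has at most the size of a proper initial segment, below \<open>a n\<close>
  say. The points \<open>a n\<close> do not form a cofinal set, so there is a \<open>b\<close> above all of them, and the initial
  segment of \<open>b\<close> bounds the size of all \<open>B n\<close>. So the union of the \<open>B n\<close> is countable or no larger than
  this segment, and in both cases smaller than \<open>\<kappa>\<close>, which is uncountable.
\<close>

lemma uncountable_cofinality_pigeonhole:
  fixes \<kappa> :: "'c rel" and B :: "nat \<Rightarrow> 'b set"
  assumes \<kappa>: "Card_order \<kappa>" and cof: "natLeq <o cofinality \<kappa>" and un: "|\<Union>n. B n| =o \<kappa>"
  obtains n where "|B n| =o \<kappa>"
proof -
  have cof_le: "cofinality \<kappa> \<le>o |C|" if "C \<subseteq> Field \<kappa>" "\<forall>a\<in>Field \<kappa>. \<exists>b\<in>C. (a, b) \<in> \<kappa>" for C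
    unfolding cofinality_def by (rule least_card(2)) (use that in blast)
  have "\<exists>n. |B n| =o \<kappa>"
  proof (rule ccontr)
    assume no: "\<not> ?thesis"
    have ls: "|B n| <o \<kappa>" for n
    proof -
      have "|B n| \<le>o \<kappa>"
        using card_of_mono1[of "B n" "\<Union>n. B n"] un ordLeq_ordIso_trans by blast
      then show ?thesis using no by (simp add: ordLeq_iff_ordLess_or_ordIso)
    qed
    have "\<exists>a\<in>Field \<kappa>. |B n| \<le>o |underS \<kappa> a|" for n
    proof -
      have "Well_order \<kappa>" using \<kappa> by (simp add: card_order_on_def)
      then obtain a where a: "a \<in> Field \<kappa>" "|B n| =o Restr \<kappa> (underS \<kappa> a)"
        using ls[of n] ordLess_iff_ordIso_Restr[OF _ card_of_Well_order] by blast
      have "|Field |B n| | \<le>o |Field (Restr \<kappa> (underS \<kappa> a))|"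
        by (rule card_of_mono2[OF ordIso_imp_ordLeq[OF a(2)]])
      also have "|Field (Restr \<kappa> (underS \<kappa> a))| \<le>o |underS \<kappa> a|"
        by (rule card_of_mono1) (auto simp: Field_def)
      finally show ?thesis using a(1) by (auto simp: Field_card_of)
    qed
    then have "\<forall>n. \<exists>a. a \<in> Field \<kappa> \<and> |B n| \<le>o |underS \<kappa> a|" by blast
    from choice[OF this] obtain a where a: "\<And>n. a n \<in> Field \<kappa>" "\<And>n. |B n| \<le>o |underS \<kappa> (a n)|" by blast
    have "|range a| \<le>o natLeq"
      using card_of_image[of a UNIV] card_of_nat ordLeq_ordIso_trans by blast
    then have "\<not> cofinality \<kappa> \<le>o |range a|"
      using cof ordLeq_transitive not_ordLess_ordLeq by blast
    then obtain b where b: "b \<in> Field \<kappa>" "\<And>n. (b, a n) \<notin> \<kappa>"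
      using cof_le[of "range a"] a(1) by blast
    have "a n \<in> underS \<kappa> b" for n
    proof -
      have "a n \<noteq> b" using b Card_orderD(4)[OF \<kappa>] by auto
      then show ?thesis using Card_orderD(3)[OF \<kappa> a(1)[of n] b(1)] b(2)[of n] by (auto simp: underS_def)
    qed
    then have Bb: "|B n| \<le>o |underS \<kappa> b|" for n
      using a(2)[of n] card_of_mono1[OF underS_mono[OF \<kappa>]] ordLeq_transitive by blast
    have "cofinality \<kappa> \<le>o |Field \<kappa>|" using Card_orderD(4)[OF \<kappa>] by (intro cof_le) auto
    then have "cofinality \<kappa> \<le>o \<kappa>" using card_of_Field_ordIso[OF \<kappa>] ordLeq_ordIso_trans by blast
    then have nat: "natLeq <o \<kappa>" using cof ordLess_ordLeq_trans by blast
    show False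
    proof (cases "finite (underS \<kappa> b)")
      case True
      have "|B n| \<le>o |UNIV :: nat set|" for n
      proof -
        have "finite (B n)" using Bb[of n] True by (rule card_of_ordLeq_finite)
        then show ?thesis by (intro ordLess_imp_ordLeq card_of_finite_ordLess_infinite) auto
      qed
      then have "|\<Union>n. B n| \<le>o |UNIV :: nat set|" by (intro countable_union_ordLess) auto
      then have "\<kappa> \<le>o natLeq"
        using un card_of_nat ordIso_symmetric ordIso_ordLeq_trans ordLeq_ordIso_trans by blast
      then show False using nat not_ordLess_ordLeq by blast
    next
      case False
      then have "|\<Union>n. B n| \<le>o |underS \<kappa> b|" using Bb by (rule countable_union_ordLess)
      moreover have "|underS \<kappa> b| <o \<kappa>" by (rule card_of_underS[OF \<kappa> b(1)])
      ultimately have "|\<Union>n. B n| <o \<kappa>" using ordLeq_ordLess_trans by blast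
      then show False using un not_ordLess_ordIso by blast
    qed
  qed
  then show ?thesis using that by blast
qed

theorem separated_set_of_uniform_size:
  fixes A :: "'a::real_normed_vector set" and e :: "'a \<Rightarrow> real" and \<kappa> :: "'c rel"
  assumes A: "A \<subseteq> sphere 0 1" and e: "\<And>a. a \<in> A \<Longrightarrow> e a > 0"
    and sep: "\<And>a b. a \<in> A \<Longrightarrow> b \<in> A \<Longrightarrow> a \<noteq> b \<Longrightarrow> \<exists>k\<in>{a, b}. 1 + e k \<le> norm (a + b) \<and> 1 + e k \<le> norm (a - b)"
    and \<kappa>: "Card_order \<kappa>" "\<kappa> \<le>o |A|" "natLeq <o cofinality \<kappa>"
  shows "\<exists>\<epsilon>>0. \<exists>A' \<subseteq> sphere 0 1. symmetrically_separated (1 + \<epsilon>) (A' :: 'a set) \<and> |A'| =o \<kappa>"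
proof -
  have "|Field \<kappa>| \<le>o |A|"
    using card_of_Field_ordIso[OF \<kappa>(1)] \<kappa>(2) ordIso_ordLeq_trans by blast
  then obtain g where g: "inj_on g (Field \<kappa>)" "g ` Field \<kappa> \<subseteq> A"
    using card_of_ordLeq[of "Field \<kappa>" A] by blast
  define B where "B n = {a \<in> g ` Field \<kappa>. 1 / real (Suc n) \<le> e a}" for n
  have "(\<Union>n. B n) = g ` Field \<kappa>"
  proof -
    have "\<exists>n. 1 / real (Suc n) \<le> e a" if "a \<in> g ` Field \<kappa>" for a
    proof -
      have "e a > 0" using that g(2) by (intro e) auto
      from reals_Archimedean[OF this] obtain n where "inverse (real (Suc n)) < e a" by blast
      then show ?thesis by (intro exI[of _ n]) (simp add: inverse_eq_divide)
    qed
    then show ?thesis by (auto simp: B_def)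
  qed
  moreover have "|Field \<kappa>| =o |g ` Field \<kappa>|"
    using g(1) by (intro card_of_ordIsoI[of g]) (simp add: bij_betw_def)
  ultimately have "|\<Union>n. B n| =o |Field \<kappa>|"
    using ordIso_symmetric by simp
  then have "|\<Union>n. B n| =o \<kappa>"
    by (rule ordIso_transitive[OF _ card_of_Field_ordIso[OF \<kappa>(1)]])
  then obtain n where n: "|B n| =o \<kappa>"
    using uncountable_cofinality_pigeonhole[OF \<kappa>(1,3)] by blast
  have "symmetrically_separated (1 + 1 / real (Suc n)) (B n)"
    unfolding symmetrically_separated_def
  proof (intro ballI impI)
    fix a b assume ab: "a \<in> B n" "b \<in> B n" "a \<noteq> b"
    then have "a \<in> A" "b \<in> A" using g(2) by (auto simp: B_def)
    from sep[OF this ab(3)] obtain k where k: "k \<in> {a, b}" "1 + e k \<le> norm (a + b)" "1 + e k \<le> norm (a - b)"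
      by blast
    have "1 / real (Suc n) \<le> e k" using k(1) ab by (auto simp: B_def)
    then show "1 + 1 / real (Suc n) \<le> norm (a - b) \<and> 1 + 1 / real (Suc n) \<le> norm (a + b)"
      using k(2,3) by linarith
  qed
  moreover have "B n \<subseteq> sphere 0 1" using A g(2) by (auto simp: B_def)
  moreover have "1 / real (Suc n) > 0" by simp
  ultimately show ?thesis using n by blast
qed

section \<open>A Banach space inside an ultrapower\<close>

context scalar_banach
begin

lemma ultra_tendsto_scalar:
  fixes f :: "nat \<Rightarrow> 'k"
  assumes "eventually (\<lambda>n. norm (f n) \<le> M) ultra"
  shows "\<exists>l. (f \<longlongrightarrow> l) ultra"
proof -
  have conv: "\<exists>l. ((\<lambda>n. re (g n)) \<longlongrightarrow> l) ultra" if "eventually (\<lambda>n. norm (g n) \<le> K) ultra" for g K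
  proof -
    have "eventually (\<lambda>n. re (g n) \<in> cball 0 (onorm re * K)) ultra"
      using that
    proof eventually_elim
      case (elim n)
      have "norm (re (g n)) \<le> onorm re * norm (g n)" by (rule onorm[OF bl_re])
      also have "\<dots> \<le> onorm re * K" using elim onorm_pos_le[OF bl_re] by (rule mult_left_mono)
      finally show ?case by (simp add: dist_norm)
    qed
    from ultra_tendsto[OF this bounded_cball] show ?thesis by blast
  qed
  obtain a where a: "((\<lambda>n. re (f n)) \<longlongrightarrow> a) ultra" using conv[OF assms] by blast
  have "eventually (\<lambda>n. norm (ii * f n) \<le> norm ii * M) ultra"
    using assms by eventually_elim (simp add: norm_mult mult_left_mono)
  then obtain b where b: "((\<lambda>n. re (ii * f n)) \<longlongrightarrow> b) ultra"
    using conv[of "\<lambda>n. ii * f n"] by blast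
  have "((\<lambda>n. of_real (re (f n)) - ii * of_real (re (ii * f n))) \<longlongrightarrow> of_real a - ii * of_real b) ultra"
    by (intro tendsto_intros a b)
  then show ?thesis unfolding scalar_expand[symmetric] by blast
qed

end

text \<open>
  Given are bounded sequences \<open>s 0, s 1, \<dots>\<close> in \<open>X\<close>. Each represents an element of the ultrapower of \<open>X\<close>,
  and \<open>Y\<close> will be the closed span of these elements. Working in this span instead of the whole
  ultrapower has the effect that the point representing a weak-star limit of the \<open>s m\<close> is
  automatically a norm limit of linear combinations of them.
\<close>

locale ultra_span = scalar_banach sc ii re
  for sc :: "'k::real_or_complex \<Rightarrow> 'a::banach \<Rightarrow> 'a" and ii :: 'k and re :: "'k \<Rightarrow> real" +
  fixes s :: "nat \<Rightarrow> nat \<Rightarrow> 'a" and M :: real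
  assumes s_bound: "norm (s m n) \<le> M"
begin

definition lincomb :: "nat \<Rightarrow> (nat \<Rightarrow> 'k) \<Rightarrow> nat \<Rightarrow> 'a" where
  "lincomb N a n = (\<Sum>m<N. sc (a m) (s m n))"

text \<open>
  The sequences that represent elements of the closed span.
\<close>

definition W :: "(nat \<Rightarrow> 'a) set" where
  "W = {w. \<forall>\<epsilon>>0. \<exists>N a. eventually (\<lambda>n. norm (w n - lincomb N a n) < \<epsilon>) ultra}"

lemma WD:
  assumes "w \<in> W" "\<epsilon> > 0"
  obtains N a where "eventually (\<lambda>n. norm (w n - lincomb N a n) < \<epsilon>) ultra"
  using assms unfolding W_def by blast

lemma lincomb_extend: "N \<le> N' \<Longrightarrow> lincomb N a n = lincomb N' (\<lambda>m. if m < N then a m else 0) n"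
  unfolding lincomb_def by (rule sum.mono_neutral_cong_left) (auto simp: sc_zero)

lemma W_add:
  assumes w: "w \<in> W" and v: "v \<in> W"
  shows "(\<lambda>n. w n + v n) \<in> W"
  unfolding W_def
proof (clarify)
  fix \<epsilon> :: real assume "\<epsilon> > 0"
  then have e2: "\<epsilon> / 2 > 0" by simp
  obtain N a where a: "eventually (\<lambda>n. norm (w n - lincomb N a n) < \<epsilon> / 2) ultra" using WD[OF w e2] .
  obtain N' a' where a': "eventually (\<lambda>n. norm (v n - lincomb N' a' n) < \<epsilon> / 2) ultra" using WD[OF v e2] .
  let ?N = "max N N'"
  let ?a = "\<lambda>m. (if m < N then a m else 0) + (if m < N' then a' m else 0)"
  have eq: "lincomb ?N ?a n = lincomb N a n + lincomb N' a' n" for n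
    unfolding lincomb_extend[of N ?N a n, OF max.cobounded1] lincomb_extend[of N' ?N a' n, OF max.cobounded2]
    by (simp only: lincomb_def sc_simps(2) sum.distrib)
  have "eventually (\<lambda>n. norm (w n + v n - lincomb ?N ?a n) < \<epsilon>) ultra"
    using a a'
  proof eventually_elim
    case (elim n)
    have "w n + v n - lincomb ?N ?a n = (w n - lincomb N a n) + (v n - lincomb N' a' n)"
      unfolding eq by simp
    then have "norm (w n + v n - lincomb ?N ?a n) \<le> norm (w n - lincomb N a n) + norm (v n - lincomb N' a' n)"
      by (simp only: norm_triangle_ineq)
    then show ?case using elim by simp
  qed
  then show "\<exists>N a. eventually (\<lambda>n. norm (w n + v n - lincomb N a n) < \<epsilon>) ultra" by blast
qed

lemma W_sc:
  assumes w: "w \<in> W"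
  shows "(\<lambda>n. sc c (w n)) \<in> W"
  unfolding W_def
proof (clarify)
  interpret sc: bounded_linear "sc c" by (rule bounded_linear_sc)
  fix \<epsilon> :: real assume e: "\<epsilon> > 0"
  have pos: "norm c + 1 > 0" by (simp add: add_nonneg_pos)
  then have "\<epsilon> / (norm c + 1) > 0" using e by simp
  then obtain N a where a: "eventually (\<lambda>n. norm (w n - lincomb N a n) < \<epsilon> / (norm c + 1)) ultra" using WD[OF w] by blast
  have eq: "lincomb N (\<lambda>m. c * a m) n = sc c (lincomb N a n)" for n
    by (simp add: lincomb_def sc.sum sc_simps)
  have "eventually (\<lambda>n. norm (sc c (w n) - lincomb N (\<lambda>m. c * a m) n) < \<epsilon>) ultra"
    using a
  proof eventually_elim
    case (elim n)
    have "norm (sc c (w n) - lincomb N (\<lambda>m. c * a m) n) = norm c * norm (w n - lincomb N a n)"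
      unfolding eq by (simp add: sc_simps flip: sc.diff)
    also have "\<dots> \<le> (norm c + 1) * norm (w n - lincomb N a n)" by (intro mult_right_mono) auto
    also have "\<dots> < \<epsilon>" using elim pos by (simp add: field_simps)
    finally show ?case .
  qed
  then show "\<exists>N a. eventually (\<lambda>n. norm (sc c (w n) - lincomb N a n) < \<epsilon>) ultra" by blast
qed

lemma W_closed:
  assumes "\<And>\<epsilon>. \<epsilon> > 0 \<Longrightarrow> \<exists>v\<in>W. eventually (\<lambda>n. norm (w n - v n) < \<epsilon>) ultra"
  shows "w \<in> W"
  unfolding W_def
proof (clarify)
  fix \<epsilon> :: real assume "\<epsilon> > 0"
  then have e2: "\<epsilon> / 2 > 0" by simp
  obtain v where v: "v \<in> W" "eventually (\<lambda>n. norm (w n - v n) < \<epsilon> / 2) ultra" using assms[OF e2] by blast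
  obtain N a where a: "eventually (\<lambda>n. norm (v n - lincomb N a n) < \<epsilon> / 2) ultra" using WD[OF v(1) e2] .
  have "eventually (\<lambda>n. norm (w n - lincomb N a n) < \<epsilon>) ultra"
    using a v(2)
  proof eventually_elim
    case (elim n)
    have "norm (w n - lincomb N a n) \<le> norm (w n - v n) + norm (v n - lincomb N a n)"
      using norm_triangle_ineq[of "w n - v n" "v n - lincomb N a n"] by simp
    then show ?case using elim by simp
  qed
  then show "\<exists>N a. eventually (\<lambda>n. norm (w n - lincomb N a n) < \<epsilon>) ultra" by blast
qed

lemma W_lincomb: "lincomb N a \<in> W"
  unfolding W_def by (auto intro!: exI[of _ N] exI[of _ a])

lemma W_s: "s m \<in> W"
proof -
  have "lincomb (Suc m) (\<lambda>i. if i = m then 1 else 0) n = s m n" for n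
    unfolding lincomb_def by (simp add: sc_simps sc_zero)
  then have "lincomb (Suc m) (\<lambda>i. if i = m then 1 else 0) = s m" by blast
  then show ?thesis using W_lincomb by metis
qed

lemma W_zero: "(\<lambda>n. 0) \<in> W"
proof -
  have "lincomb 0 (\<lambda>_. 0) = (\<lambda>n. 0)" by (auto simp: lincomb_def)
  then show ?thesis using W_lincomb by metis
qed

lemma W_diff: "w \<in> W \<Longrightarrow> v \<in> W \<Longrightarrow> (\<lambda>n. w n - v n) \<in> W"
  using W_add[OF _ W_sc[of v "- 1"], of w] by (simp add: sc_minus sc_simps)

lemma W_sum: "finite B \<Longrightarrow> (\<And>b. b \<in> B \<Longrightarrow> w b \<in> W) \<Longrightarrow> (\<lambda>n. \<Sum>b\<in>B. w b n) \<in> W"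
  by (induction B rule: finite_induct) (simp_all add: W_zero W_add)

definition ultra_norm :: "(nat \<Rightarrow> 'a) \<Rightarrow> real" where
  "ultra_norm w = Lim ultra (\<lambda>n. norm (w n))"

lemma W_bounded:
  assumes w: "w \<in> W"
  shows "\<exists>K. eventually (\<lambda>n. norm (w n) \<le> K) ultra"
proof -
  obtain N a where a: "eventually (\<lambda>n. norm (w n - lincomb N a n) < 1) ultra" using WD[OF w zero_less_one] .
  have "norm (lincomb N a n) \<le> (\<Sum>m<N. norm (a m) * M)" for n
    unfolding lincomb_def using s_bound by (intro sum_norm_le) (simp add: sc_simps mult_left_mono)
  then have "eventually (\<lambda>n. norm (w n) \<le> 1 + (\<Sum>m<N. norm (a m) * M)) ultra"
    using a
  proof (elim eventually_mono)
    fix n assume "norm (w n - lincomb N a n) < 1" "\<And>n. norm (lincomb N a n) \<le> (\<Sum>m<N. norm (a m) * M)"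
    then show "norm (w n) \<le> 1 + (\<Sum>m<N. norm (a m) * M)"
      using norm_triangle_ineq[of "w n - lincomb N a n" "lincomb N a n"] by (smt (verit) diff_add_cancel)
  qed
  then show ?thesis by blast
qed

lemma tendsto_ultra_norm:
  assumes w: "w \<in> W"
  shows "((\<lambda>n. norm (w n)) \<longlongrightarrow> ultra_norm w) ultra"
proof -
  obtain K where "eventually (\<lambda>n. norm (w n) \<le> K) ultra" using W_bounded[OF w] by blast
  then have "eventually (\<lambda>n. norm (w n) \<in> cball 0 K) ultra" by eventually_elim (simp add: dist_norm)
  from ultra_tendsto[OF this bounded_cball] obtain l where "((\<lambda>n. norm (w n)) \<longlongrightarrow> l) ultra" by blast
  then show ?thesis unfolding ultra_norm_def using tendsto_Lim[OF ultra(2)] by blast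
qed

lemma ultra_norm_unique: "w \<in> W \<Longrightarrow> ((\<lambda>n. norm (w n)) \<longlongrightarrow> l) ultra \<Longrightarrow> ultra_norm w = l"
  using tendsto_unique[OF ultra(2) tendsto_ultra_norm] .

lemma ultra_norm_le: "w \<in> W \<Longrightarrow> eventually (\<lambda>n. norm (w n) \<le> c) ultra \<Longrightarrow> ultra_norm w \<le> c"
  using tendsto_upperbound[OF tendsto_ultra_norm _ ultra(2)] .

lemma ultra_norm_less: "w \<in> W \<Longrightarrow> ultra_norm w < c \<Longrightarrow> eventually (\<lambda>n. norm (w n) < c) ultra"
  using order_tendstoD(2)[OF tendsto_ultra_norm] .

lemma ultra_norm_nonneg: "w \<in> W \<Longrightarrow> 0 \<le> ultra_norm w"
  using tendsto_lowerbound[OF tendsto_ultra_norm _ ultra(2), of w 0] by simp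

lemma ultra_norm_triangle: "w \<in> W \<Longrightarrow> v \<in> W \<Longrightarrow> ultra_norm (\<lambda>n. w n + v n) \<le> ultra_norm w + ultra_norm v"
  by (rule tendsto_le[OF ultra(2) tendsto_add[OF tendsto_ultra_norm tendsto_ultra_norm] tendsto_ultra_norm[OF W_add]])
    (auto simp: norm_triangle_ineq intro!: always_eventually)

lemma ultra_norm_sc: "w \<in> W \<Longrightarrow> ultra_norm (\<lambda>n. sc c (w n)) = norm c * ultra_norm w"
  by (rule ultra_norm_unique[OF W_sc]) (simp_all add: sc_simps tendsto_mult_left tendsto_ultra_norm)

lemma ultra_norm_cong:
  assumes w: "w \<in> W" and v: "v \<in> W" and eq: "((\<lambda>n. w n - v n) \<longlongrightarrow> 0) ultra"
  shows "ultra_norm w = ultra_norm v"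
proof (rule ultra_norm_unique[OF w])
  have "((\<lambda>n. norm (w n) - norm (v n)) \<longlongrightarrow> 0) ultra"
  proof (rule Lim_null_comparison)
    show "eventually (\<lambda>n. norm (norm (w n) - norm (v n)) \<le> norm (w n - v n)) ultra"
      by (intro always_eventually allI) (simp add: norm_triangle_ineq3)
    show "((\<lambda>n. norm (w n - v n)) \<longlongrightarrow> 0) ultra" using eq by (rule tendsto_norm_zero)
  qed
  from tendsto_add[OF this tendsto_ultra_norm[OF v]] show "((\<lambda>n. norm (w n)) \<longlongrightarrow> ultra_norm v) ultra" by simp
qed

lemma ultra_norm_zero_iff: "w \<in> W \<Longrightarrow> ultra_norm w = 0 \<longleftrightarrow> (w \<longlongrightarrow> 0) ultra"
  using tendsto_ultra_norm[of w] ultra_norm_unique[of w 0] tendsto_norm_zero_iff[of w ultra] by auto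

text \<open>
  Elements of the space \<open>Y\<close> are classes of sequences that agree in the limit, so that they belong to
  the type over which super-reflexivity quantifies.
\<close>

definition ultra_class :: "(nat \<Rightarrow> 'a) \<Rightarrow> (nat \<Rightarrow> 'a) set" where
  "ultra_class w = {v. ((\<lambda>n. v n - w n) \<longlongrightarrow> 0) ultra}"

definition rep :: "(nat \<Rightarrow> 'a) set \<Rightarrow> nat \<Rightarrow> 'a" where
  "rep A = (SOME w. w \<in> A)"

lemma rep_ultra_class: "((\<lambda>n. rep (ultra_class w) n - w n) \<longlongrightarrow> 0) ultra"
proof -
  have "w \<in> ultra_class w" by (simp add: ultra_class_def)
  then have "rep (ultra_class w) \<in> ultra_class w" unfolding rep_def by (rule someI[of "\<lambda>v. v \<in> ultra_class w"])
  then show ?thesis by (simp add: ultra_class_def)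
qed

lemma ultra_class_eq_iff: "ultra_class w = ultra_class v \<longleftrightarrow> ((\<lambda>n. w n - v n) \<longlongrightarrow> 0) ultra"
proof
  assume "ultra_class w = ultra_class v"
  moreover have "w \<in> ultra_class w" by (simp add: ultra_class_def)
  ultimately show "((\<lambda>n. w n - v n) \<longlongrightarrow> 0) ultra" by (simp add: ultra_class_def)
next
  assume *: "((\<lambda>n. w n - v n) \<longlongrightarrow> 0) ultra"
  have "u \<in> ultra_class w \<longleftrightarrow> u \<in> ultra_class v" for u
    using tendsto_add[OF _ *, of "\<lambda>n. u n - w n" 0] tendsto_diff[OF _ *, of "\<lambda>n. u n - v n" 0]
    by (auto simp: ultra_class_def)
  then show "ultra_class w = ultra_class v" by blast
qed

lemma W_null: "v \<in> W \<Longrightarrow> ((\<lambda>n. w n - v n) \<longlongrightarrow> 0) ultra \<Longrightarrow> w \<in> W"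
  by (rule W_closed, rule bexI[of _ v]) (auto dest: tendstoD simp: dist_norm)

lemma rep_ultra_class_W: "w \<in> W \<Longrightarrow> rep (ultra_class w) \<in> W"
  by (rule W_null[OF _ rep_ultra_class])

definition Y :: "('k, (nat \<Rightarrow> 'a) set) nspace" where
  "Y = \<lparr>vcarrier = ultra_class ` W, vzero = ultra_class (\<lambda>n. 0), vadd = (\<lambda>A B. ultra_class (\<lambda>n. rep A n + rep B n)),
    vsmul = (\<lambda>c A. ultra_class (\<lambda>n. sc c (rep A n))), vnorm = (\<lambda>A. ultra_norm (rep A))\<rparr>"

lemma carrier_Y: "A \<in> vcarrier Y \<longleftrightarrow> (\<exists>w\<in>W. A = ultra_class w)" by (auto simp: Y_def)

lemma ultra_class_carrier: "w \<in> W \<Longrightarrow> ultra_class w \<in> vcarrier Y" by (auto simp: Y_def)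

lemma rep_carrier: "A \<in> vcarrier Y \<Longrightarrow> rep A \<in> W" by (auto simp: Y_def rep_ultra_class_W)

lemma ultra_class_rep: "A \<in> vcarrier Y \<Longrightarrow> ultra_class (rep A) = A"
  using ultra_class_eq_iff rep_ultra_class by (force simp: Y_def)

lemma zero_Y: "vzero Y = ultra_class (\<lambda>n. 0)" by (simp add: Y_def)

lemma add_Y: "vadd Y (ultra_class w) (ultra_class v) = ultra_class (\<lambda>n. w n + v n)"
proof -
  have "((\<lambda>n. (rep (ultra_class w) n - w n) + (rep (ultra_class v) n - v n)) \<longlongrightarrow> 0 + 0) ultra"
    by (intro tendsto_add rep_ultra_class)
  then show ?thesis by (simp add: Y_def ultra_class_eq_iff algebra_simps)
qed

lemma smul_Y: "vsmul Y c (ultra_class w) = ultra_class (\<lambda>n. sc c (w n))"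
proof -
  interpret sc: bounded_linear "sc c" by (rule bounded_linear_sc)
  have "((\<lambda>n. sc c (rep (ultra_class w) n - w n)) \<longlongrightarrow> sc c 0) ultra"
    by (intro sc.tendsto rep_ultra_class)
  then show ?thesis by (simp add: Y_def ultra_class_eq_iff sc.diff sc.zero)
qed

lemma norm_Y: "w \<in> W \<Longrightarrow> vnorm Y (ultra_class w) = ultra_norm w"
  using ultra_norm_cong[OF rep_ultra_class_W _ rep_ultra_class] by (simp add: Y_def)

lemma diff_Y: "vdiff Y (ultra_class w) (ultra_class v) = ultra_class (\<lambda>n. w n - v n)"
  by (simp add: vdiff_def smul_Y add_Y sc_minus sc_simps)

lemma normed_space_Y: "normed_space Y"
proof
  show "vzero Y \<in> vcarrier Y" by (simp add: zero_Y ultra_class_carrier W_zero)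
  show "\<And>x y. x \<in> vcarrier Y \<Longrightarrow> y \<in> vcarrier Y \<Longrightarrow> vadd Y x y \<in> vcarrier Y"
    unfolding carrier_Y by (auto simp: add_Y) (use W_add in blast)
  show "\<And>x c. x \<in> vcarrier Y \<Longrightarrow> vsmul Y c x \<in> vcarrier Y"
    unfolding carrier_Y by (auto simp: smul_Y) (use W_sc in blast)
  show "\<And>x y z. \<lbrakk>x \<in> vcarrier Y; y \<in> vcarrier Y; z \<in> vcarrier Y\<rbrakk>
    \<Longrightarrow> vadd Y (vadd Y x y) z = vadd Y x (vadd Y y z)"
    by (auto simp: carrier_Y add_Y add.assoc)
  show "\<And>x y. \<lbrakk>x \<in> vcarrier Y; y \<in> vcarrier Y\<rbrakk> \<Longrightarrow> vadd Y x y = vadd Y y x"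
    by (auto simp: carrier_Y add_Y add.commute)
  show "\<And>x. x \<in> vcarrier Y \<Longrightarrow> vadd Y x (vzero Y) = x"
    by (auto simp: carrier_Y zero_Y add_Y)
  show "\<And>x. x \<in> vcarrier Y \<Longrightarrow> vdiff Y x x = vzero Y"
    by (auto simp: carrier_Y zero_Y diff_Y)
  show "\<And>x y c. \<lbrakk>x \<in> vcarrier Y; y \<in> vcarrier Y\<rbrakk>
      \<Longrightarrow> vsmul Y c (vadd Y x y) = vadd Y (vsmul Y c x) (vsmul Y c y)"
    by (auto simp: carrier_Y add_Y smul_Y sc_simps)
  show "\<And>x c d. x \<in> vcarrier Y \<Longrightarrow> vsmul Y (c + d) x = vadd Y (vsmul Y c x) (vsmul Y d x)"
    by (auto simp: carrier_Y add_Y smul_Y sc_simps)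
  show "\<And>x c d. x \<in> vcarrier Y \<Longrightarrow> vsmul Y c (vsmul Y d x) = vsmul Y (c * d) x"
    by (auto simp: carrier_Y smul_Y sc_simps)
  show "\<And>x. x \<in> vcarrier Y \<Longrightarrow> vsmul Y 1 x = x"
    by (auto simp: carrier_Y smul_Y sc_simps)
  show "\<And>x. x \<in> vcarrier Y \<Longrightarrow> vnorm Y x = 0 \<longleftrightarrow> x = vzero Y"
    unfolding carrier_Y by (erule bexE) (simp add: zero_Y norm_Y ultra_class_eq_iff ultra_norm_zero_iff)
  show "\<And>x y. \<lbrakk>x \<in> vcarrier Y; y \<in> vcarrier Y\<rbrakk> \<Longrightarrow> vnorm Y (vadd Y x y) \<le> vnorm Y x + vnorm Y y"
    by (auto simp: carrier_Y add_Y norm_Y W_add ultra_norm_triangle)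
  show "\<And>x c. x \<in> vcarrier Y \<Longrightarrow> vnorm Y (vsmul Y c x) = norm c * vnorm Y x"
    by (auto simp: carrier_Y smul_Y norm_Y W_sc ultra_norm_sc)
qed

text \<open>
  A diagonal argument. Let \<open>u j\<close> represent the members of a rapidly convergent subsequence. At the index
  \<open>n\<close> the limit \<open>w\<close> takes the value of \<open>u j\<close> for the largest \<open>j \<le> n\<close> such that the estimates between
  \<open>u j\<close> and all earlier \<open>u i\<close>, which hold for most indices, hold at \<open>n\<close>.
\<close>

lemma complete_Y:
  assumes A: "\<And>n. A n \<in> vcarrier Y"
    and cauchy: "\<And>e. e > 0 \<Longrightarrow> \<exists>N. \<forall>m\<ge>N. \<forall>n\<ge>N. vnorm Y (vdiff Y (A m) (A n)) < e"
  shows "\<exists>l\<in>vcarrier Y. (\<lambda>n. vnorm Y (vdiff Y (A n) l)) \<longlonglongrightarrow> 0"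
proof -
  define v where "v n = rep (A n)" for n
  have v: "v n \<in> W" "ultra_class (v n) = A n" for n using A by (auto simp: v_def rep_carrier ultra_class_rep)
  have norm_diff: "vnorm Y (vdiff Y (A m) (A n)) = ultra_norm (\<lambda>k. v m k - v n k)" for m n
    unfolding v(2)[symmetric] diff_Y by (rule norm_Y[OF W_diff[OF v(1) v(1)]])
  have "\<forall>j. \<exists>N. \<forall>m\<ge>N. \<forall>n\<ge>N. ultra_norm (\<lambda>k. v m k - v n k) < (1/2 :: real) ^ j"
    using cauchy unfolding norm_diff by simp
  from choice[OF this] obtain N0 where
    N0: "\<And>j m n. m \<ge> N0 j \<Longrightarrow> n \<ge> N0 j \<Longrightarrow> ultra_norm (\<lambda>k. v m k - v n k) < (1/2 :: real) ^ j" by blast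
  \<comment> \<open>A monotone choice of indices that dominates all \<open>N0 i\<close> with \<open>i \<le> j\<close>.\<close>
  define N where "N j = (\<Sum>i\<le>j. N0 i)" for j
  have N_ge: "N0 i \<le> N j" if "i \<le> j" for i j
    unfolding N_def using that by (intro member_le_sum) auto
  define u where "u j = v (N j)" for j
  have uW: "u j \<in> W" for j by (simp add: u_def v)
  define good where "good n j \<longleftrightarrow> j \<le> n \<and> (\<forall>i\<le>j. norm (u j n - u i n) < (1/2 :: real) ^ i)" for n j
  define J where "J n = (GREATEST j. good n j)" for n
  define w where "w n = u (J n) n" for n
  have good0: "good n 0" for n by (simp add: good_def)
  have goodJ: "good n (J n)" for n
    unfolding J_def by (rule GreatestI_nat[where P = "good n" and k = 0 and b = n, OF good0]) (auto simp: good_def)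
  have leJ: "j \<le> J n" if "good n j" for n j
    unfolding J_def using that by (rule Greatest_le_nat[where P = "good n" and b = n]) (auto simp: good_def)
  have close: "eventually (\<lambda>n. norm (w n - u j n) < (1/2 :: real) ^ j) ultra" for j
  proof -
    have "eventually (\<lambda>n. norm (u j n - u i n) < (1/2 :: real) ^ i) ultra" if "i \<le> j" for i
      using N_ge[OF that] N_ge[of i i] unfolding u_def by (intro ultra_norm_less W_diff v N0) auto
    then have "eventually (\<lambda>n. \<forall>i\<in>{..j}. norm (u j n - u i n) < (1/2 :: real) ^ i) ultra"
      by (intro eventually_ball_finite) auto
    moreover have "eventually (\<lambda>n. j \<le> n) ultra"
      using ultra(1) eventually_ge_at_top[of j] by (auto simp: le_filter_def)
    ultimately show ?thesis
    proof eventually_elim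
      case (elim n)
      then have "good n j" by (auto simp: good_def)
      then show ?case using goodJ[of n] leJ by (auto simp: good_def w_def)
    qed
  qed
  have wW: "w \<in> W"
  proof (rule W_closed)
    fix e :: real assume "e > 0"
    then obtain j where j: "(1/2 :: real) ^ j < e" using real_arch_pow_inv[of e "1/2"] by auto
    show "\<exists>v\<in>W. eventually (\<lambda>n. norm (w n - v n) < e) ultra"
      by (rule bexI[OF _ uW[of j]]) (use close[of j] j in \<open>auto elim: eventually_mono\<close>)
  qed
  have "(\<lambda>n. ultra_norm (\<lambda>k. v n k - w k)) \<longlonglongrightarrow> 0"
  proof (rule LIMSEQ_I)
    fix e :: real assume "e > 0"
    then obtain j where j: "(1/2 :: real) ^ j < e / 2" using real_arch_pow_inv[of "e / 2" "1/2"] by auto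
    have "norm (ultra_norm (\<lambda>k. v n k - w k) - 0) < e" if n: "n \<ge> N j" for n
    proof -
      have "ultra_norm (\<lambda>k. (v n k - u j k) + (u j k - w k)) \<le> ultra_norm (\<lambda>k. v n k - u j k) + ultra_norm (\<lambda>k. u j k - w k)"
        by (intro ultra_norm_triangle W_diff v uW wW)
      also have "(\<lambda>k. (v n k - u j k) + (u j k - w k)) = (\<lambda>k. v n k - w k)" by simp
      also have "ultra_norm (\<lambda>k. v n k - u j k) < (1/2) ^ j"
        unfolding u_def using n N_ge[of j j] by (intro N0) auto
      also have "ultra_norm (\<lambda>k. u j k - w k) \<le> (1/2) ^ j"
        using close[of j] by (intro ultra_norm_le W_diff uW wW) (auto simp: norm_minus_commute elim: eventually_mono)
      finally show ?thesis using j ultra_norm_nonneg[OF W_diff[OF v(1) wW], of n] by simp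
    qed
    then show "\<exists>no. \<forall>n\<ge>no. norm (ultra_norm (\<lambda>k. v n k - w k) - 0) < e" by blast
  qed
  moreover have "vnorm Y (vdiff Y (A n) (ultra_class w)) = ultra_norm (\<lambda>k. v n k - w k)" for n
    unfolding v(2)[symmetric] diff_Y by (rule norm_Y[OF W_diff[OF v(1) wW]])
  ultimately show ?thesis by (intro bexI[OF _ ultra_class_carrier[OF wW]]) simp
qed

lemma banach_space_Y: "banach_space Y"
  using normed_space_Y complete_Y unfolding banach_space_def banach_space_axioms_def by blast

end

section \<open>Finite representability\<close>

context ultra_span
begin

definition comb :: "(nat \<Rightarrow> 'a) set set \<Rightarrow> ((nat \<Rightarrow> 'a) set \<Rightarrow> 'k) \<Rightarrow> nat \<Rightarrow> 'a" where
  "comb B a n = (\<Sum>b\<in>B. sc (a b) (rep b n))"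

lemma comb_add: "comb B (\<lambda>b. a b + a' b) n = comb B a n + comb B a' n"
  by (simp add: comb_def sc_simps sum.distrib)

lemma comb_scale: "comb B (\<lambda>b. c * a b) n = sc c (comb B a n)"
proof -
  interpret sc: bounded_linear "sc c" by (rule bounded_linear_sc)
  show ?thesis by (simp add: comb_def sc.sum sc_simps)
qed

lemma comb_diff: "comb B (\<lambda>b. a b - a' b) n = comb B a n - comb B a' n"
  using comb_add[of B a "\<lambda>b. - 1 * a' b" n] comb_scale[of B "- 1" a' n] by (simp add: sc_minus sc_simps)

lemma comb_cong: "(\<And>b. b \<in> B \<Longrightarrow> a b = a' b) \<Longrightarrow> comb B a = comb B a'"
  by (intro ext) (simp add: comb_def)

lemma comb_W: "finite B \<Longrightarrow> B \<subseteq> vcarrier Y \<Longrightarrow> comb B a \<in> W"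
  unfolding comb_def[abs_def] by (intro W_sum W_sc rep_carrier) auto

lemma vspan_comb:
  assumes B: "finite B" "B \<subseteq> vcarrier Y" and A: "A \<in> vspan Y B"
  shows "\<exists>a. A = ultra_class (comb B a)"
proof -
  let ?R = "range (\<lambda>a. ultra_class (comb B a))"
  have "vsubspace Y ?R"
    unfolding vsubspace_def
  proof (intro conjI ballI allI)
    show "?R \<subseteq> vcarrier Y" using ultra_class_carrier comb_W[OF B] by auto
    show "vzero Y \<in> ?R"
      by (rule range_eqI[of _ _ "\<lambda>_. 0"]) (simp add: zero_Y comb_def[abs_def] sc_zero)
    fix A assume "A \<in> ?R"
    then obtain a where a: "A = ultra_class (comb B a)" by blast
    show "vsmul Y c A \<in> ?R" for c
      by (rule range_eqI[of _ _ "\<lambda>b. c * a b"]) (simp add: a smul_Y comb_scale[abs_def])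
    fix A' assume "A' \<in> ?R"
    then obtain a' where a': "A' = ultra_class (comb B a')" by blast
    show "vadd Y A A' \<in> ?R"
      by (rule range_eqI[of _ _ "\<lambda>b. a b + a' b"]) (simp add: a a' add_Y comb_add[abs_def])
  qed
  moreover have "b \<in> ?R" if b: "b \<in> B" for b
  proof (rule range_eqI[of _ _ "\<lambda>b'. if b' = b then 1 else 0"])
    have "comb B (\<lambda>b'. if b' = b then 1 else 0) n = (\<Sum>b'\<in>B. if b' = b then rep b n else 0)" for n
      unfolding comb_def by (intro sum.cong) (auto simp: sc_simps sc_zero)
    then have "comb B (\<lambda>b'. if b' = b then 1 else 0) = rep b" using B(1) b by auto
    then show "b = ultra_class (comb B (\<lambda>b'. if b' = b then 1 else 0))" using ultra_class_rep b B(2) by auto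
  qed
  ultimately have "vspan Y B \<subseteq> ?R" unfolding vspan_def by (intro hull_minimal) auto
  then show ?thesis using A by blast
qed

text \<open>
  A generating set of least cardinality: an element with nonzero coefficient in a vanishing combination
  could be eliminated.
\<close>

lemma independent_generators:
  assumes "fin_dim_subspace Y E"
  obtains B where "finite B" "B \<subseteq> vcarrier Y" "\<And>A. A \<in> E \<Longrightarrow> \<exists>a. A = ultra_class (comb B a)"
    "\<forall>a. (comb B a \<longlongrightarrow> 0) ultra \<longrightarrow> (\<forall>b\<in>B. a b = 0)"
proof -
  define Q where "Q B \<longleftrightarrow> finite B \<and> B \<subseteq> vcarrier Y \<and> (\<forall>A\<in>E. \<exists>a. A = ultra_class (comb B a))" for B
  obtain B0 where "finite B0" "B0 \<subseteq> vcarrier Y" "E = vspan Y B0"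
    using assms by (auto simp: fin_dim_subspace_def)
  then have "Q B0" using vspan_comb by (simp add: Q_def)
  from ex_has_least_nat[of Q B0 card, OF this] obtain B where
    B: "Q B" "\<And>B'. Q B' \<Longrightarrow> card B \<le> card B'" by blast
  have fin: "finite B" "B \<subseteq> vcarrier Y" using B(1) by (auto simp: Q_def)
  have "a b = 0" if null: "(comb B a \<longlongrightarrow> 0) ultra" and b: "b \<in> B" for a b
  proof (rule ccontr)
    assume nz: "a b \<noteq> 0"
    have "Q (B - {b})"
      unfolding Q_def
    proof (intro conjI ballI)
      fix A assume "A \<in> E"
      then obtain c where c: "A = ultra_class (comb B c)" using B(1) by (auto simp: Q_def)
      define t where "t = c b / a b"
      define c' where "c' = (\<lambda>b'. c b' - t * a b')"
      have c'b: "c' b = 0" using nz by (simp add: c'_def t_def)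
      have "comb (B - {b}) c' n = comb B c' n" for n
        unfolding comb_def using fin(1) b by (simp add: sum.remove[of B b] c'b sc_zero)
      then have eq: "comb B c n - comb (B - {b}) c' n = sc t (comb B a n)" for n
        by (simp add: c'_def comb_diff comb_scale)
      interpret sc: bounded_linear "sc t" by (rule bounded_linear_sc)
      have "((\<lambda>n. sc t (comb B a n)) \<longlongrightarrow> sc t 0) ultra" by (rule sc.tendsto[OF null])
      then have "A = ultra_class (comb (B - {b}) c')" unfolding c ultra_class_eq_iff eq by (simp add: sc.zero)
      then show "\<exists>a. A = ultra_class (comb (B - {b}) a)" by blast
    qed (use fin in auto)
    then have "card B \<le> card (B - {b})" by (rule B(2))
    then show False using card_Diff1_less[OF fin(1) b] by simp
  qed
  then show ?thesis using that[OF fin] B(1) unfolding Q_def by blast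
qed

context
  fixes B :: "(nat \<Rightarrow> 'a) set set"
  assumes B: "finite B" "B \<subseteq> vcarrier Y"
begin

lemma coefficient_limit:
  assumes a: "eventually (\<lambda>n. (\<Sum>b\<in>B. norm (a n b :: 'k)) = 1) ultra"
  shows "\<exists>a0. (\<forall>b\<in>B. ((\<lambda>n. a n b) \<longlongrightarrow> a0 b) ultra) \<and> (\<Sum>b\<in>B. norm (a0 b)) = 1"
proof -
  have "\<exists>l. ((\<lambda>n. a n b) \<longlongrightarrow> l) ultra" if b: "b \<in> B" for b
  proof (rule ultra_tendsto_scalar)
    show "eventually (\<lambda>n. norm (a n b) \<le> 1) ultra"
      using a
    proof eventually_elim
      case (elim n)
      have "norm (a n b) \<le> (\<Sum>b\<in>B. norm (a n b))"
        using B(1) b by (intro member_le_sum) auto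
      then show ?case using elim by simp
    qed
  qed
  then have "\<forall>b\<in>B. \<exists>l. ((\<lambda>n. a n b) \<longlongrightarrow> l) ultra" by blast
  from bchoice[OF this] obtain a0 where a0: "\<forall>b\<in>B. ((\<lambda>n. a n b) \<longlongrightarrow> a0 b) ultra" ..
  have "((\<lambda>n. \<Sum>b\<in>B. norm (a n b)) \<longlongrightarrow> (\<Sum>b\<in>B. norm (a0 b))) ultra"
    using a0 by (intro tendsto_sum tendsto_norm) auto
  moreover have "((\<lambda>n. \<Sum>b\<in>B. norm (a n b)) \<longlongrightarrow> 1) ultra" by (rule tendsto_eventually[OF a])
  ultimately have "(\<Sum>b\<in>B. norm (a0 b)) = 1" by (rule tendsto_unique[OF ultra(2)])
  then show ?thesis using a0 by blast
qed

lemma norm_comb_diff_le: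
  "\<bar>norm (comb B a n) - norm (comb B a' n)\<bar> \<le> (\<Sum>b\<in>B. norm (a b - a' b) * norm (rep b n))"
proof -
  have "\<bar>norm (comb B a n) - norm (comb B a' n)\<bar> \<le> norm (comb B (\<lambda>b. a b - a' b) n)"
    unfolding comb_diff by (rule norm_triangle_ineq3)
  also have "\<dots> \<le> (\<Sum>b\<in>B. norm (a b - a' b) * norm (rep b n))"
    unfolding comb_def by (intro sum_norm_le) (simp add: sc_simps)
  finally show ?thesis .
qed

lemma ultra_norm_comb_diff_le:
  "\<bar>ultra_norm (comb B a) - ultra_norm (comb B a')\<bar> \<le> (\<Sum>b\<in>B. norm (a b - a' b) * ultra_norm (rep b))"
proof (rule tendsto_le[OF ultra(2)])
  show "((\<lambda>n. \<bar>norm (comb B a n) - norm (comb B a' n)\<bar>) \<longlongrightarrow> \<bar>ultra_norm (comb B a) - ultra_norm (comb B a')\<bar>) ultra"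
    by (intro tendsto_rabs tendsto_diff tendsto_ultra_norm comb_W B)
  show "((\<lambda>n. \<Sum>b\<in>B. norm (a b - a' b) * norm (rep b n)) \<longlongrightarrow> (\<Sum>b\<in>B. norm (a b - a' b) * ultra_norm (rep b))) ultra"
    using B(2) by (intro tendsto_sum tendsto_mult tendsto_const tendsto_ultra_norm rep_carrier) auto
qed (intro always_eventually allI norm_comb_diff_le)

lemma coefficient_error_tendsto:
  assumes "\<And>b. b \<in> B \<Longrightarrow> ((\<lambda>n. a n b :: 'k) \<longlongrightarrow> a0 b) ultra"
    and "\<And>b. b \<in> B \<Longrightarrow> ((\<lambda>n. q n b) \<longlongrightarrow> qlim b) ultra"
  shows "((\<lambda>n. \<Sum>b\<in>B. norm (a n b - a0 b) * q n b :: real) \<longlongrightarrow> 0) ultra"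
proof -
  have "((\<lambda>n. \<Sum>b\<in>B. norm (a n b - a0 b) * q n b) \<longlongrightarrow> (\<Sum>b\<in>B. norm (a0 b - a0 b) * qlim b)) ultra"
    using assms by (intro tendsto_sum tendsto_mult tendsto_norm tendsto_diff tendsto_const) auto
  then show ?thesis by simp
qed

text \<open>
  At almost every index the norm in \<open>X\<close> is close to the norm in \<open>Y\<close>, uniformly over normalised
  coefficients. If the exceptional coefficients \<open>a n\<close> existed at most indices, they would have a limit
  \<open>a0\<close> along the ultrafilter; replacing \<open>a n\<close> by \<open>a0\<close> changes both norms by an amount that tends to 0.
\<close>

lemma norm_comb_uniform:
  assumes \<eta>: "\<eta> > 0"
  shows "eventually (\<lambda>n. \<forall>a. (\<Sum>b\<in>B. norm (a b)) = 1 \<longrightarrow> \<bar>norm (comb B a n) - ultra_norm (comb B a)\<bar> < \<eta>) ultra"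
    (is "eventually ?P ultra")
proof (rule ccontr)
  assume "\<not> ?thesis"
  then have evP: "eventually (\<lambda>n. \<not> ?P n) ultra" using ultra(3) by blast
  define R where "R n a \<longleftrightarrow> (\<Sum>b\<in>B. norm (a b)) = 1 \<and> \<eta> \<le> \<bar>norm (comb B a n) - ultra_norm (comb B a)\<bar>" for n a
  have ev0: "eventually (\<lambda>n. \<exists>a. R n a) ultra"
    by (rule eventually_mono[OF evP]) (auto simp: R_def not_less)
  define a where "a n = (SOME a. R n a)" for n
  have ev: "eventually (\<lambda>n. R n (a n)) ultra"
  proof (rule eventually_mono[OF ev0])
    fix n assume "\<exists>a. R n a"
    then show "R n (a n)" unfolding a_def by (rule someI_ex[of "R n"])
  qed
  have "eventually (\<lambda>n. (\<Sum>b\<in>B. norm (a n b)) = 1) ultra"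
    using ev by (rule eventually_mono) (simp add: R_def)
  from coefficient_limit[OF this] obtain a0 where a0: "\<And>b. b \<in> B \<Longrightarrow> ((\<lambda>n. a n b) \<longlongrightarrow> a0 b) ultra" by blast
  let ?d1 = "\<lambda>n. \<Sum>b\<in>B. norm (a n b - a0 b) * norm (rep b n)"
  let ?d2 = "\<lambda>n. \<Sum>b\<in>B. norm (a n b - a0 b) * ultra_norm (rep b)"
  have "(?d1 \<longlongrightarrow> 0) ultra"
    using B(2) by (intro coefficient_error_tendsto[where a = a and q = "\<lambda>n b. norm (rep b n)" and qlim = "\<lambda>b. ultra_norm (rep b)"] a0 tendsto_ultra_norm rep_carrier) auto
  moreover have "(?d2 \<longlongrightarrow> 0) ultra"
    by (intro coefficient_error_tendsto[where a = a and q = "\<lambda>n b. ultra_norm (rep b)" and qlim = "\<lambda>b. ultra_norm (rep b)"] a0 tendsto_const)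
  moreover have "((\<lambda>n. \<bar>norm (comb B a0 n) - ultra_norm (comb B a0)\<bar>) \<longlongrightarrow> \<bar>ultra_norm (comb B a0) - ultra_norm (comb B a0)\<bar>) ultra"
    by (intro tendsto_rabs tendsto_diff tendsto_ultra_norm comb_W B tendsto_const)
  ultimately have "((\<lambda>n. ?d1 n + ?d2 n + \<bar>norm (comb B a0 n) - ultra_norm (comb B a0)\<bar>) \<longlongrightarrow> 0 + 0 + \<bar>ultra_norm (comb B a0) - ultra_norm (comb B a0)\<bar>) ultra"
    by (intro tendsto_add)
  then have "eventually (\<lambda>n. ?d1 n + ?d2 n + \<bar>norm (comb B a0 n) - ultra_norm (comb B a0)\<bar> < \<eta>) ultra"
    using \<eta> by (intro order_tendstoD(2)) auto
  with ev have "eventually (\<lambda>_. False) ultra"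
  proof eventually_elim
    case (elim n)
    show ?case
      using elim norm_comb_diff_le[of "a n" n a0] ultra_norm_comb_diff_le[of "a n" a0] unfolding R_def by linarith
  qed
  then show False using ultra(2) by (simp add: trivial_limit_def)
qed

lemma ultra_norm_comb_lower_bound:
  assumes indep: "\<forall>a. (comb B a \<longlongrightarrow> 0) ultra \<longrightarrow> (\<forall>b\<in>B. a b = 0)"
  shows "\<exists>\<delta>>0. \<forall>a. (\<Sum>b\<in>B. norm (a b)) = 1 \<longrightarrow> \<delta> \<le> ultra_norm (comb B a)"
proof (rule ccontr)
  assume no: "\<not> ?thesis"
  have "\<exists>a. (\<Sum>b\<in>B. norm (a b)) = 1 \<and> ultra_norm (comb B a) < 1 / real (Suc n)" for n
    using no by (auto simp: not_le dest!: spec[of _ "1 / real (Suc n)"])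
  then have "\<forall>n. \<exists>a. (\<Sum>b\<in>B. norm (a b)) = 1 \<and> ultra_norm (comb B a) < 1 / real (Suc n)" by blast
  from choice[OF this] obtain a where
    a: "\<And>n. (\<Sum>b\<in>B. norm (a n b)) = 1" "\<And>n. ultra_norm (comb B (a n)) < 1 / real (Suc n)" by blast
  have "eventually (\<lambda>n. (\<Sum>b\<in>B. norm (a n b)) = 1) ultra" using a(1) by simp
  from coefficient_limit[OF this] obtain a0 where
    a0: "\<And>b. b \<in> B \<Longrightarrow> ((\<lambda>n. a n b) \<longlongrightarrow> a0 b) ultra" "(\<Sum>b\<in>B. norm (a0 b)) = 1" by blast
  let ?d2 = "\<lambda>n. \<Sum>b\<in>B. norm (a n b - a0 b) * ultra_norm (rep b)"
  have "(?d2 \<longlongrightarrow> 0) ultra"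
    by (intro coefficient_error_tendsto[where a = a and q = "\<lambda>n b. ultra_norm (rep b)" and qlim = "\<lambda>b. ultra_norm (rep b)"] a0 tendsto_const)
  moreover have "((\<lambda>n. 1 / real (Suc n)) \<longlongrightarrow> 0) ultra"
    using LIMSEQ_inverse_real_of_nat by (intro tendsto_ultra) (simp add: inverse_eq_divide)
  ultimately have "((\<lambda>n. ?d2 n + 1 / real (Suc n)) \<longlongrightarrow> 0 + 0) ultra" by (intro tendsto_add)
  moreover have "ultra_norm (comb B a0) \<le> ?d2 n + 1 / real (Suc n)" for n
    using ultra_norm_comb_diff_le[of "a n" a0] a(2)[of n] by linarith
  ultimately have "ultra_norm (comb B a0) \<le> 0"
    using tendsto_lowerbound[OF _ _ ultra(2), of _ 0 "ultra_norm (comb B a0)"] by simp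
  then have "ultra_norm (comb B a0) = 0" using ultra_norm_nonneg[OF comb_W[OF B], of a0] by simp
  then have "(comb B a0 \<longlongrightarrow> 0) ultra" using ultra_norm_zero_iff[OF comb_W[OF B]] by blast
  then have "\<forall>b\<in>B. a0 b = 0" using indep by blast
  then show False using a0(2) by simp
qed

lemma almost_isometric_index:
  assumes indep: "\<forall>a. (comb B a \<longlongrightarrow> 0) ultra \<longrightarrow> (\<forall>b\<in>B. a b = 0)" and t: "t > 0"
  shows "\<exists>n. \<forall>a. \<bar>norm (comb B a n) - ultra_norm (comb B a)\<bar> \<le> t * ultra_norm (comb B a)"
proof -
  obtain \<delta> where \<delta>: "\<delta> > 0" "\<And>a. (\<Sum>b\<in>B. norm (a b)) = 1 \<Longrightarrow> \<delta> \<le> ultra_norm (comb B a)"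
    using ultra_norm_comb_lower_bound[OF indep] by blast
  have "t * \<delta> > 0" using t \<delta>(1) by simp
  from eventually_happens'[OF ultra(2) norm_comb_uniform[OF this]] obtain n where
    n: "\<And>a. (\<Sum>b\<in>B. norm (a b)) = 1 \<Longrightarrow> \<bar>norm (comb B a n) - ultra_norm (comb B a)\<bar> < t * \<delta>" by blast
  have "\<bar>norm (comb B a n) - ultra_norm (comb B a)\<bar> \<le> t * ultra_norm (comb B a)" for a
  proof -
    define S where "S = (\<Sum>b\<in>B. norm (a b))"
    have S0: "S \<ge> 0" unfolding S_def by (intro sum_nonneg) auto
    define a' where "a' = (\<lambda>b. of_real (inverse S) * a b)"
    have scale: "comb B a' n = inverse S *\<^sub>R comb B a n" for n
      by (simp only: a'_def comb_scale sc_of_real)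
    have ultra_norm_scale: "ultra_norm (comb B a') = norm (of_real (inverse S) :: 'k) * ultra_norm (comb B a)"
      unfolding a'_def comb_scale[abs_def] by (rule ultra_norm_sc[OF comb_W[OF B]])
    show ?thesis
    proof (cases "S = 0")
      case True
      then have "\<forall>b\<in>B. a b = 0" using B(1) by (simp add: S_def sum_nonneg_eq_0_iff)
      then have "comb B a = (\<lambda>n. 0)" by (intro ext) (simp add: comb_def sc_zero)
      moreover have "ultra_norm (\<lambda>n. 0) = 0" by (simp add: ultra_norm_zero_iff W_zero)
      ultimately show ?thesis by simp
    next
      case False
      then have S: "S > 0" using S0 by simp
      have "(\<Sum>b\<in>B. norm (a' b)) = (\<Sum>b\<in>B. inverse S * norm (a b))"
        using S by (intro sum.cong) (simp_all add: a'_def norm_mult norm_inverse)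
      also have "\<dots> = inverse S * S" by (simp only: S_def sum_distrib_left)
      finally have one: "(\<Sum>b\<in>B. norm (a' b)) = 1" using S by simp
      have "\<bar>norm (comb B a' n) - ultra_norm (comb B a')\<bar> \<le> t * ultra_norm (comb B a')"
        using n[OF one] mult_left_mono[OF \<delta>(2)[OF one], of t] t by linarith
      moreover have "norm (comb B a' n) - ultra_norm (comb B a') = inverse S * (norm (comb B a n) - ultra_norm (comb B a))"
        unfolding scale ultra_norm_scale using S by (simp add: norm_inverse algebra_simps)
      moreover have "t * ultra_norm (comb B a') = inverse S * (t * ultra_norm (comb B a))"
        unfolding ultra_norm_scale using S by (simp add: norm_inverse)
      ultimately have "inverse S * \<bar>norm (comb B a n) - ultra_norm (comb B a)\<bar> \<le> inverse S * (t * ultra_norm (comb B a))"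
        using S by (simp add: abs_mult)
      then show ?thesis using S by (simp only: mult_le_cancel_left_pos positive_imp_inverse_positive)
    qed
  qed
  then show ?thesis by blast
qed

end

text \<open>
  Evaluation at a suitable index \<open>n\<close>, in coordinates with respect to an independent generating set,
  distorts norms by factors between \<open>1 - t\<close> and \<open>1 + t\<close>; it is rescaled so that it does not decrease them.
\<close>

theorem finitely_representable_Y: "finitely_representable Y (type_space sc)"
  unfolding finitely_representable_def
proof (intro allI impI)
  fix E and \<epsilon> :: real assume \<epsilon>: "0 < \<epsilon>" and E: "fin_dim_subspace Y E"
  obtain B where B: "finite B" "B \<subseteq> vcarrier Y" and coords: "\<And>A. A \<in> E \<Longrightarrow> \<exists>a. A = ultra_class (comb B a)"
    and indep: "\<forall>a. (comb B a \<longlongrightarrow> 0) ultra \<longrightarrow> (\<forall>b\<in>B. a b = 0)"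
    using independent_generators[OF E] by blast
  \<comment> \<open>Chosen so that \<open>(1 + t) / (1 - t) = 1 + \<epsilon>\<close>.\<close>
  define t where "t = \<epsilon> / (2 + \<epsilon>)"
  have t: "0 < t" "t < 1" "(1 + t) * inverse (1 - t) = 1 + \<epsilon>"
    using \<epsilon> by (simp_all add: t_def field_simps)
  obtain n where n: "\<And>a. \<bar>norm (comb B a n) - ultra_norm (comb B a)\<bar> \<le> t * ultra_norm (comb B a)"
    using almost_isometric_index[OF B indep t(1)] by blast
  define coord where "coord A = (SOME a. A = ultra_class (comb B a))" for A
  define T where "T A = inverse (1 - t) *\<^sub>R comb B (coord A) n" for A
  have T: "T (ultra_class (comb B a)) = inverse (1 - t) *\<^sub>R comb B a n" for a
  proof -
    have "ultra_class (comb B a) = ultra_class (comb B (coord (ultra_class (comb B a))))"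
      unfolding coord_def by (rule someI[where P = "\<lambda>a'. ultra_class (comb B a) = ultra_class (comb B a')"]) (rule refl)
    then have "(comb B (\<lambda>b. a b - coord (ultra_class (comb B a)) b) \<longlongrightarrow> 0) ultra"
      by (simp add: ultra_class_eq_iff comb_diff[abs_def])
    then have "\<forall>b\<in>B. a b - coord (ultra_class (comb B a)) b = 0" using indep[rule_format, of "\<lambda>b. a b - coord (ultra_class (comb B a)) b"] by blast
    then have "comb B (coord (ultra_class (comb B a))) = comb B a" by (intro comb_cong) simp
    then show ?thesis by (simp add: T_def)
  qed
  have "vlinear_on Y (type_space sc) E T"
    unfolding vlinear_on_def
  proof (intro conjI ballI allI)
    fix A assume "A \<in> E"
    then obtain a where a: "A = ultra_class (comb B a)" using coords by blast
    show "T A \<in> vcarrier (type_space sc)" by simp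
    show "T (vsmul Y c A) = vsmul (type_space sc) c (T A)" for c
    proof -
      have "vsmul Y c A = ultra_class (comb B (\<lambda>b. c * a b))" by (simp add: a smul_Y comb_scale[abs_def])
      then show ?thesis by (simp add: T a comb_scale sc_scaleR)
    qed
    fix A' assume "A' \<in> E"
    then obtain a' where a': "A' = ultra_class (comb B a')" using coords by blast
    have "vadd Y A A' = ultra_class (comb B (\<lambda>b. a b + a' b))" by (simp add: a a' add_Y comb_add[abs_def])
    then show "T (vadd Y A A') = vadd (type_space sc) (T A) (T A')"
      by (simp add: T a a' comb_add scaleR_right_distrib)
  qed
  moreover have "vnorm Y A \<le> vnorm (type_space sc) (T A) \<and> vnorm (type_space sc) (T A) \<le> (1 + \<epsilon>) * vnorm Y A"
    if "A \<in> E" for A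
  proof -
    obtain a where a: "A = ultra_class (comb B a)" using coords \<open>A \<in> E\<close> by blast
    have nY: "vnorm Y A = ultra_norm (comb B a)" unfolding a by (rule norm_Y[OF comb_W[OF B]])
    have nT: "norm (T A) = inverse (1 - t) * norm (comb B a n)" using t by (simp add: a T)
    have inv: "inverse (1 - t) > 0" using t by simp
    have "(1 - t) * ultra_norm (comb B a) \<le> norm (comb B a n)" "norm (comb B a n) \<le> (1 + t) * ultra_norm (comb B a)"
      using n[of a] by (simp_all add: abs_le_iff algebra_simps)
    then have "inverse (1 - t) * ((1 - t) * ultra_norm (comb B a)) \<le> norm (T A)"
      "norm (T A) \<le> inverse (1 - t) * ((1 + t) * ultra_norm (comb B a))"
      unfolding nT using inv by (auto intro!: mult_left_mono)
    moreover have "inverse (1 - t) * ((1 - t) * ultra_norm (comb B a)) = ultra_norm (comb B a)" using t by simp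
    moreover have "inverse (1 - t) * ((1 + t) * ultra_norm (comb B a)) = (1 + \<epsilon>) * ultra_norm (comb B a)"
      using t(3) by (simp add: mult.assoc[symmetric] mult.commute)
    ultimately show ?thesis by (simp add: nY)
  qed
  ultimately show "\<exists>T. vlinear_on Y (type_space sc) E T \<and>
    (\<forall>y\<in>E. vnorm Y y \<le> vnorm (type_space sc) (T y) \<and> vnorm (type_space sc) (T y) \<le> (1 + \<epsilon>) * vnorm Y y)"
    by blast
qed

end

section \<open>Super-reflexive spaces\<close>

context ultra_span
begin

text \<open>
  The functionals \<open>H k\<close> induce functionals \<open>F k\<close> on \<open>Y\<close>, bounded by one constant, such that \<open>F k\<close> kills the
  class of \<open>s m\<close> for \<open>m \<le> k\<close> and has real part 1 there for \<open>m > k\<close>. If the weak-star limit \<open>\<Lambda>\<close> of these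
  classes were given by a point \<open>w\<close> of \<open>Y\<close>, every \<open>F k\<close> would have real part 1 at \<open>w\<close>. But \<open>w\<close> is close to
  a combination of the \<open>s m\<close> with \<open>m < N\<close>, which \<open>F N\<close> kills.
\<close>

theorem not_reflexive_Y:
  fixes H :: "nat \<Rightarrow> nat \<Rightarrow> 'a \<Rightarrow> 'k"
  assumes H_add: "\<And>k n x y. H k n (x + y) = H k n x + H k n y"
    and H_sc: "\<And>k n c x. H k n (sc c x) = c * H k n x"
    and H_bound: "\<And>k n x. norm (H k n x) \<le> C * norm x"
    and zero: "\<And>m k. m \<le> k \<Longrightarrow> eventually (\<lambda>n. H k n (s m n) = 0) ultra"
    and one: "\<And>m k. k < m \<Longrightarrow> eventually (\<lambda>n. re (H k n (s m n)) = 1) ultra"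
  shows "\<not> reflexive Y"
proof
  assume refl: "reflexive Y"
  interpret N: normed_space Y by (rule normed_space_Y)
  interpret ND: normed_space "dual Y" by (rule N.normed_space_dual)
  interpret re: bounded_linear re by (rule bl_re)
  have C: "norm (H k n x) \<le> \<bar>C\<bar> * norm x" for k n x
    using H_bound[of k n x] mult_right_mono[OF abs_ge_self[of C] norm_ge_zero[of x]] by linarith
  have H0: "H k n 0 = 0" for k n using H_add[of k n 0 0] by simp
  have H_diff: "H k n (x - y) = H k n x - H k n y" for k n x y
    using H_add[of k n "x - y" y] by simp
  have H_sum: "H k n (\<Sum>i\<in>I. f i) = (\<Sum>i\<in>I. H k n (f i))" for k n I and f :: "nat \<Rightarrow> 'a"
    by (induction I rule: infinite_finite_induct) (simp_all add: H0 H_add)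
  define L where "L k w = Lim ultra (\<lambda>n. H k n (w n))" for k w
  have L: "((\<lambda>n. H k n (w n)) \<longlongrightarrow> L k w) ultra" if w: "w \<in> W" for k w
  proof -
    obtain K where "eventually (\<lambda>n. norm (w n) \<le> K) ultra" using W_bounded[OF w] by blast
    then have "eventually (\<lambda>n. norm (H k n (w n)) \<le> \<bar>C\<bar> * K) ultra"
    proof eventually_elim
      case (elim n)
      then show ?case using C[of k n "w n"] mult_left_mono[OF elim, of "\<bar>C\<bar>"] by linarith
    qed
    from ultra_tendsto_scalar[OF this] obtain l where l: "((\<lambda>n. H k n (w n)) \<longlongrightarrow> l) ultra" ..
    then show ?thesis unfolding L_def tendsto_Lim[OF ultra(2) l] .
  qed
  have L_unique: "L k w = l" if "w \<in> W" "((\<lambda>n. H k n (w n)) \<longlongrightarrow> l) ultra" for k w l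
    using tendsto_unique[OF ultra(2) L[OF that(1)] that(2)] .
  have L_bound: "norm (L k w) \<le> \<bar>C\<bar> * ultra_norm w" if w: "w \<in> W" for k w
    by (rule tendsto_le[OF ultra(2) tendsto_mult_left[OF tendsto_ultra_norm[OF w]] tendsto_norm[OF L[OF w]]])
      (intro always_eventually allI C)
  have L_add: "L k (\<lambda>n. w n + v n) = L k w + L k v" if "w \<in> W" "v \<in> W" for k w v
    using tendsto_add[OF L[OF that(1), of k] L[OF that(2), of k]] by (intro L_unique W_add that) (simp add: H_add)
  have L_sc: "L k (\<lambda>n. sc c (w n)) = c * L k w" if "w \<in> W" for k w c
    using tendsto_mult_left[OF L[OF that, of k], of c] by (intro L_unique W_sc that) (simp add: H_sc)
  have L_cong: "L k w = L k v" if w: "w \<in> W" and v: "v \<in> W" and eq: "((\<lambda>n. w n - v n) \<longlongrightarrow> 0) ultra" for k w v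
  proof (rule L_unique[OF w])
    have "((\<lambda>n. H k n (w n - v n)) \<longlongrightarrow> 0) ultra"
    proof (rule Lim_null_comparison)
      show "eventually (\<lambda>n. norm (H k n (w n - v n)) \<le> \<bar>C\<bar> * norm (w n - v n)) ultra"
        by (intro always_eventually allI C)
      show "((\<lambda>n. \<bar>C\<bar> * norm (w n - v n)) \<longlongrightarrow> 0) ultra"
        using tendsto_mult_left[OF tendsto_norm_zero[OF eq], of "\<bar>C\<bar>"] by simp
    qed
    from tendsto_add[OF this L[OF v, of k]] show "((\<lambda>n. H k n (w n)) \<longlongrightarrow> L k v) ultra" by (simp add: H_diff)
  qed
  define F where "F k A = (if A \<in> vcarrier Y then L k (rep A) else 0)" for k A
  have F: "F k (ultra_class w) = L k w" if "w \<in> W" for k w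
    using that L_cong[OF rep_ultra_class_W[OF that] that rep_ultra_class] by (simp add: F_def ultra_class_carrier)
  have F_dual: "F k \<in> vcarrier (dual Y)" for k
    unfolding in_dual_iff
  proof (intro conjI ballI allI impI)
    fix A assume "A \<in> vcarrier Y"
    then obtain w where w: "w \<in> W" "A = ultra_class w" by (auto simp: carrier_Y)
    show "F k (vsmul Y c A) = c * F k A" for c
      by (simp add: w smul_Y F W_sc L_sc)
    fix A' assume "A' \<in> vcarrier Y"
    then obtain w' where w': "w' \<in> W" "A' = ultra_class w'" by (auto simp: carrier_Y)
    show "F k (vadd Y A A') = F k A + F k A'"
      by (simp add: w w' add_Y F W_add L_add)
  next
    have "norm (F k A) \<le> \<bar>C\<bar> * vnorm Y A" if "A \<in> vcarrier Y" for A
    proof -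
      obtain w where w: "w \<in> W" "A = ultra_class w" using \<open>A \<in> vcarrier Y\<close> by (auto simp: carrier_Y)
      show ?thesis using L_bound[OF w(1), of k] by (simp add: w F norm_Y)
    qed
    then show "\<exists>C. \<forall>A\<in>vcarrier Y. norm (F k A) \<le> C * vnorm Y A" by blast
  qed (simp add: F_def)
  define \<Lambda> where "\<Lambda> G = (if G \<in> vcarrier (dual Y) then Lim ultra (\<lambda>m. G (ultra_class (s m))) else 0)" for G
  have G_bound: "norm (G (ultra_class (s m))) \<le> vnorm (dual Y) G * M" if G: "G \<in> vcarrier (dual Y)" for G m
  proof -
    have "ultra_norm (s m) \<le> M" by (rule ultra_norm_le[OF W_s]) (simp add: s_bound)
    then have "vnorm (dual Y) G * ultra_norm (s m) \<le> vnorm (dual Y) G * M"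
      using ND.norm_nonneg[OF G] by (intro mult_left_mono)
    then show ?thesis using N.dual_bound[OF G ultra_class_carrier[OF W_s[of m]]] by (simp add: norm_Y[OF W_s])
  qed
  have \<Lambda>: "((\<lambda>m. G (ultra_class (s m))) \<longlongrightarrow> \<Lambda> G) ultra" if G: "G \<in> vcarrier (dual Y)" for G
  proof -
    have "eventually (\<lambda>m. norm (G (ultra_class (s m))) \<le> vnorm (dual Y) G * M) ultra"
      by (intro always_eventually allI G_bound[OF G])
    from ultra_tendsto_scalar[OF this] obtain l where l: "((\<lambda>m. G (ultra_class (s m))) \<longlongrightarrow> l) ultra" ..
    moreover have "\<Lambda> G = l" using G tendsto_Lim[OF ultra(2) l] by (simp add: \<Lambda>_def)
    ultimately show ?thesis by simp
  qed
  have \<Lambda>_unique: "\<Lambda> G = l" if "G \<in> vcarrier (dual Y)" "((\<lambda>m. G (ultra_class (s m))) \<longlongrightarrow> l) ultra" for G l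
    using tendsto_unique[OF ultra(2) \<Lambda>[OF that(1)] that(2)] .
  have "\<Lambda> \<in> vcarrier (bidual Y)"
    unfolding in_dual_iff[of _ "dual Y"]
  proof (intro conjI ballI allI impI)
    fix G assume G: "G \<in> vcarrier (dual Y)"
    show "\<Lambda> (vsmul (dual Y) c G) = c * \<Lambda> G" for c
      using ND.smul_closed[OF G, of c] tendsto_mult_left[OF \<Lambda>[OF G], of c] by (intro \<Lambda>_unique) simp_all
    fix G' assume G': "G' \<in> vcarrier (dual Y)"
    show "\<Lambda> (vadd (dual Y) G G') = \<Lambda> G + \<Lambda> G'"
      using ND.add_closed[OF G G'] tendsto_add[OF \<Lambda>[OF G] \<Lambda>[OF G']] by (intro \<Lambda>_unique) simp_all
  next
    have "norm (\<Lambda> G) \<le> M * vnorm (dual Y) G" if G: "G \<in> vcarrier (dual Y)" for G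
      by (rule tendsto_upperbound[OF tendsto_norm[OF \<Lambda>[OF G]] _ ultra(2)])
        (use G_bound[OF G] in \<open>simp add: mult.commute\<close>)
    then show "\<exists>C. \<forall>G\<in>vcarrier (dual Y). norm (\<Lambda> G) \<le> C * vnorm (dual Y) G" by blast
  qed (simp add: \<Lambda>_def)
  then obtain A where A: "A \<in> vcarrier Y" "\<Lambda> = canonical Y A"
    using refl unfolding reflexive_def by blast
  then obtain w where w: "w \<in> W" "A = ultra_class w" by (auto simp: carrier_Y)
  have re_one: "re (L k w) = 1" for k
  proof -
    have "L k w = \<Lambda> (F k)" using F_dual[of k] by (simp add: A(2) canonical_def w F)
    then have "((\<lambda>m. re (F k (ultra_class (s m)))) \<longlongrightarrow> re (L k w)) ultra"
      using re.tendsto[OF \<Lambda>[OF F_dual[of k]]] by simp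
    moreover have "re (F k (ultra_class (s m))) = 1" if "k < m" for m
    proof -
      have "((\<lambda>n. re (H k n (s m n))) \<longlongrightarrow> re (L k (s m))) ultra" by (rule re.tendsto[OF L[OF W_s]])
      moreover have "((\<lambda>n. re (H k n (s m n))) \<longlongrightarrow> 1) ultra" by (rule tendsto_eventually[OF one[OF that]])
      ultimately have "re (L k (s m)) = 1" by (rule tendsto_unique[OF ultra(2)])
      then show ?thesis by (simp add: F W_s)
    qed
    then have "((\<lambda>m. re (F k (ultra_class (s m)))) \<longlongrightarrow> 1) ultra"
      by (intro tendsto_ultra tendsto_eventually eventually_mono[OF eventually_gt_at_top[of k]])
    ultimately show ?thesis by (rule tendsto_unique[OF ultra(2)])
  qed
  define Q where "Q = onorm re * \<bar>C\<bar>"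
  have Q: "Q \<ge> 0" using onorm_pos_le[OF bl_re] by (simp add: Q_def)
  define \<delta> where "\<delta> = 1 / (2 * (Q + 1))"
  have "\<delta> > 0" using Q by (simp add: \<delta>_def)
  then obtain N a where Na: "eventually (\<lambda>n. norm (w n - lincomb N a n) < \<delta>) ultra" using WD[OF w(1)] by blast
  have "eventually (\<lambda>n. \<forall>m\<in>{..<N}. H N n (s m n) = 0) ultra"
    by (intro eventually_ball_finite ballI zero) auto
  with Na have "eventually (\<lambda>n. norm (re (H N n (w n))) \<le> Q * \<delta>) ultra"
  proof eventually_elim
    case (elim n)
    have "H N n (lincomb N a n) = 0" using elim(2) by (simp add: lincomb_def H_sum H_sc)
    then have "H N n (w n) = H N n (w n - lincomb N a n)" by (simp add: H_diff)
    then have "norm (H N n (w n)) \<le> \<bar>C\<bar> * norm (w n - lincomb N a n)" using C[of N n "w n - lincomb N a n"] by simp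
    also have "\<dots> \<le> \<bar>C\<bar> * \<delta>" using elim(1) by (intro mult_left_mono) auto
    finally have "onorm re * norm (H N n (w n)) \<le> onorm re * (\<bar>C\<bar> * \<delta>)"
      using onorm_pos_le[OF bl_re] by (rule mult_left_mono)
    then show ?case using onorm[OF bl_re, of "H N n (w n)"] by (simp add: Q_def mult.assoc)
  qed
  then have "norm (re (L N w)) \<le> Q * \<delta>"
    by (rule tendsto_upperbound[OF tendsto_norm[OF re.tendsto[OF L[OF w(1)]]] _ ultra(2)])
  moreover have "Q * \<delta> < 1" using Q by (simp add: \<delta>_def field_simps)
  ultimately show False using re_one[of N] by simp
qed

end

context scalar_banach
begin

text \<open>
  If for every \<open>n\<close> some subspace is flat with constant \<open>1 / (n + 1)\<close>, the first \<open>n\<close> partial sums of its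
  sequence are bounded by \<open>exp 1\<close>. Let \<open>s m n\<close> be the partial sum of length \<open>min m n\<close> for the index \<open>n\<close>.
  The functionals \<open>h n k\<close>, turned into functionals over the scalar field, have the properties required
  for a non-reflexive space of classes.
\<close>

theorem super_reflexive_not_flat:
  assumes sr: "super_reflexive (type_space sc)"
  shows "\<exists>\<epsilon>>0. \<forall>Y :: 'a set. subspace Y \<longrightarrow> (\<exists>e\<in>Y. norm e = 1) \<longrightarrow> \<not> flat Y \<epsilon>"
proof (rule ccontr)
  assume no: "\<not> ?thesis"
  define G where "G n x h \<longleftrightarrow> (\<forall>k. norm (h k) \<le> 3 \<and> blinfun_apply (h k) (x k) = 1) \<and>
      (\<forall>i k. i \<noteq> k \<longrightarrow> blinfun_apply (h k) (x i) = 0 \<and> blinfun_apply (h k) (sc ii (x i)) = 0) \<and>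
      (\<forall>m\<le>n. norm (\<Sum>i<m. x i) \<le> exp 1)"
    for n :: nat and x :: "nat \<Rightarrow> 'a" and h :: "nat \<Rightarrow> 'a \<Rightarrow>\<^sub>L real"
  have "\<exists>x h. G n x h" for n
  proof -
    let ?\<epsilon> = "1 / real (Suc n)"
    have "?\<epsilon> > 0" by simp
    then obtain Z :: "'a set" and e where Z: "subspace Z" "e \<in> Z" "norm e = 1" "flat Z ?\<epsilon>"
      using no by blast
    obtain x :: "nat \<Rightarrow> 'a" and h :: "nat \<Rightarrow> 'a \<Rightarrow>\<^sub>L real" where x:
      "\<And>k. x k \<in> Z" "\<And>k. norm (x k) = 1" "\<And>k. norm (h k) \<le> 3" "\<And>k. blinfun_apply (h k) (x k) = 1"
      "\<And>i k. i \<noteq> k \<Longrightarrow> blinfun_apply (h k) (x i) = 0 \<and> blinfun_apply (h k) (sc ii (x i)) = 0"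
      "\<And>n' j. norm (\<Sum>i | i < n' \<and> i mod 1 = j. x i) \<le> exp (\<Sum>i<n'. ?\<epsilon>)"
      by (rule flat_sequence[where eps = "\<lambda>_. ?\<epsilon>", OF Z(1,2,3,4) \<open>?\<epsilon> > 0\<close> zero_less_one bounded_linear_sc]) (rule that, assumption+)
    have "norm (\<Sum>i<m. x i) \<le> exp 1" if "m \<le> n" for m
    proof -
      have "{i. i < m \<and> i mod 1 = 0} = {..<m}" by auto
      then have "norm (\<Sum>i<m. x i) \<le> exp (\<Sum>i<m. ?\<epsilon>)" using x(6)[of m 0] by simp
      also have "\<dots> \<le> exp 1" using that by (simp add: field_simps)
      finally show ?thesis .
    qed
    then show ?thesis using x(3,4,5) unfolding G_def by blast
  qed
  then have "\<forall>n. \<exists>p. G n (fst p) (snd p)" by simp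
  from choice[OF this] obtain p where p: "\<And>n. G n (fst (p n)) (snd (p n))" by blast
  define x where "x n = fst (p n)" for n
  define h where "h n = snd (p n)" for n
  have G: "G n (x n) (h n)" for n using p by (simp add: x_def h_def)
  have x: "norm (h n k) \<le> 3" "blinfun_apply (h n k) (x n k) = 1" for n k
    using G[of n] by (simp_all add: G_def)
  have h0: "blinfun_apply (h n k) (x n i) = 0 \<and> blinfun_apply (h n k) (sc ii (x n i)) = 0" if "i \<noteq> k" for n k i
    using G[of n] that by (simp add: G_def)
  have x_sum: "norm (\<Sum>i<m. x n i) \<le> exp 1" if "m \<le> n" for n m
    using G[of n] that by (simp add: G_def)
  \<comment> \<open>Truncation at \<open>n\<close> keeps \<open>s\<close> bounded; it only affects the finitely many indices \<open>n < m\<close>.\<close>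
  define s where "s m n = (\<Sum>i<min m n. x n i)" for m n
  interpret ultra_span sc ii re s "exp 1"
    by unfold_locales (simp add: s_def x_sum)
  define H where "H k n = complexify (blinfun_apply (h n k))" for k n
  have H_dual: "H k n \<in> vcarrier (dual (type_space sc))" for k n
    unfolding H_def by (intro complexify_in_dual blinfun.bounded_linear_right)
  have H_add: "H k n (u + v) = H k n u + H k n v" and H_sc: "H k n (sc c u) = c * H k n u" for k n u v c
    using H_dual[of k n] by (simp_all add: in_dual_iff)
  have H0: "H k n 0 = 0" for k n using H_add[of k n 0 0] by simp
  have H_sum: "H k n (\<Sum>i\<in>I. f i) = (\<Sum>i\<in>I. H k n (f i))" for k n I and f :: "nat \<Rightarrow> 'a"
    by (induction I rule: infinite_finite_induct) (simp_all add: H0 H_add)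
  have H_bound: "norm (H k n u) \<le> (3 + norm ii * (3 * norm ii)) * norm u" for k n u
  proof -
    have b: "\<bar>blinfun_apply (h n k) v\<bar> \<le> 3 * norm v" for v
      using blinfun_abs_le[of "h n k" v] mult_right_mono[OF x(1)[of n k], of "norm v"] by simp
    show ?thesis unfolding H_def by (rule norm_complexify_le[OF b])
  qed
  have Hx: "H k n (x n i) = 0" if "i \<noteq> k" for k n i
    using h0[OF that] by (simp add: H_def complexify_def)
  have Hs: "H k n (s m n) = (if k < min m n then H k n (x n k) else 0)" for k n m
  proof -
    have "H k n (s m n) = (\<Sum>i<min m n. if i = k then H k n (x n k) else 0)"
      unfolding s_def H_sum by (intro sum.cong) (auto simp: Hx)
    then show ?thesis by simp
  qed
  have "\<not> reflexive Y"
  proof (rule not_reflexive_Y[OF H_add H_sc H_bound])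
    show "eventually (\<lambda>n. H k n (s m n) = 0) ultra" if "m \<le> k" for m k
      using that by (intro always_eventually allI) (simp add: Hs)
    show "eventually (\<lambda>n. re (H k n (s m n)) = 1) ultra" if "k < m" for m k
    proof -
      have "eventually (\<lambda>n. k < n) ultra"
        using ultra(1) eventually_gt_at_top[of k] by (auto simp: le_filter_def)
      then show ?thesis
      proof eventually_elim
        case (elim n)
        have "re (H k n (x n k)) = 1" unfolding H_def re_complexify by (rule x(2))
        then show ?case using elim that by (simp add: Hs)
      qed
    qed
  qed
  then show False
    using sr banach_space_Y finitely_representable_Y unfolding super_reflexive_def by blast
qed

end

section \<open>Separated subsets of the unit sphere\<close>

lemma infinite_dens:
  assumes infdim: "\<And>B :: 'a::real_normed_vector set. finite B \<Longrightarrow> span B \<noteq> UNIV"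
  shows "Card_order (dens (UNIV :: 'a set))" "infinite (Field (dens (UNIV :: 'a set)))"
proof -
  have "\<exists>D. (D \<subseteq> UNIV \<and> UNIV \<subseteq> closure D) \<and> dens (UNIV :: 'a set) = |D|"
    unfolding dens_def by (rule least_card(1)[of _ UNIV]) simp
  then obtain D :: "'a set" where D: "closure D = UNIV" "dens (UNIV :: 'a set) = |D|" by blast
  have "infinite D"
  proof
    assume "finite D"
    then have "closure D = D" by (simp add: finite_imp_closed)
    then show False using infdim[OF \<open>finite D\<close>] D(1) by simp
  qed
  then show "Card_order (dens (UNIV :: 'a set))" "infinite (Field (dens (UNIV :: 'a set)))"
    unfolding D(2) by (simp_all add: Field_card_of card_of_card_order_on)
qed

lemma not_flatD:
  fixes Y :: "'a::real_normed_vector set"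
  assumes "\<not> flat Y \<epsilon>"
  obtains x and F :: "('a \<Rightarrow>\<^sub>L real) set" where "x \<in> Y" "norm x = 1" "finite F"
    "\<And>z. z \<in> Y \<Longrightarrow> norm z = 1 \<Longrightarrow> (\<And>f. f \<in> F \<Longrightarrow> blinfun_apply f z = 0) \<Longrightarrow> 1 + \<epsilon> \<le> norm (x + z)"
  using assms unfolding flat_def by (meson not_less)

theorem theoremB:
  fixes sc :: "'k::real_or_complex \<Rightarrow> 'a::banach \<Rightarrow> 'a"
  assumes "banach_space (type_space sc)"
    and "infinite_dimensional (type_space sc)"
    and "quasi_reflexive (type_space sc)"
  shows "(\<exists>A \<subseteq> sphere (0::'a) 1.
            symmetrically_plus_separated 1 A \<and> |A| =o dens (UNIV :: 'a set)) \<and>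
         (\<forall>\<kappa> :: 'c rel.
            Card_order \<kappa> \<and> \<kappa> \<le>o dens (UNIV :: 'a set) \<and> natLeq <o cofinality \<kappa> \<longrightarrow>
            (\<exists>\<epsilon>>0. \<exists>A \<subseteq> sphere (0::'a) 1. symmetrically_separated (1 + \<epsilon>) A \<and> |A| =o \<kappa>)) \<and>
         (super_reflexive (type_space sc) \<longrightarrow>
            (\<exists>\<epsilon>>0. \<exists>A \<subseteq> sphere (0::'a) 1.
               symmetrically_separated (1 + \<epsilon>) A \<and> |A| =o dens (UNIV :: 'a set)))"
proof -
  obtain ii :: 'k and re where parts: "scalar_parts ii re" using exists_scalar_parts by blast
  interpret scalar_banach sc ii re by (rule scalar_banach.intro[OF assms(1) parts])
  let ?r = "dens (UNIV :: 'a set)"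
  have infdim: "span B \<noteq> (UNIV :: 'a set)" if "finite B" for B
    by (rule infinite_dimensional_real[OF assms(2) that])
  note r = infinite_dens[OF infdim]
  obtain d where fd: "finite_deficiency TYPE('a) d"
    using quasi_reflexive_imp_finite_deficiency[OF assms(3)] by blast
  \<comment> \<open>The construction with constants in a prescribed set: all positive numbers for the first two
    parts, a single number for the third.\<close>
  have family: "\<exists>A e. A \<subseteq> sphere (0::'a) 1 \<and> |A| =o ?r \<and> (\<forall>a\<in>A. e a \<in> Eps) \<and>
      (\<forall>a\<in>A. \<forall>b\<in>A. a \<noteq> b \<longrightarrow> (\<exists>k\<in>{a, b}. 1 + e k \<le> norm (a + b) \<and> 1 + e k \<le> norm (a - b)))"
    if Eps: "Eps \<subseteq> {0<..}" and nf: "\<And>Y :: 'a set. subspace Y \<Longrightarrow> (\<exists>e\<in>Y. norm e = 1) \<Longrightarrow> \<exists>\<epsilon>\<in>Eps. \<not> flat Y \<epsilon>"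
    for Eps
  proof -
    have "\<exists>x F \<epsilon>. norm x = 1 \<and> (\<forall>f\<in>\<Phi>. blinfun_apply f x = 0) \<and> finite F \<and> \<epsilon> \<in> Eps \<and>
        (\<forall>z. norm z = 1 \<longrightarrow> (\<forall>f\<in>\<Phi> \<union> F. blinfun_apply f z = 0) \<longrightarrow> 1 + \<epsilon> \<le> norm (x + z))"
      if \<Phi>: "|\<Phi>| <o ?r" for \<Phi> :: "('a \<Rightarrow>\<^sub>L real) set"
    proof -
      let ?Y = "{v. \<forall>f\<in>\<Phi>. blinfun_apply f v = 0}"
      have "subspace ?Y"
        by (intro subspaceI) (auto simp: blinfun.add_right blinfun.scaleR_right)
      moreover obtain v where "norm v = 1" "\<And>f. f \<in> \<Phi> \<Longrightarrow> blinfun_apply f v = 0"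
        using common_kernel_nontrivial[OF fd infdim \<Phi>] by blast
      then have "\<exists>e\<in>?Y. norm e = 1" by blast
      ultimately obtain \<epsilon> where \<epsilon>: "\<epsilon> \<in> Eps" "\<not> flat ?Y \<epsilon>" using nf by blast
      obtain x and F :: "('a \<Rightarrow>\<^sub>L real) set" where xF: "x \<in> ?Y" "norm x = 1" "finite F"
        "\<And>z. z \<in> ?Y \<Longrightarrow> norm z = 1 \<Longrightarrow> (\<And>f. f \<in> F \<Longrightarrow> blinfun_apply f z = 0) \<Longrightarrow> 1 + \<epsilon> \<le> norm (x + z)"
        by (rule not_flatD[OF \<epsilon>(2)]) blast
      have "1 + \<epsilon> \<le> norm (x + z)" if "norm z = 1" "\<forall>f\<in>\<Phi> \<union> F. blinfun_apply f z = 0" for z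
        using that by (intro xF(4)) auto
      then show ?thesis using xF(1,2,3) \<epsilon>(1) by blast
    qed
    from transfinite_separated_set[OF r Eps this] show ?thesis by metis
  qed
  have nf: "\<exists>\<epsilon>\<in>{0<..}. \<not> flat Y \<epsilon>" if "subspace Y" "\<exists>e\<in>Y. norm e = 1" for Y :: "'a set"
    using finite_deficiency_not_flat[OF fd that(1)] that(2) by auto
  have "\<exists>A e. A \<subseteq> sphere (0::'a) 1 \<and> |A| =o ?r \<and> (\<forall>a\<in>A. e a \<in> {0<..}) \<and>
      (\<forall>a\<in>A. \<forall>b\<in>A. a \<noteq> b \<longrightarrow> (\<exists>k\<in>{a, b}. 1 + e k \<le> norm (a + b) \<and> 1 + e k \<le> norm (a - b)))"
    by (rule family[OF subset_refl]) (rule nf)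
  then obtain A and e :: "'a \<Rightarrow> real" where A: "A \<subseteq> sphere 0 1" "|A| =o ?r" and e: "\<forall>a\<in>A. e a \<in> {0<..}"
    and sep: "\<forall>a\<in>A. \<forall>b\<in>A. a \<noteq> b \<longrightarrow> (\<exists>k\<in>{a, b}. 1 + e k \<le> norm (a + b) \<and> 1 + e k \<le> norm (a - b))"
    by (elim exE conjE)
  have e_pos: "e a > 0" if "a \<in> A" for a using e that by auto
  have A_sep: "\<exists>k\<in>{a, b}. 1 + e k \<le> norm (a + b) \<and> 1 + e k \<le> norm (a - b)"
    if "a \<in> A" "b \<in> A" "a \<noteq> b" for a b using sep that by blast
  have "symmetrically_plus_separated 1 A"
    unfolding symmetrically_plus_separated_def
  proof (intro ballI impI)
    fix a b assume ab: "a \<in> A" "b \<in> A" "a \<noteq> b"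
    from A_sep[OF this] obtain k where k: "k \<in> {a, b}" "1 + e k \<le> norm (a + b)" "1 + e k \<le> norm (a - b)" by blast
    then have "e k > 0" using e_pos ab by blast
    then show "1 < norm (a - b) \<and> 1 < norm (a + b)" using k by linarith
  qed
  then have i: "\<exists>A \<subseteq> sphere (0::'a) 1. symmetrically_plus_separated 1 A \<and> |A| =o ?r" using A(1,2) by blast
  have ii: "\<exists>\<epsilon>>0. \<exists>A \<subseteq> sphere (0::'a) 1. symmetrically_separated (1 + \<epsilon>) A \<and> |A| =o \<kappa>"
    if \<kappa>: "Card_order \<kappa>" "\<kappa> \<le>o ?r" "natLeq <o cofinality \<kappa>" for \<kappa> :: "'c rel"
  proof (rule separated_set_of_uniform_size[OF A(1) e_pos A_sep \<kappa>(1) _ \<kappa>(3)])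
    show "\<kappa> \<le>o |A|" using \<kappa>(2) A(2) ordIso_symmetric ordLeq_ordIso_trans by blast
  qed
  have iii: "\<exists>\<epsilon>>0. \<exists>A \<subseteq> sphere (0::'a) 1. symmetrically_separated (1 + \<epsilon>) A \<and> |A| =o ?r"
    if sr: "super_reflexive (type_space sc)"
  proof -
    obtain \<epsilon> where \<epsilon>: "\<epsilon> > 0" "\<And>Y :: 'a set. subspace Y \<Longrightarrow> \<exists>e\<in>Y. norm e = 1 \<Longrightarrow> \<not> flat Y \<epsilon>"
      using super_reflexive_not_flat[OF sr] by blast
    have "\<exists>A e. A \<subseteq> sphere (0::'a) 1 \<and> |A| =o ?r \<and> (\<forall>a\<in>A. e a \<in> {\<epsilon>}) \<and>
      (\<forall>a\<in>A. \<forall>b\<in>A. a \<noteq> b \<longrightarrow> (\<exists>k\<in>{a, b}. 1 + e k \<le> norm (a + b) \<and> 1 + e k \<le> norm (a - b)))"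
      by (rule family) (use \<epsilon> in auto)
    then obtain A' and e' :: "'a \<Rightarrow> real" where A': "A' \<subseteq> sphere 0 1" "|A'| =o ?r" and e': "\<forall>a\<in>A'. e' a \<in> {\<epsilon>}"
      and sep': "\<forall>a\<in>A'. \<forall>b\<in>A'. a \<noteq> b \<longrightarrow> (\<exists>k\<in>{a, b}. 1 + e' k \<le> norm (a + b) \<and> 1 + e' k \<le> norm (a - b))"
      by (elim exE conjE)
    have "symmetrically_separated (1 + \<epsilon>) A'"
      unfolding symmetrically_separated_def
    proof (intro ballI impI)
      fix a b assume ab: "a \<in> A'" "b \<in> A'" "a \<noteq> b"
      with sep' obtain k where k: "k \<in> {a, b}" "1 + e' k \<le> norm (a + b)" "1 + e' k \<le> norm (a - b)" by blast
      have "e' k = \<epsilon>" using k(1) e' ab by blast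
      then show "1 + \<epsilon> \<le> norm (a - b) \<and> 1 + \<epsilon> \<le> norm (a + b)" using k by simp
    qed
    then show ?thesis using A'(1,2) \<epsilon>(1) by blast
  qed
  show ?thesis using i ii iii by blast
qed

end
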